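(* Let $I_{\rm ref}=(-1,1)$, let $\alpha\in(k-1,k)$ with $k,m\in\mathbb N$, and let $p$ be an integer with $1/2<\alpha+m<p+1$. Then for every $\omega\in\mathcal U^{\alpha,m}_{-1+}(I_{\rm ref})$, $$\|\omega-\Pi_p^-\omega\|_{L^2(I_{\rm ref})}\le C\,p^{-\min\{2\alpha+1,\;\alpha+m-1/2\}}\,U^{\alpha,m}_{-1+}(\omega;I_{\rm ref}),$$ $$\|\omega-\Pi_p^+\omega\|_{L^2(I_{\rm ref})}\le C\,p^{-\min\{2\alpha+1/2,\;\alpha+m-1/2\}}\,U^{\alpha,m}_{-1+}(\omega;I_{\rm ref}),$$ and $$|\omega(\pm1)-\Pi_p^\pm\omega(\pm1)|\le C\,p^{-\min\{2\alpha,\;\alpha+m-1/2\}}\,U^{\alpha,m}_{-1+}(\omega;I_{\rm ref}),$$ where $C$ is a positive constant independent of $p$ and $\omega$ (in the last estimate the same sign is taken throughout).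
   Context: Convention: $\mathbb N=\{1,2,\dots\}$; $\mathcal P_p$ denotes polynomials of degree at most $p$. Gauss--Radau projections: for $\omega\in W^{1,1}(I_{\rm ref})$, $\Pi_p^\pm\omega\in\mathcal P_p$ is the polynomial satisfying $\int_{-1}^1(\Pi_p^\pm\omega-\omega)\,v\,d\xi=0$ for all $v\in\mathcal P_{p-1}$ and $\Pi_p^\pm\omega(\mp1)=\omega(\mp1)$ (so $\Pi_p^-$ interpolates at $+1$ and $\Pi_p^+$ interpolates at $-1$). Fractional space: for $\alpha\in(k-1,k)$, the left Caputo derivative is ${}^CD^\alpha_{-1+}\omega(\xi)=\frac1{\Gamma(k-\alpha)}\int_{-1}^\xi(\xi-\tau)^{k-\alpha-1}\omega^{(k)}(\tau)\,d\tau$. Define $\mathcal U^{\alpha,m}_{-1+}(I_{\rm ref})=\{\omega\in W^{k,1}(I_{\rm ref}):\ {}^CD^\alpha_{-1+}\omega\in W^{m,1}(I_{\rm ref})\}$ with semi-norm $$U^{\alpha,m}_{-1+}(\omega;I_{\rm ref})=\big\|D^m({}^CD^\alpha_{-1+}\omega)\big\|_{L^1(I_{\rm ref})}+\sum_{i=0}^{m-1}\big|D^i({}^CD^\alpha_{-1+}\omega)(-1+)\big|,$$ where $D^i$ is the $i$-th ordinary derivative. *)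

theory Defs
  imports "HOL-Analysis.Analysis" "HOL-Computational_Algebra.Polynomial"
begin

abbreviation I_ref :: "real set" where
  "I_ref \<equiv> {-1<..<1}"

definition test_function :: "real set \<Rightarrow> (real \<Rightarrow> real) \<Rightarrow> bool" where
  "test_function S \<phi> \<longleftrightarrow>
     (\<forall>n. (deriv ^^ n) \<phi> differentiable_on UNIV) \<and>
     compact (closure {x. \<phi> x \<noteq> 0}) \<and> closure {x. \<phi> x \<noteq> 0} \<subseteq> S"

definition locally_integrable_on :: "(real \<Rightarrow> real) \<Rightarrow> real set \<Rightarrow> bool"
    (infixr "locally'_integrable'_on" 46) where
  "f locally_integrable_on S \<longleftrightarrow> (\<forall>K. compact K \<and> K \<subseteq> S \<longrightarrow> f absolutely_integrable_on K)"

definition has_weak_deriv :: "real set \<Rightarrow> nat \<Rightarrow> (real \<Rightarrow> real) \<Rightarrow> (real \<Rightarrow> real) \<Rightarrow> bool" where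
  "has_weak_deriv S n f g \<longleftrightarrow>
     f locally_integrable_on S \<and> g locally_integrable_on S \<and>
     (\<forall>\<phi>. test_function S \<phi> \<longrightarrow>
        (LINT x:S|lebesgue. f x * (deriv ^^ n) \<phi> x) =
        (- 1) ^ n * (LINT x:S|lebesgue. g x * \<phi> x))"

text \<open>Elements of the Sobolev spaces are represented by functions that matter only up to
  equality almost everywhere on \<open>S\<close>. A weak derivative is unique up to a null set, so the choice
  made by the following operator is irrelevant.\<close>

definition weak_deriv :: "real set \<Rightarrow> nat \<Rightarrow> (real \<Rightarrow> real) \<Rightarrow> real \<Rightarrow> real" where
  "weak_deriv S n f = (SOME g. has_weak_deriv S n f g)"

text \<open>The space \<open>W\<close> with indices \<open>n\<close> and \<open>1\<close> on \<open>S\<close>.\<close>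

definition sobolev1 :: "real set \<Rightarrow> nat \<Rightarrow> (real \<Rightarrow> real) set" where
  "sobolev1 S n = {f. f absolutely_integrable_on S \<and>
     (\<forall>i\<le>n. \<exists>g. g absolutely_integrable_on S \<and> has_weak_deriv S i f g)}"

text \<open>Point values of a Sobolev function on an interval are those of its continuous
  representative, whose values on the closure of the interval are uniquely determined.\<close>

definition cont_rep :: "real set \<Rightarrow> (real \<Rightarrow> real) \<Rightarrow> real \<Rightarrow> real" where
  "cont_rep S f = (SOME F. continuous_on (closure S) F \<and>
     (AE x in lebesgue. x \<in> S \<longrightarrow> F x = f x))"

text \<open>The two norms are used only for integrable, respectively square-integrable functions;
  functions in \<open>sobolev1 I_ref 1\<close> have a bounded representative.\<close>

definition L1_norm :: "real set \<Rightarrow> (real \<Rightarrow> real) \<Rightarrow> real" where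
  "L1_norm S f = (LINT x:S|lebesgue. \<bar>f x\<bar>)"

definition L2_norm :: "real set \<Rightarrow> (real \<Rightarrow> real) \<Rightarrow> real" where
  "L2_norm S f = sqrt (LINT x:S|lebesgue. (f x)\<^sup>2)"

text \<open>Intended for \<open>real k - 1 < \<alpha> < real k\<close>.\<close>

definition caputo :: "nat \<Rightarrow> real \<Rightarrow> (real \<Rightarrow> real) \<Rightarrow> real \<Rightarrow> real" where
  "caputo k \<alpha> \<omega> \<xi> = 1 / Gamma (real k - \<alpha>) *
     (LINT \<tau>:{-1<..<\<xi>}|lebesgue. (\<xi> - \<tau>) powr (real k - \<alpha> - 1) * weak_deriv I_ref k \<omega> \<tau>)"

definition U_space :: "nat \<Rightarrow> real \<Rightarrow> nat \<Rightarrow> (real \<Rightarrow> real) set" where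
  "U_space k \<alpha> m = {\<omega> \<in> sobolev1 I_ref k. caputo k \<alpha> \<omega> \<in> sobolev1 I_ref m}"

definition U_seminorm :: "nat \<Rightarrow> real \<Rightarrow> nat \<Rightarrow> (real \<Rightarrow> real) \<Rightarrow> real" where
  "U_seminorm k \<alpha> m \<omega> =
     L1_norm I_ref (weak_deriv I_ref m (caputo k \<alpha> \<omega>)) +
     (\<Sum>i<m. \<bar>Lim (at_right (-1)) (cont_rep I_ref (weak_deriv I_ref i (caputo k \<alpha> \<omega>)))\<bar>)"

text \<open>The Gauss--Radau projection of degree \<open>p\<close> interpolating at the endpoint \<open>a\<close>.\<close>

definition radau_proj :: "real \<Rightarrow> nat \<Rightarrow> (real \<Rightarrow> real) \<Rightarrow> real poly" where
  "radau_proj a p \<omega> = (THE q. degree q \<le> p \<and>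
     (\<forall>v :: real poly. degree v < p \<longrightarrow>
        (LINT \<xi>:I_ref|lebesgue. (poly q \<xi> - \<omega> \<xi>) * poly v \<xi>) = 0) \<and>
     poly q a = cont_rep I_ref \<omega> a)"

text \<open>The superscript is opposite to the sign of the interpolation point.\<close>

abbreviation radau_minus :: "nat \<Rightarrow> (real \<Rightarrow> real) \<Rightarrow> real poly" where
  "radau_minus \<equiv> radau_proj 1"

abbreviation radau_plus :: "nat \<Rightarrow> (real \<Rightarrow> real) \<Rightarrow> real poly" where
  "radau_plus \<equiv> radau_proj (-1)"

end

theory Submission
  imports Defs
begin

text \<open>
  Write \<open>\<omega>\<close> as a polynomial of degree less than \<open>k\<close>, plus boundary terms
  \<open>d\<^sub>i (1 + x) powr (\<alpha> + i)\<close> for \<open>i < m\<close>, plus the Riemann--Liouville integral of order \<open>\<alpha> + m\<close> of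
  \<open>h = D\<^sup>m (\<^sup>CD\<^sup>\<alpha> \<omega>)\<close>; the semi-norm is exactly \<open>\<parallel>h\<parallel> + \<Sum>\<bar>d\<^sub>i\<bar>\<close>. The polynomial part is
  reproduced by the projections, because \<open>p \<ge> k\<close>.

  With \<open>b\<^sub>n = \<integral> \<omega>' P\<^sub>n\<close> (Legendre polynomials), integration by parts shows that the error at the
  free endpoint is \<open>\<plusminus> b\<^sub>p\<close> and that the \<open>L\<^sup>2\<close> projection of degree \<open>p\<close> misses the endpoint
  values by \<open>(b\<^sub>p \<plusminus> b\<^sub>p\<^sub>+\<^sub>1) / 2\<close>. So everything reduces to bounding \<open>b\<^sub>n\<close> and the Legendre
  coefficients of \<open>\<omega>\<close>, hence to Legendre moments of \<open>(1 + x) powr \<beta>\<close>, which satisfy a two-term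
  recurrence in \<open>n\<close>, and to the tails \<open>\<integral>\<^sub>t\<^sup>1 (x - t) powr (g - 1) P\<^sub>n(x) dx\<close>, uniformly in \<open>t\<close>. By
  Mehler's formula the tail at \<open>t = cos \<theta>\<close> is a multiple of
  \<open>\<integral>\<^sub>0\<^sup>\<theta> cos ((n + 1/2) \<phi>) (cos \<phi> - cos \<theta>) powr (g - 1/2) d\<phi>\<close>, and the second mean value theorem
  bounds this oscillatory integral by \<open>n powr (- min (2 g) (g + 1/2))\<close>.
\<close>

section \<open>Set integrals\<close>

text \<open>The function \<open>h\<close> is only integrable, so it can enter only through its
  \<open>L1\<close> norm; this forces bounds on the Legendre tails that are uniform in
  \<open>t\<close>. The rate \<open>2 * g\<close> in \<open>min (2 * g) (g + 1 / 2)\<close> comes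
  from \<open>t\<close> near 1 and -1, where \<open>cos\<close> is flat, and it matters only for
  \<open>g < 1 / 2\<close>.

  The two projections differ because the singular terms \<open>(1 + x) powr (\<alpha> + i)\<close>
  sit at -1. Consecutive Legendre moments of such a power have the ratio
  \<open>(b - n) / (n + b + 2)\<close>, close to -1. In the sum of two neighbouring functional
  values, which governs the endpoint 1, they cancel to leading order; in the difference, which
  governs -1, they reinforce each other. Correcting the \<open>L2\<close> projection at 1 therefore
  costs no more than the projection error itself. Correcting it at -1 gives
  \<open>2 * \<alpha>\<close> from the functional and \<open>1 / 2\<close> from the
  \<open>L2\<close> size of the Legendre polynomial of degree \<open>p\<close>, hence the exponent
  \<open>2 * \<alpha> + 1 / 2\<close>.\<close>

lemma LINT_eq_diff:
  fixes F f :: "real \<Rightarrow> real"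
  assumes "a \<le> b" "continuous_on {a..b} F"
    and "\<And>x. a < x \<Longrightarrow> x < b \<Longrightarrow> (F has_real_derivative f x) (at x)"
    and int: "set_integrable lebesgue {a<..<b} f"
  shows "(LINT x:{a<..<b}|lebesgue. f x) = F b - F a"
proof -
  have "(f has_integral (F b - F a)) {a..b}"
    using assms(1-3)
    by (intro fundamental_theorem_of_calculus_interior)
       (auto simp flip: has_real_derivative_iff_has_vector_derivative)
  then have "integral {a<..<b} f = F b - F a"
    by (simp add: has_integral_Icc_iff_Ioo integral_unique)
  then show ?thesis using int by (simp add: set_lebesgue_integral_eq_integral)
qed

lemma set_integrable_mult_continuous:
  fixes f g :: "real \<Rightarrow> real"
  assumes f: "set_integrable lebesgue {a<..<b} f" and g: "continuous_on {a..b} g"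
  shows "set_integrable lebesgue {a<..<b} (\<lambda>x. f x * g x)"
proof -
  have "bounded (g ` {a<..<b})"
    by (rule bounded_subset[OF compact_imp_bounded[OF compact_continuous_image[OF g]]]) auto
  moreover have "g \<in> borel_measurable (lebesgue_on {a<..<b})"
    by (intro continuous_imp_measurable_on_sets_lebesgue)
       (auto intro: continuous_on_subset[OF g])
  ultimately have "(\<lambda>x. g x * f x) absolutely_integrable_on {a<..<b}"
    using f by (intro absolutely_integrable_bounded_measurable_product_real) auto
  then show ?thesis by (simp add: mult.commute)
qed

lemma set_integrable_continuous:
  fixes g :: "real \<Rightarrow> real"
  assumes "continuous_on {a..b} g"
  shows "set_integrable lebesgue {a<..<b} g"
  by (rule set_integrable_subset[of _ "{a..b}"])
     (auto intro: absolutely_integrable_continuous_real[OF assms])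

text \<open>The affine substitution \<open>x = t + (X - t) * u\<close> reduces this to the Beta
  integral on the unit interval; nonnegativity upgrades its existence to absolute integrability. The
  singular kernels with a single factor are the case where the other exponent is
  \<open>1 - 1\<close>.\<close>

lemma Beta_interval:
  fixes a b t X :: real
  assumes "a > 0" "b > 0" "t < X"
  shows "set_integrable lebesgue {t<..<X} (\<lambda>x. (x - t) powr (a - 1) * (X - x) powr (b - 1))"
    and "(LINT x:{t<..<X}|lebesgue. (x - t) powr (a - 1) * (X - x) powr (b - 1)) = (X - t) powr (a + b - 1) * Beta a b"
proof -
  let ?f = "\<lambda>x. (x - t) powr (a - 1) * (X - x) powr (b - 1)"
  let ?g = "\<lambda>u. t + (X - t) * u"
  have im: "?g ` {0<..<1} = {t<..<X}"
  proof -
    have "x \<in> ?g ` {0<..<1}" if "t < x" "x < X" for x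
      by (rule image_eqI[of _ _ "(x - t) / (X - t)"]) (use that in \<open>auto simp: field_simps\<close>)
    moreover have "?g u < X" if "u < 1" "0 < u" for u
    proof -
      have "(X - t) * u < (X - t) * 1" using assms that by (intro mult_strict_left_mono) auto
      then show ?thesis unfolding mult_1_right by linarith
    qed
    ultimately show ?thesis using assms by auto
  qed
  have hi: "((\<lambda>u. u powr (a - 1) * (1 - u) powr (b - 1)) has_integral Beta a b) {0<..<1}"
    using has_integral_Beta_real[of a b] assms by (simp add: has_integral_Icc_iff_Ioo)
  have eq: "\<bar>X - t\<bar> * ?f (?g u) = (X - t) powr (a + b - 1) * (u powr (a - 1) * (1 - u) powr (b - 1))"
    if "u \<in> {0<..<1}" for u
  proof -
    have "X - ?g u = (X - t) * (1 - u)" by (simp add: algebra_simps)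
    then have "?f (?g u) = (X - t) powr (a - 1) * (X - t) powr (b - 1) * (u powr (a - 1) * (1 - u) powr (b - 1))"
      using that assms by (simp add: powr_mult)
    moreover have "(X - t) powr (a + b - 1) = (X - t) powr 1 * (X - t) powr (a - 1) * (X - t) powr (b - 1)"
      by (simp only: powr_add[symmetric]) (simp add: algebra_simps)
    ultimately show ?thesis using assms by simp
  qed
  have "((\<lambda>u. \<bar>X - t\<bar> * ?f (?g u)) has_integral (X - t) powr (a + b - 1) * Beta a b) {0<..<1}"
    by (rule has_integral_eq[OF _ has_integral_mult_right[OF hi]]) (simp only: eq)
  then have "(\<lambda>u. \<bar>X - t\<bar> * ?f (?g u)) absolutely_integrable_on {0<..<1} \<and>
     integral {0<..<1} (\<lambda>u. \<bar>X - t\<bar> * ?f (?g u)) = (X - t) powr (a + b - 1) * Beta a b"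
    by (auto simp: has_integral_iff intro!: nonnegative_absolutely_integrable_1)
  then have "?f absolutely_integrable_on ?g ` {0<..<1} \<and> integral (?g ` {0<..<1}) ?f = (X - t) powr (a + b - 1) * Beta a b"
    by (subst has_absolute_integral_change_of_variables_1'[symmetric, where g' = "\<lambda>_. X - t"])
       (use assms in \<open>auto intro!: derivative_eq_intros inj_onI\<close>)
  then show "set_integrable lebesgue {t<..<X} ?f"
    and "(LINT x:{t<..<X}|lebesgue. ?f x) = (X - t) powr (a + b - 1) * Beta a b"
    unfolding im by (auto simp: set_lebesgue_integral_eq_integral)
qed

lemma set_integrable_powr_left:
  fixes b t X :: real
  assumes "b > -1"
  shows "set_integrable lebesgue {t<..<X} (\<lambda>x. (x - t) powr b)"
proof (cases "t < X")
  case True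
  have "set_integrable lebesgue {t<..<X} (\<lambda>x. (x - t) powr (b + 1 - 1) * (X - x) powr (1 - 1))"
    by (rule Beta_interval) (use assms True in auto)
  also have "?this \<longleftrightarrow> ?thesis" by (intro set_integrable_cong) auto
  finally show ?thesis .
qed (simp add: set_integrable_def)

section \<open>Changes on null sets and Borel representatives\<close>

lemma absolutely_integrable_cong_AE:
  fixes f g :: "real \<Rightarrow> real"
  assumes "AE x in lebesgue. x \<in> S \<longrightarrow> f x = g x" "f absolutely_integrable_on S"
  shows "g absolutely_integrable_on S"
proof -
  obtain N where N: "N \<in> null_sets lebesgue" "{x \<in> space lebesgue. \<not> (x \<in> S \<longrightarrow> f x = g x)} \<subseteq> N"
    using AE_E[OF assms(1)] by (metis (no_types, lifting) null_setsI)
  show ?thesis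
    by (rule absolutely_integrable_spike[OF assms(2), of N])
       (use N in \<open>auto simp: negligible_iff_null_sets\<close>)
qed

lemma set_integral_cong_AE:
  fixes f g :: "real \<Rightarrow> real"
  assumes "AE x in lebesgue. x \<in> S \<longrightarrow> f x = g x" "S \<in> sets lebesgue"
  shows "(LINT x:S|lebesgue. f x) = (LINT x:S|lebesgue. g x)"
proof (cases "f absolutely_integrable_on S")
  case True
  obtain N where N: "N \<in> null_sets lebesgue" "{x \<in> space lebesgue. \<not> (x \<in> S \<longrightarrow> f x = g x)} \<subseteq> N"
    using AE_E[OF assms(1)] by (metis (no_types, lifting) null_setsI)
  have "integral S f = integral S g"
    by (rule integral_spike[of N]) (use N in \<open>auto simp: negligible_iff_null_sets\<close>)
  then show ?thesis
    using True absolutely_integrable_cong_AE[OF assms(1) True] by (simp add: set_lebesgue_integral_eq_integral)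
next
  case False
  moreover have "\<not> g absolutely_integrable_on S"
  proof
    have "AE x in lebesgue. x \<in> S \<longrightarrow> g x = f x" using assms(1) by eventually_elim auto
    moreover assume "g absolutely_integrable_on S"
    ultimately show False using False absolutely_integrable_cong_AE by blast
  qed
  \<comment> \<open>Neither function is integrable, so both integrals have the default value
    0.\<close>
  ultimately show ?thesis
    by (simp add: set_lebesgue_integral_def set_integrable_def not_integrable_integral_eq)
qed

text \<open>Fubini needs joint measurability on a product of Borel spaces, which a function
  measurable only for the completed measure does not provide.\<close>

lemma borel_representative:
  fixes f :: "real \<Rightarrow> real"
  assumes "set_integrable lebesgue S f" "S \<in> sets lebesgue"
  obtains h where "h \<in> borel_measurable borel" "AE x in lebesgue. x \<in> S \<longrightarrow> f x = h x" "integrable lborel h"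
proof -
  define g where "g x = indicator S x * f x" for x
  have g: "integrable lebesgue g" using assms by (simp add: set_integrable_def g_def[abs_def])
  then obtain h where h: "h \<in> borel_measurable lborel" and gh: "AE x in lborel. g x = h x"
    using completion_ex_borel_measurable_real[of g lborel] by auto
  have gh': "AE x in lebesgue. g x = h x" using gh by (rule AE_completion)
  have "integrable lebesgue h"
    by (rule integrable_cong_AE_imp[OF g]) (use gh' h in \<open>auto simp: measurable_completion\<close>)
  then have "integrable lborel h" using h by (simp add: integrable_completion)
  moreover have "AE x in lebesgue. x \<in> S \<longrightarrow> f x = h x"
    using gh' by eventually_elim (auto simp: g_def)
  ultimately show thesis using that h by simp
qed

lemma set_integral_lborel:
  fixes f :: "real \<Rightarrow> real"
  assumes [measurable]: "f \<in> borel_measurable borel" "S \<in> sets borel"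
  shows "(LINT x:S|lebesgue. f x) = (LINT x:S|lborel. f x)"
    and "set_integrable lebesgue S f \<longleftrightarrow> set_integrable lborel S f"
  unfolding set_lebesgue_integral_def set_integrable_def
  by (rule integral_completion integrable_completion; measurable)+

lemma set_integral_sum:
  fixes f :: "'i \<Rightarrow> real \<Rightarrow> real"
  assumes "\<And>i. i \<in> A \<Longrightarrow> set_integrable M S (f i)"
  shows "(LINT x:S|M. (\<Sum>i\<in>A. f i x)) = (\<Sum>i\<in>A. LINT x:S|M. f i x)"
    and "set_integrable M S (\<lambda>x. \<Sum>i\<in>A. f i x)"
  using assms unfolding set_lebesgue_integral_def set_integrable_def scaleR_sum_right
  by (intro Bochner_Integration.integral_sum Bochner_Integration.integrable_sum; simp)+

lemma set_integral_split:
  fixes f :: "real \<Rightarrow> real"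
  assumes f: "set_integrable lebesgue {a<..<b} f" and c: "a \<le> c" "c \<le> b"
  shows "(LINT x:{a<..<b}|lebesgue. f x) = (LINT x:{a<..<c}|lebesgue. f x) + (LINT x:{c<..<b}|lebesgue. f x)"
proof -
  have i: "set_integrable lebesgue {u<..<v} f" if "a \<le> u" "v \<le> b" for u v
    by (rule set_integrable_subset[OF f]) (use that in auto)
  have "f integrable_on {a<..<b}" using f by (rule set_lebesgue_integral_eq_integral)
  then have "f integrable_on {a..b}" by (simp add: integrable_on_Icc_iff_Ioo)
  then have "integral {a..c} f + integral {c..b} f = integral {a..b} f"
    by (rule Henstock_Kurzweil_Integration.integral_combine[OF c])
  then show ?thesis
    using i[of a b] i[of a c] i[of c b] c
    by (simp add: set_lebesgue_integral_eq_integral integral_open_interval_real)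
qed

lemma set_integral_abs_le:
  fixes f g :: "real \<Rightarrow> real"
  assumes "set_integrable lebesgue S f" "set_integrable lebesgue S g" "\<And>x. x \<in> S \<Longrightarrow> \<bar>f x\<bar> \<le> g x"
  shows "\<bar>LINT x:S|lebesgue. f x\<bar> \<le> (LINT x:S|lebesgue. g x)"
proof -
  have "norm (LINT x:S|lebesgue. f x) \<le> (LINT x:S|lebesgue. norm (f x))"
    by (rule set_integral_norm_bound[OF assms(1)])
  also have "\<dots> \<le> (LINT x:S|lebesgue. g x)"
    by (rule set_integral_mono) (use assms set_integrable_norm[OF assms(1)] in auto)
  finally show ?thesis by simp
qed

text \<open>Oscillation enters only through \<open>B\<close>, a bound for all partial integrals of
  \<open>f\<close>. The weight is paid for by its largest value \<open>w b\<close>, not by an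
  integral or a derivative of it.\<close>

lemma second_mean_value_bound:
  fixes f w :: "real \<Rightarrow> real"
  assumes ab: "a \<le> b" and f: "continuous_on {a..b} f"
    and w: "\<And>x y. a \<le> x \<Longrightarrow> x \<le> y \<Longrightarrow> y \<le> b \<Longrightarrow> w x \<le> w y" "w a \<ge> 0"
    and B: "\<And>c d. a \<le> c \<Longrightarrow> c \<le> d \<Longrightarrow> d \<le> b \<Longrightarrow> \<bar>integral {c..d} f\<bar> \<le> B"
    and int: "set_integrable lebesgue {a<..<b} (\<lambda>x. f x * w x)"
  shows "\<bar>LINT x:{a<..<b}|lebesgue. f x * w x\<bar> \<le> 2 * w b * B"
proof -
  obtain c where c: "c \<in> {a..b}"
    "integral {a..b} (\<lambda>x. w x * f x) = w a * integral {a..c} f + w b * integral {c..b} f"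
    by (rule second_mean_value_theorem[OF integrable_continuous_interval[OF f] ab, of w]) (use w(1) in auto)
  have "(LINT x:{a<..<b}|lebesgue. f x * w x) = integral {a..b} (\<lambda>x. w x * f x)"
    using int by (simp add: set_lebesgue_integral_eq_integral integral_open_interval_real mult.commute)
  also note c(2)
  also have "\<bar>w a * integral {a..c} f + w b * integral {c..b} f\<bar> \<le> w a * B + w b * B"
    using B[of a c] B[of c b] c(1) w(2) w(1)[of a b] ab
    by (intro order_trans[OF abs_triangle_ineq] add_mono) (auto simp: abs_mult intro!: mult_left_mono)
  also have "\<dots> \<le> w b * B + w b * B"
    using w(1)[of a b] ab B[of a a] by (intro add_mono mult_right_mono) auto
  finally show ?thesis by (simp add: mult_ac)
qed

lemma set_integral_mult_bound:
  fixes h f :: "real \<Rightarrow> real"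
  assumes h: "set_integrable lebesgue S h" and hf: "set_integrable lebesgue S (\<lambda>t. h t * f t)"
    and f: "\<And>t. t \<in> S \<Longrightarrow> \<bar>f t\<bar> \<le> B"
  shows "\<bar>LINT t:S|lebesgue. h t * f t\<bar> \<le> B * (LINT t:S|lebesgue. \<bar>h t\<bar>)"
proof -
  have "\<bar>LINT t:S|lebesgue. h t * f t\<bar> \<le> (LINT t:S|lebesgue. B * \<bar>h t\<bar>)"
  proof (rule set_integral_abs_le[OF hf])
    show "set_integrable lebesgue S (\<lambda>t. B * \<bar>h t\<bar>)"
      using set_integrable_norm[OF h] by simp
    fix t assume "t \<in> S"
    then show "\<bar>h t * f t\<bar> \<le> B * \<bar>h t\<bar>"
      using f[of t] by (simp add: abs_mult mult.commute[of "\<bar>h t\<bar>"] mult_right_mono)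
  qed
  then show ?thesis by simp
qed

lemma set_integral_abs_nonneg: "0 \<le> (LINT t:S|M. \<bar>h t :: real\<bar>)"
  unfolding set_lebesgue_integral_def by (intro integral_nonneg_AE) auto

section \<open>Legendre polynomials\<close>

text \<open>The coefficient of \<open>((x - 1) / 2) ^ k\<close> in the Legendre polynomial of degree
  \<open>n\<close>. Expanding about 1 turns the tails over \<open>{t<..<1}\<close> into finite sums
  of Beta integrals.\<close>

definition lcoeff :: "nat \<Rightarrow> nat \<Rightarrow> real" where
  "lcoeff n k = real ((n choose k) * ((n + k) choose k))"

lemma lcoeff_eq_0: "k > n \<Longrightarrow> lcoeff n k = 0"
  by (simp add: lcoeff_def)

lemma lcoeff_fact: "k \<le> n \<Longrightarrow> lcoeff n k = fact (n + k) / (fact (n - k) * (fact k)\<^sup>2)"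
  by (simp add: lcoeff_def binomial_fact power2_eq_square field_simps)

lemma lcoeff_Suc_left: "k \<le> n \<Longrightarrow> lcoeff (Suc n) k * (real n + 1 - real k) = lcoeff n k * (real n + 1 + real k)"
proof -
  assume *: "k \<le> n"
  have f: "fact (Suc n - k) = (real n + 1 - real k) * fact (n - k)"
    using * by (simp add: Suc_diff_le of_nat_diff)
  have g: "fact (Suc n + k) = (real n + 1 + real k) * fact (n + k)"
    by (simp add: algebra_simps)
  have nz: "real n + 1 - real k \<noteq> 0" using * by linarith
  show ?thesis
    using nz unfolding lcoeff_fact[OF *] lcoeff_fact[OF le_SucI[OF *]] f g
    by simp
qed

lemma lcoeff_Suc_right: "lcoeff n (Suc k) * (real k + 1)\<^sup>2 = lcoeff n k * (real n - real k) * (real n + real k + 1)"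
proof (cases "k < n")
  case True
  then have *: "fact (n - k) = (real n - real k) * fact (n - Suc k)"
    by (metis Suc_diff_Suc fact_Suc of_nat_diff less_imp_le of_nat_fact of_nat_mult Suc_diff_Suc)
  have nz: "real n - real k \<noteq> 0" using True by simp
  show ?thesis using True nz
    unfolding lcoeff_fact[OF Suc_leI[OF True]] lcoeff_fact[OF less_imp_le[OF True]] *
    by (simp add: power2_eq_square divide_simps) (simp add: algebra_simps)
next
  case False
  then show ?thesis by (cases "k = n") (simp_all add: lcoeff_eq_0)
qed

text \<open>This is the relation \<open>legendre_diff_recurrence\<close> read off coefficientwise in
  the variable \<open>(x - 1) / 2\<close>.\<close>

lemma lcoeff_identity:
  "real k * (lcoeff (Suc n) k - lcoeff n k) + (real k + 1) * (lcoeff (Suc n) (Suc k) - lcoeff n (Suc k))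
     = (real n + 1) * (lcoeff n k + lcoeff (Suc n) k)"
proof -
  consider "k \<le> n" | "k = Suc n" | "k > Suc n" by linarith
  then show ?thesis
  proof cases
    case 1
    define N K c where "N = real n" and "K = real k" and "c = lcoeff n k"
    have pos: "N + 1 - K > 0" "K + 1 > 0" using 1 by (auto simp: N_def K_def)
    have a: "lcoeff (Suc n) k = c * (N + 1 + K) / (N + 1 - K)"
      using lcoeff_Suc_left[OF 1] pos by (simp add: N_def K_def c_def field_simps)
    have b: "lcoeff n (Suc k) = c * (N - K) * (N + K + 1) / (K + 1)\<^sup>2"
      using lcoeff_Suc_right[of n k] pos by (simp add: N_def K_def c_def field_simps)
    have "lcoeff (Suc n) (Suc k) * (K + 1)\<^sup>2 = lcoeff (Suc n) k * (N + 1 - K) * (N + K + 2)"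
      using lcoeff_Suc_right[of "Suc n" k] by (simp add: N_def K_def algebra_simps)
    also have "lcoeff (Suc n) k * (N + 1 - K) = c * (N + 1 + K)" using a pos by simp
    finally have d: "lcoeff (Suc n) (Suc k) = c * (N + 1 + K) * (N + K + 2) / (K + 1)\<^sup>2"
      using pos by (simp add: field_simps)
    have e: "(K + 1) * (c * (N + 1 + K) * (N + K + 2) / (K + 1)\<^sup>2 - c * (N - K) * (N + K + 1) / (K + 1)\<^sup>2)
      = 2 * c * (N + 1 + K)"
      using pos by (simp add: power2_eq_square divide_simps) (simp add: algebra_simps)
    have "K * (c * (N + 1 + K) / (N + 1 - K) - c) + 2 * c * (N + 1 + K)
      = (N + 1) * (c + c * (N + 1 + K) / (N + 1 - K))"
      using pos by (simp add: divide_simps) (simp add: algebra_simps)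
    then show ?thesis using e unfolding a b d by (simp add: N_def K_def c_def)
  qed (simp_all add: lcoeff_eq_0 algebra_simps)
qed

lemma coeff_lcoeff_sum: "coeff (\<Sum>k\<le>n. monom (lcoeff n k) k) i = lcoeff n i"
  by (simp add: coeff_sum lcoeff_eq_0 cong: if_cong)

definition legendre :: "nat \<Rightarrow> real poly" where
  "legendre n = pcompose (\<Sum>k\<le>n. monom (lcoeff n k) k) [:-1/2, 1/2:]"

lemma poly_legendre: "poly (legendre n) x = (\<Sum>k\<le>n. lcoeff n k * ((x - 1) / 2) ^ k)"
  by (simp add: legendre_def poly_pcompose poly_sum poly_monom diff_divide_distrib)

text \<open>The one structural fact about Legendre polynomials used here: the values at -1, the
  moment recurrence, orthogonality and the norm all follow from it. In
  \<open>y = (x - 1) / 2\<close> the factor \<open>1 + x\<close> is \<open>2 * (1 + y)\<close>, and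
  this 2 cancels the chain rule factor \<open>1 / 2\<close>.\<close>

lemma legendre_diff_recurrence:
  "[:1, 1:] * (pderiv (legendre (Suc n)) - pderiv (legendre n))
     = smult (real n + 1) (legendre n + legendre (Suc n))"
proof -
  define L where "L n = (\<Sum>k\<le>n. monom (lcoeff n k) k)" for n
  have cL: "coeff (L n) i = lcoeff n i" for n i
    by (simp only: L_def coeff_lcoeff_sum)
  have L: "[:1, 1:] * (pderiv (L (Suc n)) - pderiv (L n)) = smult (real n + 1) (L n + L (Suc n))"
  proof (rule poly_eqI)
    fix k
    show "coeff ([:1, 1:] * (pderiv (L (Suc n)) - pderiv (L n))) k = coeff (smult (real n + 1) (L n + L (Suc n))) k"
      using lcoeff_identity[of k n]
      by (cases k) (simp_all add: coeff_pderiv cL algebra_simps)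
  qed
  have leg: "legendre n = pcompose (L n) [:-1/2, 1/2:]" for n
    by (simp only: legendre_def L_def)
  have "[:1, 1:] = smult 2 (pcompose [:1, 1:] [:-1/2, 1/2 :: real:])"
    by (simp add: pcompose_pCons)
  moreover have "smult 2 q * smult (1/2) p = q * p" for p q :: "real poly"
    by simp
  ultimately have 1: "[:1, 1:] * smult (1/2) p = pcompose [:1, 1:] [:-1/2, 1/2 :: real:] * p" for p
    by metis
  have 2: "pderiv (legendre n) = smult (1/2) (pcompose (pderiv (L n)) [:-1/2, 1/2:])" for n
    by (simp add: leg pderiv_pcompose pderiv_pCons mult.commute)
  have "[:1, 1:] * (pderiv (legendre (Suc n)) - pderiv (legendre n)) =
    pcompose ([:1, 1:] * (pderiv (L (Suc n)) - pderiv (L n))) [:-1/2, 1/2:]"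
    unfolding 2 smult_diff_right[symmetric] 1 by (simp only: pcompose_mult pcompose_diff)
  then show ?thesis
    unfolding L by (simp add: leg pcompose_smult pcompose_add)
qed

lemma degree_legendre: "degree (legendre n) = n"
proof -
  have "degree (\<Sum>k\<le>n. monom (lcoeff n k) k) = n"
  proof (rule antisym)
    show "degree (\<Sum>k\<le>n. monom (lcoeff n k) k) \<le> n"
      by (rule degree_le) (simp add: coeff_lcoeff_sum lcoeff_eq_0)
    show "n \<le> degree (\<Sum>k\<le>n. monom (lcoeff n k) k)"
      by (intro le_degree) (subst coeff_lcoeff_sum, simp add: lcoeff_def)
  qed
  then show ?thesis by (simp add: legendre_def degree_pcompose)
qed

lemma legendre_at_1 [simp]: "poly (legendre n) 1 = 1"
  by (simp add: poly_legendre lcoeff_def power_0_left if_distrib cong: if_cong)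

lemma legendre_0 [simp]: "legendre 0 = 1"
  by (simp add: legendre_def lcoeff_def monom_0)

lemma legendre_at_neg1 [simp]: "poly (legendre n) (-1) = (-1) ^ n"
proof (induction n)
  case (Suc n)
  from legendre_diff_recurrence[of n]
  have "poly ([:1, 1:] * (pderiv (legendre (Suc n)) - pderiv (legendre n))) (-1)
    = poly (smult (real n + 1) (legendre n + legendre (Suc n))) (-1)" by (simp only:)
  then have "(real n + 1) * (poly (legendre n) (-1) + poly (legendre (Suc n)) (-1)) = 0"
    by simp
  then have "poly (legendre n) (-1) + poly (legendre (Suc n)) (-1) = 0"
    by (metis mult_eq_0_iff of_nat_Suc of_nat_eq_0_iff nat.simps(3) add.commute)
  with Suc show ?case by simp
qed simp

section \<open>Legendre moments of powers of \<open>1 + x\<close>\<close>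

definition moment :: "nat \<Rightarrow> real \<Rightarrow> real" where
  "moment n b = (LINT x:I_ref|lebesgue. (1 + x) powr b * poly (legendre n) x)"

lemma set_integrable_powr_poly:
  assumes "b > -1"
  shows "set_integrable lebesgue I_ref (\<lambda>x. (1 + x) powr b * poly q x)"
  using set_integrable_mult_continuous[of "-1" 1, OF set_integrable_powr_left[OF assms]]
  by (simp add: add.commute continuous_on_poly)

text \<open>Integrate the derivative of \<open>(1 + x) powr (b + 1)\<close> times the difference of
  two consecutive Legendre polynomials. The boundary term vanishes at -1 because
  \<open>b + 1 > 0\<close>, and at 1 because both polynomials equal 1 there.\<close>

lemma moment_Suc:
  assumes "b > -1"
  shows "(real n + b + 2) * moment (Suc n) b = (b - real n) * moment n b"
proof -
  define P Q where "P = legendre n" and "Q = legendre (Suc n)"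
  let ?F = "\<lambda>x::real. (1 + x) powr (b + 1) * poly (Q - P) x"
  let ?f = "\<lambda>x::real. (real n + b + 2) * ((1 + x) powr b * poly Q x) - (b - real n) * ((1 + x) powr b * poly P x)"
  have int: "set_integrable lebesgue I_ref (\<lambda>x. (1 + x) powr b * poly P x)"
       "set_integrable lebesgue I_ref (\<lambda>x. (1 + x) powr b * poly Q x)"
    by (simp_all add: assms set_integrable_powr_poly)
  have "(LINT x:I_ref|lebesgue. ?f x) = ?F 1 - ?F (-1)"
  proof (rule LINT_eq_diff)
    show "continuous_on {-1..1} ?F" using assms
      by (intro continuous_intros continuous_on_powr') auto
    fix x :: real assume x: "-1 < x" "x < 1"
    have "(1 + x) * (poly (pderiv Q) x - poly (pderiv P) x) = (real n + 1) * (poly P x + poly Q x)"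
      using arg_cong[OF legendre_diff_recurrence[of n], of "\<lambda>p. poly p x"]
      by (simp add: P_def Q_def algebra_simps)
    then have "(1 + x) powr b * ((1 + x) * poly (pderiv (Q - P)) x)
        = (1 + x) powr b * ((real n + 1) * (poly P x + poly Q x))"
      by (simp add: pderiv_diff)
    then have "(1 + x) powr (b + 1) * poly (pderiv (Q - P)) x
        = (1 + x) powr b * ((real n + 1) * (poly P x + poly Q x))"
      using x by (simp add: powr_add mult.assoc)
    moreover have "(?F has_real_derivative
       (b + 1) * (1 + x) powr b * poly (Q - P) x + (1 + x) powr (b + 1) * poly (pderiv (Q - P)) x) (at x)"
      by (rule derivative_eq_intros poly_DERIV | use x in simp)+
    ultimately show "(?F has_real_derivative ?f x) (at x)"
      by (simp add: algebra_simps)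
  qed (use int in auto)
  then show ?thesis
    using int by (simp add: P_def Q_def moment_def)
qed

text \<open>The factor \<open>b - real n\<close> of the recurrence vanishes at \<open>n = j\<close>,
  and all later moments inherit the zero.\<close>

lemma moment_nat_eq_0:
  assumes "j < n"
  shows "moment n (real j) = 0"
  using assms
proof (induction n)
  case (Suc n)
  have "(real n + real j + 2) * moment (Suc n) (real j) = 0"
  proof (cases "j = n")
    case True then show ?thesis by (subst moment_Suc) auto
  next
    case False then show ?thesis using Suc by (subst moment_Suc) auto
  qed
  then show ?case by simp
qed simp

text \<open>For \<open>n \<ge> b\<close> the recurrence multiplies the modulus by
  \<open>1 - (2 * b + 2) / (n + b + 2)\<close>, and such products decay like
  \<open>n powr (- (2 * b + 2))\<close>. With \<open>b = \<alpha> - 1\<close>, the exponent of the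
  first boundary term in the density, this is the origin of \<open>2 * \<alpha>\<close> in the
  theorem.\<close>

lemma moment_bound:
  assumes "b > -1"
  shows "\<exists>C>0. \<forall>n\<ge>1. \<bar>moment n b\<bar> \<le> C * real n powr (- (2 * b + 2))"
proof -
  define s where "s = 2 * b + 2"
  define y where "y n = real n + b + 2" for n
  have y: "y n > 1" for n using assms by (simp add: y_def)
  have s: "s > 0" using assms by (simp add: s_def)
  obtain N where N: "real N \<ge> b" using real_arch_simple by blast
  \<comment> \<open>\<open>u\<close> is nonincreasing once \<open>n \<ge> b\<close>, since \<open>1 - s / y \<le> (1 + 1 / y) powr (- s)\<close>\<close>
  define u where "u n = \<bar>moment n b\<bar> * y n powr s" for n
  have step: "u (Suc n) \<le> u n" if "n \<ge> N" for n
  proof -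
    have m: "moment (Suc n) b = (b - real n) * moment n b / y n"
      using moment_Suc[OF assms, of n] y[of n] by (simp add: y_def field_simps)
    have nb: "b \<le> real n" using N that by linarith
    have a: "\<bar>moment (Suc n) b\<bar> = (1 - s / y n) * \<bar>moment n b\<bar>"
    proof -
      have "(real n - b) / y n = 1 - s / y n" using y[of n] by (simp add: y_def s_def field_simps)
      moreover have "\<bar>moment (Suc n) b\<bar> = (real n - b) / y n * \<bar>moment n b\<bar>"
        unfolding m using nb y[of n] by (simp add: abs_mult)
      ultimately show ?thesis by metis
    qed
    have "1 - s / y n \<le> exp (- (s / y n))" using exp_ge_add_one_self[of "- (s / y n)"] by simp
    also have "\<dots> \<le> (1 + 1 / y n) powr (- s)"
    proof -
      have "ln (1 + 1 / y n) \<le> 1 / y n" using y[of n] by (intro ln_add_one_self_le_self) auto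
      then have "s * ln (1 + 1 / y n) \<le> s * (1 / y n)" using s by (intro mult_left_mono) auto
      moreover have "1 + 1 / y n > 0" using y[of n] by (intro add_pos_pos) auto
      ultimately show ?thesis by (auto simp: powr_def)
    qed
    also have "1 + 1 / y n = y (Suc n) / y n" using y[of n] by (simp add: y_def field_simps)
    also have "(y (Suc n) / y n) powr (- s) = y n powr s / y (Suc n) powr s"
      using y[of n] y[of "Suc n"] by (simp add: powr_divide powr_minus divide_simps)
    finally have "(1 - s / y n) * y (Suc n) powr s \<le> y n powr s"
      using y[of "Suc n"] by (simp add: field_simps)
    then have "\<bar>moment n b\<bar> * ((1 - s / y n) * y (Suc n) powr s) \<le> \<bar>moment n b\<bar> * y n powr s"
      by (intro mult_left_mono) auto
    then show ?thesis unfolding u_def a by (simp add: mult_ac)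
  qed
  define C where "C = Max (u ` {..N}) + 1"
  have small: "u n \<le> C" if "n \<le> N" for n
  proof -
    have "u n \<le> Max (u ` {..N})" using that by (intro Max_ge) auto
    then show ?thesis by (simp add: C_def)
  qed
  have large: "u n \<le> C" if "n \<ge> N" for n
    using that by (induction rule: dec_induct) (use small step order_trans in blast)+
  have u: "u n \<le> C" for n using small large by (cases "n \<le> N") auto
  have "u 0 \<ge> 0" by (simp add: u_def)
  with small[of 0] have "C \<ge> 0" by simp
  show ?thesis
  proof (intro exI[of _ "C + 1"] conjI allI impI)
    show "0 < C + 1" using \<open>C \<ge> 0\<close> by simp
    fix n :: nat assume n: "n \<ge> 1"
    have "\<bar>moment n b\<bar> \<le> C * y n powr (- s)"
      using u[of n] y[of n] by (simp add: u_def powr_minus field_simps)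
    also have "\<dots> \<le> (C + 1) * real n powr (- s)"
      using n s assms \<open>C \<ge> 0\<close> by (intro mult_mono powr_mono2') (auto simp: y_def)
    finally show "\<bar>moment n b\<bar> \<le> (C + 1) * real n powr (- (2 * b + 2))" by (simp add: s_def)
  qed
qed

text \<open>Consecutive moments nearly cancel: their sum is smaller by a factor of order
  \<open>1 / n\<close>. The better rate of \<open>radau_minus\<close> rests on this.\<close>

lemma moment_add_Suc:
  assumes "b > -1"
  shows "moment n b + moment (Suc n) b = (2 * b + 2) / (real n + b + 2) * moment n b"
  using moment_Suc[OF assms, of n] assms by (simp add: field_simps)

section \<open>Legendre expansions\<close>

lemma legendre_orthogonal:
  assumes "degree v < n"
  shows "(LINT x:I_ref|lebesgue. poly (legendre n) x * poly v x) = 0"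
proof -
  \<comment> \<open>Recentring \<open>v\<close> at -1 leaves only moments with natural exponents
    below \<open>n\<close>.\<close>
  define u where "u = pcompose v [:-1, 1:]"
  have du: "degree u = degree v" by (simp add: u_def degree_pcompose)
  have vu: "poly v x = (\<Sum>j\<le>degree v. coeff u j * (1 + x) ^ j)" for x
  proof -
    have "poly v x = poly u (1 + x)" by (simp add: u_def poly_pcompose)
    then show ?thesis by (simp add: poly_altdef du)
  qed
  have m: "(LINT x:I_ref|lebesgue. (1 + x) ^ j * poly (legendre n) x) = moment n (real j)" for j
    unfolding moment_def by (rule set_lebesgue_integral_cong) (auto simp: powr_realpow)
  have i: "set_integrable lebesgue I_ref (\<lambda>x. coeff u j * ((1 + x) ^ j * poly (legendre n) x))" for j
    by (intro set_integrable_continuous continuous_intros)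
  have "(LINT x:I_ref|lebesgue. poly (legendre n) x * poly v x)
      = (LINT x:I_ref|lebesgue. (\<Sum>j\<le>degree v. coeff u j * ((1 + x) ^ j * poly (legendre n) x)))"
    by (simp add: vu sum_distrib_left mult_ac)
  also have "\<dots> = (\<Sum>j\<le>degree v. LINT x:I_ref|lebesgue. coeff u j * ((1 + x) ^ j * poly (legendre n) x))"
    using i unfolding set_lebesgue_integral_def set_integrable_def scaleR_sum_right
    by (intro Bochner_Integration.integral_sum) auto
  also have "\<dots> = 0"
    using assms by (intro sum.neutral) (auto simp: m moment_nat_eq_0)
  finally show ?thesis .
qed

text \<open>Test the first-order relation against \<open>Q = legendre n\<close>. The terms with
  \<open>P\<close> drop out by orthogonality, and \<open>(1 + x) * Q * Q'\<close> is integrated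
  through the derivative of \<open>(1 + x) * Q^2 / 2\<close>, whose boundary value is 1. With
  \<open>h\<close> the squared norm this leaves \<open>1 - h / 2 = n * h\<close>.\<close>

lemma legendre_norm: "(LINT x:I_ref|lebesgue. poly (legendre n) x * poly (legendre n) x) = 2 / (2 * real n + 1)"
proof (cases n)
  case 0
  have "(LINT x:I_ref|lebesgue. (1::real)) = 1 - (-1)"
    by (rule LINT_eq_diff) (auto intro!: set_integrable_continuous continuous_intros)
  then show ?thesis using 0 by simp
next
  case (Suc m)
  define P Q where "P = legendre m" and "Q = legendre n"
  define h where "h = (LINT x:I_ref|lebesgue. poly Q x * poly Q x)"
  have ip: "set_integrable lebesgue I_ref (poly p)" for p
    by (intro set_integrable_continuous continuous_intros)
  have o1: "(LINT x:I_ref|lebesgue. poly Q x * poly P x) = 0"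
    unfolding P_def Q_def by (rule legendre_orthogonal) (simp add: degree_legendre Suc)
  have o2: "(LINT x:I_ref|lebesgue. poly Q x * poly ([:1, 1:] * pderiv P) x) = 0"
    unfolding Q_def
  proof (rule legendre_orthogonal)
    have "degree ([:1, 1:] * pderiv P) \<le> m"
    proof (cases "pderiv P = 0")
      case False
      then have "degree P > 0" by (metis degree_pderiv degree_0 pderiv_eq_0_iff neq0_conv)
      then show ?thesis using False
        by (subst degree_mult_eq) (auto simp: degree_pderiv P_def degree_legendre)
    next
      case True then show ?thesis unfolding True by simp
    qed
    then show "degree ([:1, 1:] * pderiv P) < n" using Suc by simp
  qed
  have o3: "(LINT x:I_ref|lebesgue. poly Q x * poly ([:1, 1:] * pderiv Q) x) = 1 - h / 2"
  proof -
    let ?F = "\<lambda>x. (1 + x) * (poly Q x)\<^sup>2 / 2"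
    have "(LINT x:I_ref|lebesgue. poly (smult (1/2) (Q * Q) + Q * ([:1, 1:] * pderiv Q)) x) = ?F 1 - ?F (-1)"
    proof (rule LINT_eq_diff)
      fix x :: real
      have "((\<lambda>x. (1 + x) * (poly Q x)\<^sup>2 / 2) has_real_derivative
        ((poly Q x)\<^sup>2 + 2 * poly (pderiv Q) x * poly Q x * (1 + x)) / 2) (at x)"
        by (rule derivative_eq_intros poly_DERIV refl | simp)+
      then show "(?F has_real_derivative poly (smult (1/2) (Q * Q) + Q * ([:1, 1:] * pderiv Q)) x) (at x)"
        by (simp add: power2_eq_square field_simps)
    qed ((rule ip | intro continuous_intros | simp)+)
    moreover have "(LINT x:I_ref|lebesgue. poly (smult (1/2) (Q * Q) + Q * ([:1, 1:] * pderiv Q)) x)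
      = (LINT x:I_ref|lebesgue. poly (smult (1/2) (Q * Q)) x) + (LINT x:I_ref|lebesgue. poly (Q * ([:1, 1:] * pderiv Q)) x)"
      unfolding poly_add by (rule set_integral_add(2)[OF ip ip])
    moreover have "(LINT x:I_ref|lebesgue. poly (smult (1/2) (Q * Q)) x) = h / 2" by (simp add: h_def)
    moreover have "(LINT x:I_ref|lebesgue. poly (Q * ([:1, 1:] * pderiv Q)) x) = (LINT x:I_ref|lebesgue. poly Q x * poly ([:1, 1:] * pderiv Q) x)"
      by (simp only: poly_mult)
    ultimately show ?thesis by (simp add: Q_def)
  qed
  have id: "Q * ([:1, 1:] * pderiv Q) - Q * ([:1, 1:] * pderiv P) = smult (real n) (Q * P) + smult (real n) (Q * Q)"
    using arg_cong[OF legendre_diff_recurrence[of m], of "\<lambda>p. Q * p"]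
    by (simp add: P_def Q_def Suc algebra_simps smult_add_right)
  have "(LINT x:I_ref|lebesgue. poly (Q * ([:1, 1:] * pderiv Q)) x - poly (Q * ([:1, 1:] * pderiv P)) x)
      = (LINT x:I_ref|lebesgue. poly (smult (real n) (Q * P)) x + poly (smult (real n) (Q * Q)) x)"
    using id by (simp only: poly_diff[symmetric] poly_add[symmetric])
  then have "(LINT x:I_ref|lebesgue. poly (Q * ([:1, 1:] * pderiv Q)) x) - (LINT x:I_ref|lebesgue. poly (Q * ([:1, 1:] * pderiv P)) x)
      = (LINT x:I_ref|lebesgue. poly (smult (real n) (Q * P)) x) + (LINT x:I_ref|lebesgue. poly (smult (real n) (Q * Q)) x)"
    by (simp only: set_integral_diff(2)[OF ip ip] set_integral_add(2)[OF ip ip])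
  then have "1 - h / 2 = real n * h"
    using o1 o2 o3 by (simp only: poly_mult poly_smult set_integral_mult_right h_def)
  then show ?thesis unfolding Q_def[symmetric] h_def[symmetric] by (simp add: field_simps)
qed

lemma legendre_orthogonality:
  "(LINT x:I_ref|lebesgue. poly (legendre m) x * poly (legendre n) x) = (if m = n then 2 / (2 * real n + 1) else 0)"
proof -
  consider "m < n" | "m = n" | "n < m" by linarith
  then show ?thesis
  proof cases
    case 1
    then have "(LINT x:I_ref|lebesgue. poly (legendre n) x * poly (legendre m) x) = 0"
      by (intro legendre_orthogonal) (simp add: degree_legendre)
    then show ?thesis using 1 by (simp add: mult.commute)
  next
    case 3
    then show ?thesis by (simp add: legendre_orthogonal degree_legendre)
  qed (simp add: legendre_norm)
qed

lemma legendre_span: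
  assumes "degree v \<le> p"
  obtains c where "v = (\<Sum>n\<le>p. smult (c n) (legendre n))"
proof -
  have "\<exists>c. v = (\<Sum>n\<le>p. smult (c n) (legendre n))"
    using assms
  proof (induction p arbitrary: v)
    case 0
    then obtain a where "v = [:a:]" using degree_eq_zeroE by auto
    then show ?case by (intro exI[of _ "\<lambda>_. a"]) simp
  next
    case (Suc p)
    define a where "a = coeff v (Suc p) / coeff (legendre (Suc p)) (Suc p)"
    have "coeff (legendre (Suc p)) (Suc p) \<noteq> 0"
      using degree_legendre[of "Suc p"] by (metis leading_coeff_0_iff degree_0 nat.distinct(1))
    then have "coeff (v - smult a (legendre (Suc p))) (Suc p) = 0" by (simp add: a_def)
    moreover have "degree (v - smult a (legendre (Suc p))) \<le> Suc p"
      using Suc.prems degree_smult_le[of a "legendre (Suc p)"]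
      by (intro degree_diff_le) (auto simp: degree_legendre)
    ultimately have "degree (v - smult a (legendre (Suc p))) \<le> p"
      by (metis degree_0 leading_coeff_0_iff le_Suc_eq le0)
    then obtain c where c: "v - smult a (legendre (Suc p)) = (\<Sum>n\<le>p. smult (c n) (legendre n))"
      using Suc.IH by blast
    have "(\<Sum>n\<le>p. smult ((c(Suc p := a)) n) (legendre n)) = (\<Sum>n\<le>p. smult (c n) (legendre n))"
      by (intro sum.cong) auto
    then have "v = (\<Sum>n\<le>Suc p. smult ((c(Suc p := a)) n) (legendre n))"
      using c by (simp add: algebra_simps)
    then show ?case by blast
  qed
  then show thesis using that by blast
qed

section \<open>Legendre projection and its mean square error\<close>

definition leg_coeff :: "(real \<Rightarrow> real) \<Rightarrow> nat \<Rightarrow> real" where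
  "leg_coeff W n = (2 * real n + 1) / 2 * (LINT x:I_ref|lebesgue. W x * poly (legendre n) x)"

definition leg_proj :: "(real \<Rightarrow> real) \<Rightarrow> nat \<Rightarrow> real poly" where
  "leg_proj W p = (\<Sum>n\<le>p. smult (leg_coeff W n) (legendre n))"

text \<open>Kept squared, because then passing from \<open>p\<close> to \<open>Suc p\<close> removes
  exactly one term, see \<open>leg_err_Suc\<close>.\<close>

definition leg_err :: "(real \<Rightarrow> real) \<Rightarrow> nat \<Rightarrow> real" where
  "leg_err W p = (LINT x:I_ref|lebesgue. (W x - poly (leg_proj W p) x)\<^sup>2)"

lemma degree_leg_proj: "degree (leg_proj W p) \<le> p"
  unfolding leg_proj_def
  by (rule degree_sum_le) (auto intro: order_trans[OF degree_smult_le] simp: degree_legendre)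

lemma set_integral_poly_sum:
  assumes "\<And>n. n \<in> A \<Longrightarrow> set_integrable lebesgue I_ref (\<lambda>x. f x * poly (q n) x)"
  shows "(LINT x:I_ref|lebesgue. f x * poly (\<Sum>n\<in>A. smult (c n) (q n)) x) = (\<Sum>n\<in>A. c n * (LINT x:I_ref|lebesgue. f x * poly (q n) x))"
proof -
  have "(LINT x:I_ref|lebesgue. f x * poly (\<Sum>n\<in>A. smult (c n) (q n)) x) = (LINT x:I_ref|lebesgue. (\<Sum>n\<in>A. c n * (f x * poly (q n) x)))"
    by (simp add: poly_sum sum_distrib_left mult_ac)
  also have "\<dots> = (\<Sum>n\<in>A. LINT x:I_ref|lebesgue. c n * (f x * poly (q n) x))"
    using assms unfolding set_lebesgue_integral_def set_integrable_def scaleR_sum_right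
    by (intro Bochner_Integration.integral_sum) (auto simp: algebra_simps)
  finally show ?thesis by simp
qed

context
  fixes W :: "real \<Rightarrow> real"
  assumes W: "continuous_on {-1..1} W"
begin

lemma leg_int:
  "set_integrable lebesgue I_ref (\<lambda>x. W x * poly q x)"
  "set_integrable lebesgue I_ref (\<lambda>x. poly r x * poly q x)"
  "set_integrable lebesgue I_ref (\<lambda>x. (W x - poly r x) * poly q x)"
  "set_integrable lebesgue I_ref (\<lambda>x. (W x - poly r x)\<^sup>2)"
  "set_integrable lebesgue I_ref (\<lambda>x. (poly r x)\<^sup>2)"
  by (intro set_integrable_continuous continuous_intros W)+

lemma leg_proj_orthogonal:
  assumes "degree v \<le> p"
  shows "(LINT x:I_ref|lebesgue. (W x - poly (leg_proj W p) x) * poly v x) = 0"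
proof -
  obtain c where c: "v = (\<Sum>n\<le>p. smult (c n) (legendre n))" using legendre_span[OF assms] .
  have "(LINT x:I_ref|lebesgue. (W x - poly (leg_proj W p) x) * poly (legendre n) x) = 0" if n: "n \<le> p" for n
  proof -
    have "(LINT x:I_ref|lebesgue. (W x - poly (leg_proj W p) x) * poly (legendre n) x)
      = (LINT x:I_ref|lebesgue. W x * poly (legendre n) x - poly (legendre n) x * poly (leg_proj W p) x)"
      by (simp add: left_diff_distrib mult.commute[of "poly (legendre n) _"])
    also have "\<dots> = (LINT x:I_ref|lebesgue. W x * poly (legendre n) x) - (LINT x:I_ref|lebesgue. poly (legendre n) x * poly (leg_proj W p) x)"
      by (rule set_integral_diff(2)[OF leg_int(1) leg_int(2)])
    also have "(LINT x:I_ref|lebesgue. poly (legendre n) x * poly (leg_proj W p) x) = (\<Sum>j\<le>p. leg_coeff W j * (LINT x:I_ref|lebesgue. poly (legendre n) x * poly (legendre j) x))"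
      unfolding leg_proj_def by (rule set_integral_poly_sum) (rule leg_int)
    also have "\<dots> = leg_coeff W n * (2 / (2 * real n + 1))"
      using n by (simp add: legendre_orthogonality if_distrib cong: if_cong)
    also have "\<dots> = (LINT x:I_ref|lebesgue. W x * poly (legendre n) x)"
      by (simp add: leg_coeff_def field_simps)
    finally show ?thesis by simp
  qed
  then show ?thesis unfolding c by (subst set_integral_poly_sum) (auto intro: leg_int)
qed

lemma leg_err_pythagoras:
  assumes "degree r \<le> p"
  shows "(LINT x:I_ref|lebesgue. (W x - poly (leg_proj W p) x - poly r x)\<^sup>2) = leg_err W p + (LINT x:I_ref|lebesgue. (poly r x)\<^sup>2)"
proof -
  let ?e = "\<lambda>x. W x - poly (leg_proj W p) x"
  have "(LINT x:I_ref|lebesgue. (?e x - poly r x)\<^sup>2) = (LINT x:I_ref|lebesgue. (?e x)\<^sup>2 + (poly r x)\<^sup>2 - 2 * (?e x * poly r x))"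
    by (simp add: power2_eq_square algebra_simps)
  also have "\<dots> = (LINT x:I_ref|lebesgue. (?e x)\<^sup>2) + (LINT x:I_ref|lebesgue. (poly r x)\<^sup>2) - 2 * (LINT x:I_ref|lebesgue. ?e x * poly r x)"
    using leg_int(3,4,5) by (simp add: set_integral_diff set_integral_add del: left_diff_distrib')
  also have "(LINT x:I_ref|lebesgue. ?e x * poly r x) = 0" by (rule leg_proj_orthogonal[OF assms])
  finally show ?thesis by (simp add: leg_err_def)
qed

lemma leg_err_nonneg: "leg_err W p \<ge> 0"
  unfolding leg_err_def set_lebesgue_integral_def by (intro integral_nonneg_AE) auto

lemma leg_err_Suc: "leg_err W p = leg_err W (Suc p) + (leg_coeff W (Suc p))\<^sup>2 * (2 / (2 * real (Suc p) + 1))"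
proof -
  let ?r = "smult (- leg_coeff W (Suc p)) (legendre (Suc p))"
  have "W x - poly (leg_proj W (Suc p)) x - poly ?r x = W x - poly (leg_proj W p) x" for x
    by (simp add: leg_proj_def)
  then have "leg_err W p = (LINT x:I_ref|lebesgue. (W x - poly (leg_proj W (Suc p)) x - poly ?r x)\<^sup>2)"
    by (simp only: leg_err_def)
  also have "\<dots> = leg_err W (Suc p) + (LINT x:I_ref|lebesgue. (poly ?r x)\<^sup>2)"
    by (rule leg_err_pythagoras) (auto intro: order_trans[OF degree_smult_le] simp: degree_legendre)
  also have "(LINT x:I_ref|lebesgue. (poly ?r x)\<^sup>2) = (LINT x:I_ref|lebesgue. (leg_coeff W (Suc p))\<^sup>2 * (poly (legendre (Suc p)) x * poly (legendre (Suc p)) x))"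
    by (simp add: power2_eq_square mult_ac)
  finally show ?thesis by (simp only: set_integral_mult_right legendre_norm)
qed

text \<open>Completeness of the Legendre polynomials: by \<open>leg_err_pythagoras\<close> the
  projection is at least as good as any polynomial of its degree, and Weierstrass approximation
  supplies a good one.\<close>

lemma leg_err_tendsto_0: "leg_err W \<longlonglongrightarrow> 0"
proof (rule LIMSEQ_I)
  fix e :: real assume "e > 0"
  \<comment> \<open>The interval has length 2, so a uniform error \<open>d\<close> costs at most
    \<open>2 * d^2 = e / 2\<close>.\<close>
  define d where "d = sqrt (e / 4)"
  have d: "d > 0" "d\<^sup>2 = e / 4" using \<open>e > 0\<close> by (auto simp: d_def)
  obtain g where g: "real_polynomial_function g" "\<And>x. x \<in> {-1..1} \<Longrightarrow> \<bar>W x - g x\<bar> < d"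
    using Stone_Weierstrass_real_polynomial_function[OF _ W d(1)] by auto
  obtain a N where aN: "g = (\<lambda>x. \<Sum>i\<le>N. a i * x ^ i)"
    using g(1) by (auto simp: real_polynomial_function_iff_sum)
  define q where "q = (\<Sum>i\<le>N. monom (a i) i)"
  have q: "poly q x = g x" for x by (simp add: q_def aN poly_sum poly_monom)
  have dq: "degree q \<le> N" unfolding q_def by (rule degree_sum_le) (auto intro: order_trans[OF degree_monom_le])
  have "leg_err W n < e" if "n \<ge> N" for n
  proof -
    let ?r = "q - leg_proj W n"
    have "leg_err W n \<le> leg_err W n + (LINT x:I_ref|lebesgue. (poly ?r x)\<^sup>2)"
      by (simp add: set_lebesgue_integral_def)
    also have "\<dots> = (LINT x:I_ref|lebesgue. (W x - poly (leg_proj W n) x - poly ?r x)\<^sup>2)"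
      by (rule leg_err_pythagoras[symmetric]) (use dq that degree_leg_proj in \<open>auto intro!: degree_diff_le\<close>)
    also have "\<dots> = (LINT x:I_ref|lebesgue. (W x - poly q x)\<^sup>2)" by simp
    also have "\<dots> \<le> (LINT x:I_ref|lebesgue. d\<^sup>2)"
    proof (rule set_integral_mono[OF leg_int(4)])
      fix x assume "x \<in> I_ref"
      then have "\<bar>W x - poly q x\<bar> \<le> d" using g(2)[of x] by (simp add: q)
      then show "(W x - poly q x)\<^sup>2 \<le> d\<^sup>2" using d abs_le_square_iff[of "W x - poly q x" d] by simp
    qed (intro set_integrable_continuous continuous_intros)
    also have "\<dots> = d\<^sup>2 * 1 - d\<^sup>2 * (-1)"
      by (rule LINT_eq_diff) (auto intro!: set_integrable_continuous continuous_intros derivative_eq_intros)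
    also have "\<dots> < e" using d \<open>e > 0\<close> by simp
    finally show ?thesis .
  qed
  then show "\<exists>N. \<forall>n\<ge>N. norm (leg_err W n - 0) < e" using leg_err_nonneg by auto
qed

text \<open>An integral test done by comparing steps: by the mean value theorem each drop of
  \<open>A^2 / (2 * s) * n powr (- (2 * s))\<close> dominates the corresponding drop of
  \<open>leg_err\<close>, and both sequences tend to 0.\<close>

lemma leg_err_bound:
  assumes s: "s > 0" and p: "p \<ge> 1" and A: "\<And>n. n > p \<Longrightarrow> \<bar>leg_coeff W n\<bar> \<le> A * real n powr (- s)"
  shows "leg_err W p \<le> A\<^sup>2 / (2 * s) * real p powr (- (2 * s))"
proof -
  \<comment> \<open>\<open>F\<close> increases to \<open>0\<close>\<close>
  define F where "F j = leg_err W (p + j) - A\<^sup>2 / (2 * s) * real (p + j) powr (- (2 * s))" for j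
  have inc: "F j \<le> F (Suc j)" for j
  proof -
    define n where "n = p + j"
    have n: "n \<ge> 1" using p by (simp add: n_def)
    define x where "x = real n"
    have x: "x > 0" using n by (simp add: x_def)
    have "\<exists>z>x. z < x + 1 \<and> - ((x + 1) powr (- (2 * s))) - - (x powr (- (2 * s))) = (x + 1 - x) * (2 * s * z powr (- (2 * s) - 1))"
      by (rule MVT2) (use x in \<open>auto intro!: derivative_eq_intros\<close>)
    then obtain z where z: "x < z" "z < x + 1" "x powr (- (2 * s)) - (x + 1) powr (- (2 * s)) = 2 * s * z powr (- (2 * s) - 1)"
      by auto
    have "(x + 1) powr (- (2 * s) - 1) \<le> z powr (- (2 * s) - 1)"
      using z x s by (intro powr_mono2') auto
    then have tele: "(x + 1) powr (- (2 * s) - 1) \<le> (x powr (- (2 * s)) - (x + 1) powr (- (2 * s))) / (2 * s)"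
      using z(3) s by (simp add: field_simps)
    have "(leg_coeff W (Suc n))\<^sup>2 \<le> (A * real (Suc n) powr (- s))\<^sup>2"
    proof -
      have "\<bar>leg_coeff W (Suc n)\<bar> \<le> A * real (Suc n) powr (- s)" by (rule A) (simp add: n_def)
      then show ?thesis using abs_le_square_iff[of "leg_coeff W (Suc n)" "A * real (Suc n) powr (- s)"] by simp
    qed
    also have "\<dots> = A\<^sup>2 * (x + 1) powr (- (2 * s))"
      by (simp add: power_mult_distrib x_def powr_powr add.commute mult.commute[of s 2] flip: powr_numeral)
    finally have 1: "(leg_coeff W (Suc n))\<^sup>2 \<le> A\<^sup>2 * (x + 1) powr (- (2 * s))" .
    have 2: "2 / (2 * real (Suc n) + 1) \<le> 1 / (x + 1)" using x by (simp add: x_def field_simps)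
    have "(leg_coeff W (Suc n))\<^sup>2 * (2 / (2 * real (Suc n) + 1)) \<le> A\<^sup>2 * (x + 1) powr (- (2 * s)) * (1 / (x + 1))"
      using 1 2 by (intro mult_mono) auto
    also have "\<dots> = A\<^sup>2 * (x + 1) powr (- (2 * s) - 1)"
      using x by (simp add: powr_diff)
    also have "\<dots> \<le> A\<^sup>2 * ((x powr (- (2 * s)) - (x + 1) powr (- (2 * s))) / (2 * s))"
      using tele by (intro mult_left_mono) auto
    also have "\<dots> = A\<^sup>2 / (2 * s) * x powr (- (2 * s)) - A\<^sup>2 / (2 * s) * (x + 1) powr (- (2 * s))"
      by (simp add: right_diff_distrib diff_divide_distrib)
    finally have "(leg_coeff W (Suc n))\<^sup>2 * (2 / (2 * real (Suc n) + 1))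
      \<le> A\<^sup>2 / (2 * s) * x powr (- (2 * s)) - A\<^sup>2 / (2 * s) * (x + 1) powr (- (2 * s))" .
    moreover have "p + j = n" "p + Suc j = Suc n" "real n = x" "real (Suc n) = x + 1"
      by (simp_all add: n_def x_def)
    ultimately show ?thesis
      using leg_err_Suc[of n] unfolding F_def by (simp only:)
  qed
  have "F \<longlonglongrightarrow> 0 - A\<^sup>2 / (2 * s) * 0"
    unfolding F_def
  proof (intro tendsto_intros)
    show "(\<lambda>j. leg_err W (p + j)) \<longlonglongrightarrow> 0"
      using LIMSEQ_ignore_initial_segment[OF leg_err_tendsto_0, of p] by (simp add: add.commute)
    have "filterlim (\<lambda>j. real (p + j)) at_top sequentially"
      by (rule filterlim_compose[OF filterlim_real_sequentially])
         (auto intro!: filterlim_add_const_nat_at_top simp: add.commute[of p])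
    then show "(\<lambda>j. real (p + j) powr (- (2 * s))) \<longlonglongrightarrow> 0"
      using s by (intro tendsto_neg_powr) auto
  qed
  then have "F 0 \<le> 0"
    using incseq_le[of F 0 0] inc by (simp add: incseq_SucI)
  then show ?thesis by (simp add: F_def)
qed

end

section \<open>Mehler's formula and uniform tail bounds\<close>

text \<open>Chebyshev polynomials of the third kind, expanded in powers of \<open>2 (x - 1)\<close>.\<close>

definition cheb3 :: "nat \<Rightarrow> real \<Rightarrow> real" where
  "cheb3 n x = (\<Sum>k\<le>n. real ((n + k) choose (2 * k)) * (2 * (x - 1)) ^ k)"

lemma cheb3_recurrence:
  "cheb3 (Suc (Suc n)) x + cheb3 n x = 2 * x * cheb3 (Suc n) x"
proof -
  define P where "P n = (\<Sum>k\<le>n. monom (real ((n + k) choose (2 * k))) k)" for n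
  have cP: "coeff (P n) k = real ((n + k) choose (2 * k))" for n k
    by (simp add: P_def coeff_sum)
  have pP: "poly (P n) (2 * (x - 1)) = cheb3 n x" for n x
    by (simp add: P_def cheb3_def poly_sum poly_monom)
  \<comment> \<open>With \<open>y = 2 * (x - 1)\<close> the factor \<open>2 * x\<close> becomes
    \<open>y + 2\<close>. Coefficientwise the claim is Pascal's rule, applied repeatedly.\<close>
  have "P (Suc (Suc n)) + P n = [:2, 1:] * P (Suc n)"
  proof (rule poly_eqI)
    fix k show "coeff (P (Suc (Suc n)) + P n) k = coeff ([:2, 1:] * P (Suc n)) k"
      by (cases k) (simp_all add: cP)
  qed
  then have "poly (P (Suc (Suc n)) + P n) (2 * (x - 1)) = poly ([:2, 1:] * P (Suc n)) (2 * (x - 1))"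
    by (rule arg_cong)
  then show ?thesis unfolding poly_add poly_mult pP by (simp add: algebra_simps)
qed

text \<open>At half-integer frequencies the cosine is not a polynomial in \<open>cos t\<close>, but
  it becomes one after division by \<open>cos (t / 2)\<close>. This makes the substitution
  \<open>x = cos \<phi>\<close> possible in Mehler's integral.\<close>

lemma cos_cheb3: "cos ((real n + 1 / 2) * t) = cos (t / 2) * cheb3 n (cos t)"
proof (induction n rule: induct_nat_012)
  case 0 show ?case by (simp add: cheb3_def)
next
  case 1
  have "cos (3 * (t / 2)) = cos (t / 2) * (2 * cos (2 * (t / 2)) - 1)"
    unfolding cos_treble_cos cos_double_cos by (simp add: power2_eq_square power3_eq_cube algebra_simps)
  then show ?case by (simp add: cheb3_def algebra_simps)
next
  case (ge2 n)
  have "cos (t + (real (Suc n) + 1 / 2) * t) + cos ((real (Suc n) + 1 / 2) * t - t) = 2 * cos t * cos ((real (Suc n) + 1 / 2) * t)"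
    by (simp add: cos_add cos_diff)
  moreover have "t + (real (Suc n) + 1 / 2) * t = (real (Suc (Suc n)) + 1 / 2) * t"
    "(real (Suc n) + 1 / 2) * t - t = (real n + 1 / 2) * t" by (simp_all add: algebra_simps)
  ultimately have "cos ((real (Suc (Suc n)) + 1 / 2) * t) = 2 * cos t * (cos (t / 2) * cheb3 (Suc n) (cos t)) - cos (t / 2) * cheb3 n (cos t)"
    using ge2 by simp
  also have "\<dots> = cos (t / 2) * (2 * cos t * cheb3 (Suc n) (cos t) - cheb3 n (cos t))"
    by (simp add: algebra_simps)
  also have "2 * cos t * cheb3 (Suc n) (cos t) - cheb3 n (cos t) = cheb3 (Suc (Suc n)) (cos t)"
    using cheb3_recurrence[of n "cos t"] by simp
  finally show ?case .
qed

definition legendre_tail :: "nat \<Rightarrow> real \<Rightarrow> real \<Rightarrow> real" where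
  "legendre_tail n g t = (LINT x:{t<..<1}|lebesgue. (x - t) powr (g - 1) * poly (legendre n) x)"

text \<open>The exponent \<open>\<mu> = -1 / 2\<close> is the classical Mehler-Dirichlet integral of
  the Legendre polynomial itself; a fractional integration of order \<open>g\<close> shifts it to
  \<open>\<mu> = g - 1 / 2\<close>.\<close>

definition mehler :: "real \<Rightarrow> real \<Rightarrow> real \<Rightarrow> real" where
  "mehler N \<mu> \<theta> = (LINT \<phi>:{0<..<\<theta>}|lebesgue. cos (N * \<phi>) * (cos \<phi> - cos \<theta>) powr \<mu>)"

lemma Gamma_half_nat: "Gamma (real k + 1 / 2) = sqrt pi * fact (2 * k) / (4 ^ k * fact k)"
proof (induction k)
  case (Suc k)
  have "Gamma (real (Suc k) + 1 / 2) = Gamma ((real k + 1 / 2) + 1)" by (simp add: add_ac)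
  also have "\<dots> = (real k + 1 / 2) * Gamma (real k + 1 / 2)"
  proof (rule Gamma_plus1)
    have "real k + 1 / 2 > 0" by (simp add: add_nonneg_pos)
    then show "real k + 1 / 2 \<notin> \<int>\<^sub>\<le>\<^sub>0" by (metis nonpos_Ints_nonpos not_less)
  qed
  finally have "Gamma (real (Suc k) + 1 / 2) = (real k + 1 / 2) * (sqrt pi * fact (2 * k) / (4 ^ k * fact k))"
    unfolding Suc .
  also have "\<dots> = sqrt pi * fact (2 * Suc k) / (4 ^ Suc k * fact (Suc k))"
    by (simp add: divide_simps) (simp add: algebra_simps)
  finally show ?case .
qed (simp add: Gamma_one_half_real)

lemma legendre_tail_expansion:
  assumes "g > 0" "t < 1"
  shows "legendre_tail n g t = (\<Sum>k\<le>n. lcoeff n k * (-1/2) ^ k * ((1 - t) powr (g + k) * Beta g (real k + 1)))"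
proof -
  let ?f = "\<lambda>k x. lcoeff n k * (-1/2) ^ k * ((x - t) powr (g - 1) * (1 - x) powr (real k + 1 - 1))"
  have "legendre_tail n g t = (LINT x:{t<..<1}|lebesgue. (\<Sum>k\<le>n. ?f k x))"
    unfolding legendre_tail_def
  proof (rule set_lebesgue_integral_cong, simp, intro allI impI)
    fix x assume x: "x \<in> {t<..<1}"
    have "((x - 1) / 2) ^ k = (-1/2) ^ k * (1 - x) powr (real k + 1 - 1)" for k
    proof -
      have "(x - 1) / 2 = (-1/2) * (1 - x)" by (simp add: field_simps)
      then have "((x - 1) / 2) ^ k = (-1/2) ^ k * (1 - x) ^ k" by (simp only: power_mult_distrib)
      then show ?thesis using x by (simp add: powr_realpow)
    qed
    then show "(x - t) powr (g - 1) * poly (legendre n) x = (\<Sum>k\<le>n. ?f k x)"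
      unfolding poly_legendre sum_distrib_left by (intro sum.cong refl) (simp add: mult_ac)
  qed
  also have "\<dots> = (\<Sum>k\<le>n. LINT x:{t<..<1}|lebesgue. ?f k x)"
    using assms by (intro set_integral_sum set_integrable_mult_right Beta_interval) auto
  also have "\<dots> = (\<Sum>k\<le>n. lcoeff n k * (-1/2) ^ k * ((1 - t) powr (g + k) * Beta g (real k + 1)))"
  proof (rule sum.cong[OF refl])
    fix k
    show "(LINT x:{t<..<1}|lebesgue. ?f k x) = lcoeff n k * (-1/2) ^ k * ((1 - t) powr (g + k) * Beta g (real k + 1))"
      unfolding set_integral_mult_right using assms by (subst Beta_interval(2)) (auto simp: add_ac)
  qed
  finally show ?thesis .
qed

text \<open>Substitute \<open>x = cos \<phi>\<close>. The factor \<open>cos (\<phi> / 2)\<close>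
  from \<open>cos_cheb3\<close> divided by the Jacobian \<open>sin \<phi>\<close> is
  \<open>1 / (2 * sin (\<phi> / 2))\<close>, that is \<open>(1 - x) powr (- 1 / 2) / sqrt 2\<close>.
  Every power of \<open>1 - x\<close> then gives a Beta integral with half-integer argument.
  Integrability is known on the \<open>x\<close> side and is carried back.\<close>

lemma mehler_expansion:
  assumes \<mu>: "\<mu> > -1" and \<theta>: "0 < \<theta>" "\<theta> < pi"
  shows "set_integrable lebesgue {0<..<\<theta>} (\<lambda>\<phi>. cos ((real n + 1 / 2) * \<phi>) * (cos \<phi> - cos \<theta>) powr \<mu>)"
    and "mehler (real n + 1 / 2) \<mu> \<theta>
      = (\<Sum>k\<le>n. real ((n + k) choose (2 * k)) * (-2) ^ k / sqrt 2 * ((1 - cos \<theta>) powr (\<mu> + 1 / 2 + k) * Beta (\<mu> + 1) (real k + 1 / 2)))"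
proof -
  define t where "t = cos \<theta>"
  have t: "-1 < t" "t < 1"
    using cos_monotone_0_pi[of 0 \<theta>] cos_monotone_0_pi[of \<theta> pi] \<theta> by (simp_all add: t_def)
  let ?f = "\<lambda>k x. real ((n + k) choose (2 * k)) * (-2) ^ k / sqrt 2 * ((x - t) powr (\<mu> + 1 - 1) * (1 - x) powr (real k + 1 / 2 - 1))"
  have int: "set_integrable lebesgue {t<..<1} (?f k)" for k
    using t \<mu> by (intro set_integrable_mult_right Beta_interval) auto
  let ?S = "\<Sum>k\<le>n. real ((n + k) choose (2 * k)) * (-2) ^ k / sqrt 2 * ((1 - t) powr (\<mu> + 1 / 2 + k) * Beta (\<mu> + 1) (real k + 1 / 2))"
  have val: "(LINT x:{t<..<1}|lebesgue. (\<Sum>k\<le>n. ?f k x)) = ?S"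
  proof -
    have "(LINT x:{t<..<1}|lebesgue. (\<Sum>k\<le>n. ?f k x)) = (\<Sum>k\<le>n. LINT x:{t<..<1}|lebesgue. ?f k x)"
      by (intro set_integral_sum int)
    also have "\<dots> = ?S"
    proof (rule sum.cong[OF refl])
      fix k
      show "(LINT x:{t<..<1}|lebesgue. ?f k x) = real ((n + k) choose (2 * k)) * (-2) ^ k / sqrt 2 * ((1 - t) powr (\<mu> + 1 / 2 + k) * Beta (\<mu> + 1) (real k + 1 / 2))"
        unfolding set_integral_mult_right using t \<mu> by (subst Beta_interval(2)) (auto simp: add_ac)
    qed
    finally show ?thesis .
  qed
  have im: "cos ` {0<..<\<theta>} = {t<..<1}"
  proof -
    have "x \<in> cos ` {0<..<\<theta>}" if x: "t < x" "x < 1" for x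
    proof (rule image_eqI[of _ _ "arccos x"])
      have "arccos x < arccos t" using x t by (intro arccos_less_arccos) auto
      moreover have "arccos t = \<theta>" unfolding t_def using \<theta> by (intro arccos_cos) auto
      moreover have "arccos 1 < arccos x" using x t by (intro arccos_less_arccos) auto
      ultimately show "arccos x \<in> {0<..<\<theta>}" by simp
    qed (use x t in auto)
    moreover have "cos \<phi> \<in> {t<..<1}" if "0 < \<phi>" "\<phi> < \<theta>" for \<phi>
      using cos_monotone_0_pi[of 0 \<phi>] cos_monotone_0_pi[of \<phi> \<theta>] \<theta> that by (simp add: t_def)
    ultimately show ?thesis by auto
  qed
  let ?g = "\<lambda>\<phi>. cos ((real n + 1 / 2) * \<phi>) * (cos \<phi> - t) powr \<mu>"
  have pull: "\<bar>- sin \<phi>\<bar> * (\<Sum>k\<le>n. ?f k (cos \<phi>)) = ?g \<phi>" if \<phi>: "\<phi> \<in> {0<..<\<theta>}" for \<phi>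
  proof -
    have \<phi>': "0 < \<phi>" "\<phi> < pi" using \<phi> \<theta> by auto
    have s: "sin (\<phi> / 2) > 0" using \<phi>' by (intro sin_gt_zero) auto
    have c: "1 - cos \<phi> = 2 * sin (\<phi> / 2) ^ 2" using cos_double_sin[of "\<phi> / 2"] by simp
    have c0: "1 - cos \<phi> > 0" unfolding c using s by simp
    have "sqrt 2 * sqrt (1 - cos \<phi>) = 2 * sin (\<phi> / 2)"
      unfolding c using s by (simp add: real_sqrt_mult)
    moreover have "(1 - cos \<phi>) powr (1 / 2 - 1) = 1 / sqrt (1 - cos \<phi>)"
    proof -
      have "(1 - cos \<phi>) powr (1 / 2 - 1) = (1 - cos \<phi>) powr (- (1 / 2))" by simp
      then show ?thesis using c0 by (simp only: powr_minus_divide powr_half_sqrt less_imp_le)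
    qed
    ultimately have q: "1 / sqrt 2 * (1 - cos \<phi>) powr (1 / 2 - 1) = 1 / (2 * sin (\<phi> / 2))"
      by simp
    have sp: "\<bar>- sin \<phi>\<bar> = 2 * sin (\<phi> / 2) * cos (\<phi> / 2)"
      using \<phi>' sin_double[of "\<phi> / 2"] sin_gt_zero[of \<phi>] by simp
    have "?f k (cos \<phi>) = (cos \<phi> - t) powr \<mu> * (1 / (2 * sin (\<phi> / 2))) * (real ((n + k) choose (2 * k)) * (2 * (cos \<phi> - 1)) ^ k)" for k
    proof -
      define r where "r = (1 - cos \<phi>) powr (1 / 2 - 1)"
      have "(1 - cos \<phi>) powr (real k + 1 / 2 - 1) = (1 - cos \<phi>) ^ k * r"
        using c0 powr_add[of "1 - cos \<phi>" "real k" "1 / 2 - 1"] by (simp add: r_def powr_realpow)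
      moreover have "2 * (cos \<phi> - 1) = (-2) * (1 - cos \<phi>)" by simp
      then have "(2 * (cos \<phi> - 1)) ^ k = (-2) ^ k * (1 - cos \<phi>) ^ k" by (simp only: power_mult_distrib)
      ultimately show ?thesis unfolding q[symmetric] r_def[symmetric] by simp
    qed
    then have "(\<Sum>k\<le>n. ?f k (cos \<phi>)) = (cos \<phi> - t) powr \<mu> * (1 / (2 * sin (\<phi> / 2))) * cheb3 n (cos \<phi>)"
      by (simp add: cheb3_def sum_distrib_left)
    then show ?thesis unfolding sp cos_cheb3 using s by simp
  qed
  have inj: "inj_on cos {0<..<\<theta>}"
    unfolding inj_on_def using cos_inj_pi \<theta> by auto
  have "(\<lambda>\<phi>. \<bar>- sin \<phi>\<bar> * (\<Sum>k\<le>n. ?f k (cos \<phi>))) absolutely_integrable_on {0<..<\<theta>} \<and>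
      integral {0<..<\<theta>} (\<lambda>\<phi>. \<bar>- sin \<phi>\<bar> * (\<Sum>k\<le>n. ?f k (cos \<phi>))) = ?S"
  proof (rule has_absolute_integral_change_of_variables_1'[OF _ _ inj, THEN iffD2])
    show "(\<lambda>x. \<Sum>k\<le>n. ?f k x) absolutely_integrable_on cos ` {0<..<\<theta>} \<and> integral (cos ` {0<..<\<theta>}) (\<lambda>x. \<Sum>k\<le>n. ?f k x) = ?S"
      unfolding im using set_integral_sum(2)[of "{..n}", OF int] val
      by (simp add: set_lebesgue_integral_eq_integral)
  qed (auto intro!: derivative_eq_intros)
  moreover have "(\<lambda>\<phi>. \<bar>- sin \<phi>\<bar> * (\<Sum>k\<le>n. ?f k (cos \<phi>))) absolutely_integrable_on {0<..<\<theta>} \<longleftrightarrow> ?g absolutely_integrable_on {0<..<\<theta>}"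
    by (rule set_integrable_cong[OF refl refl pull])
  moreover have "integral {0<..<\<theta>} (\<lambda>\<phi>. \<bar>- sin \<phi>\<bar> * (\<Sum>k\<le>n. ?f k (cos \<phi>))) = integral {0<..<\<theta>} ?g"
    by (rule Henstock_Kurzweil_Integration.integral_cong[OF pull])
  ultimately have *: "?g absolutely_integrable_on {0<..<\<theta>}" "integral {0<..<\<theta>} ?g = ?S"
    by (simp_all only:)
  show "set_integrable lebesgue {0<..<\<theta>} (\<lambda>\<phi>. cos ((real n + 1 / 2) * \<phi>) * (cos \<phi> - cos \<theta>) powr \<mu>)"
    using *(1) by (simp add: t_def)
  show "mehler (real n + 1 / 2) \<mu> \<theta>
      = (\<Sum>k\<le>n. real ((n + k) choose (2 * k)) * (-2) ^ k / sqrt 2 * ((1 - cos \<theta>) powr (\<mu> + 1 / 2 + k) * Beta (\<mu> + 1) (real k + 1 / 2)))"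
    using * by (simp add: mehler_def t_def set_lebesgue_integral_eq_integral)
qed

text \<open>Both sides are \<open>(1 - cos \<theta>) powr g\<close> times a polynomial in \<open>1 - cos \<theta>\<close>; the coefficients agree.\<close>

lemma legendre_tail_eq_mehler:
  assumes g: "g > 0" and \<theta>: "0 < \<theta>" "\<theta> < pi"
  shows "legendre_tail n g (cos \<theta>)
    = sqrt 2 * Gamma g / (Gamma (g + 1 / 2) * sqrt pi) * mehler (real n + 1 / 2) (g - 1 / 2) \<theta>"
proof -
  have t: "cos \<theta> < 1" using cos_monotone_0_pi[of 0 \<theta>] \<theta> by simp
  have "lcoeff n k * (-1/2) ^ k * Beta g (real k + 1)
    = sqrt 2 * Gamma g / (Gamma (g + 1 / 2) * sqrt pi) * (real ((n + k) choose (2 * k)) * (-2) ^ k / sqrt 2 * Beta (g + 1 / 2) (real k + 1 / 2))"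
    if k: "k \<le> n" for k
  proof -
    have nz: "Gamma (g + 1 / 2) \<noteq> 0" "Gamma (g + k + 1) \<noteq> 0"
      using less_imp_neq[OF Gamma_real_pos[of "g + 1 / 2"]] less_imp_neq[OF Gamma_real_pos[of "g + k + 1"]] g by auto
    have a: "Beta g (real k + 1) = Gamma g * fact k / Gamma (g + k + 1)"
      using Gamma_fact[of k, where ?'a = real] by (simp add: Beta_def add_ac)
    \<comment> \<open>The half-integer Gamma value supplies
      \<open>fact (2 * k) / (4 ^ k * fact k)\<close>, which turns the Chebyshev coefficient
      \<open>(n + k) choose (2 * k)\<close> into \<open>lcoeff n k\<close>.\<close>
    have b: "Beta (g + 1 / 2) (real k + 1 / 2) = Gamma (g + 1 / 2) * (sqrt pi * fact (2 * k) / (4 ^ k * fact k)) / Gamma (g + k + 1)"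
      by (simp add: Beta_def Gamma_half_nat add_ac)
    have c: "real ((n + k) choose (2 * k)) = fact (n + k) / (fact (2 * k) * fact (n - k))"
    proof -
      have "n + k - 2 * k = n - k" using k by simp
      then show ?thesis using k by (simp add: binomial_fact)
    qed
    have d: "(-2 :: real) ^ k = (-1/2) ^ k * 4 ^ k" by (simp flip: power_mult_distrib)
    show ?thesis
      unfolding a b c d lcoeff_fact[OF k] using nz by (simp add: power2_eq_square field_simps)
  qed
  note coeffs = this
  have "lcoeff n k * (-1/2) ^ k * ((1 - cos \<theta>) powr (g + k) * Beta g (real k + 1))
    = sqrt 2 * Gamma g / (Gamma (g + 1 / 2) * sqrt pi) * (real ((n + k) choose (2 * k)) * (-2) ^ k / sqrt 2 * ((1 - cos \<theta>) powr (g - 1 / 2 + 1 / 2 + k) * Beta (g - 1 / 2 + 1) (real k + 1 / 2)))"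
    if k: "k \<le> n" for k
  proof -
    have e: "g - 1 / 2 + 1 = g + 1 / 2" "g - 1 / 2 + 1 / 2 + k = g + k" by simp_all
    show ?thesis unfolding e
      using arg_cong[OF coeffs[OF k], of "\<lambda>z. (1 - cos \<theta>) powr (g + k) * z"]
      by (simp add: mult_ac)
  qed
  moreover have "mehler (real n + 1 / 2) (g - 1 / 2) \<theta>
      = (\<Sum>k\<le>n. real ((n + k) choose (2 * k)) * (-2) ^ k / sqrt 2 * ((1 - cos \<theta>) powr (g - 1 / 2 + 1 / 2 + k) * Beta (g - 1 / 2 + 1) (real k + 1 / 2)))"
    using g \<theta> by (intro mehler_expansion) auto
  ultimately show ?thesis
    unfolding legendre_tail_expansion[OF g t] by (simp only: sum_distrib_left) (intro sum.cong refl, simp)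
qed

section \<open>Bounds for Mehler's oscillatory integral\<close>

lemma sin_ge_half:
  assumes "0 \<le> y" "y \<le> pi / 2"
  shows "y / 2 \<le> sin (y::real)"
\<comment> \<open>Up to \<open>pi / 3\<close> the cosine is at least \<open>1 / 2\<close>, so
  \<open>sin y - y / 2\<close> is nondecreasing; beyond it \<open>sin y\<close> is at least
  \<open>sqrt 3 / 2\<close>, while \<open>y / 2\<close> stays below 0.8.\<close>
proof (cases "y \<le> pi / 3")
  case True
  have "(\<lambda>x. sin x - x / 2) 0 \<le> (\<lambda>x. sin x - x / 2) y"
  proof (rule DERIV_nonneg_imp_nondecreasing[OF assms(1)])
    fix x assume x: "0 \<le> x" "x \<le> y"
    have "cos (pi / 3) \<le> cos x" by (rule cos_monotone_0_pi_le) (use x True in auto)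
    then show "\<exists>z. ((\<lambda>x. sin x - x / 2) has_real_derivative z) (at x) \<and> 0 \<le> z"
      by (intro exI[of _ "cos x - 1 / 2"]) (auto simp: cos_60 intro!: derivative_eq_intros)
  qed
  then show ?thesis by simp
next
  case False
  have "sin (pi / 3) \<le> sin y" by (rule sin_monotone_2pi_le) (use assms False in auto)
  moreover have "y / 2 \<le> 1 / 2 * sqrt 3"
  proof -
    have "y / 2 \<le> 0.8" using assms pi_less_4 pi_approx by simp
    also have "0.8 \<le> 1 / 2 * sqrt 3"
    proof -
      have "1.6 \<le> sqrt 3" by (rule real_le_rsqrt) (simp add: power2_eq_square)
      then show ?thesis by simp
    qed
    finally show ?thesis .
  qed
  ultimately show ?thesis by (simp add: sin_60)
qed

text \<open>In the product formula for the difference of cosines, the sine of the half sum is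
  bounded below by the sine of the half difference. A quadratic bound is the best that holds
  uniformly, since the cosine is flat at 0 and at \<open>pi\<close>; this produces the exponent
  \<open>2 * g\<close> for small \<open>g\<close>.\<close>

lemma cos_diff_ge:
  assumes "0 \<le> \<phi>" "\<phi> \<le> \<theta>" "\<theta> \<le> pi"
  shows "(\<theta> - \<phi>)\<^sup>2 / 8 \<le> cos \<phi> - cos \<theta>"
proof -
  have "sin ((\<theta> + \<phi>) / 2) - sin ((\<theta> - \<phi>) / 2) = 2 * cos (\<theta> / 2) * sin (\<phi> / 2)"
    by (simp add: add_divide_distrib diff_divide_distrib sin_add sin_diff)
  moreover have "cos (\<theta> / 2) \<ge> 0" "sin (\<phi> / 2) \<ge> 0"
    using assms by (auto intro!: cos_ge_zero sin_ge_zero)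
  ultimately have s: "sin ((\<theta> - \<phi>) / 2) \<le> sin ((\<theta> + \<phi>) / 2)"
    by (metis diff_ge_0_iff_ge mult_nonneg_nonneg zero_le_numeral)
  have r: "(\<theta> - \<phi>) / 2 / 2 \<le> sin ((\<theta> - \<phi>) / 2)" using assms by (intro sin_ge_half) auto
  have "cos \<phi> - cos \<theta> = 2 * sin ((\<theta> + \<phi>) / 2) * sin ((\<theta> - \<phi>) / 2)"
    using cos_diff_cos[of \<phi> \<theta>] by (simp add: add.commute)
  moreover have "2 * ((\<theta> - \<phi>) / 4) * ((\<theta> - \<phi>) / 4) \<le> 2 * sin ((\<theta> + \<phi>) / 2) * sin ((\<theta> - \<phi>) / 2)"
    using r s assms by (intro mult_mono mult_nonneg_nonneg) auto
  moreover have "(\<theta> - \<phi>)\<^sup>2 / 8 = 2 * ((\<theta> - \<phi>) / 4) * ((\<theta> - \<phi>) / 4)"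
    by (simp add: power2_eq_square)
  ultimately show ?thesis by simp
qed

lemma integral_cos_bound:
  fixes N c d :: real
  assumes "N > 0" "c \<le> d"
  shows "\<bar>integral {c..d} (\<lambda>x. cos (N * x))\<bar> \<le> 2 / N"
proof -
  have "((\<lambda>x. cos (N * x)) has_integral sin (N * d) / N - sin (N * c) / N) {c..d}"
    using assms by (intro fundamental_theorem_of_calculus[of c d "\<lambda>x. sin (N * x) / N"])
      (auto intro!: derivative_eq_intros simp flip: has_real_derivative_iff_has_vector_derivative)
  then have "integral {c..d} (\<lambda>x. cos (N * x)) = sin (N * d) / N - sin (N * c) / N"
    by (rule integral_unique)
  also have "\<bar>\<dots>\<bar> = \<bar>sin (N * d) - sin (N * c)\<bar> / N"
    using assms by (simp flip: diff_divide_distrib)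
  also have "\<dots> \<le> 2 / N"
    using assms abs_sin_le_one[of "N * d"] abs_sin_le_one[of "N * c"]
    by (intro divide_right_mono) linarith+
  finally show ?thesis .
qed

lemma one_div_powr: "N > 0 \<Longrightarrow> (1 / N) powr a = N powr (- a)" for N a :: real
  by (simp add: powr_minus_divide powr_divide)

text \<open>Split at \<open>\<theta> - 1 / N\<close>: the weight is monotone to the left, and integrable like
  \<open>(\<theta> - \<phi>) powr (2 * \<mu>)\<close> to the right.\<close>

lemma mehler_bound_low:
  assumes \<mu>: "-1 / 2 < \<mu>" "\<mu> \<le> 0"
  shows "\<exists>C>0. \<forall>n \<theta>. 0 < \<theta> \<longrightarrow> \<theta> < pi \<longrightarrow> \<bar>mehler (real n + 1 / 2) \<mu> \<theta>\<bar> \<le> C * (real n + 1 / 2) powr (- (2 * \<mu> + 1))"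
proof -
  \<comment> \<open>\<open>1 / 8\<close> is the constant of \<open>cos_diff_ge\<close>. In
    \<open>C\<close>, the term \<open>4 * A\<close> bounds the left part, where the second mean
    value theorem gives \<open>2 * w s * (2 / N)\<close>; the other term comes from integrating
    \<open>(\<theta> - \<phi>) powr (2 * \<mu>)\<close> over a length of at most
    \<open>1 / N\<close>.\<close>
  define A where "A = (1 / 8 :: real) powr \<mu>"
  define C where "C = 4 * A + A / (2 * \<mu> + 1)"
  have A: "A > 0" by (simp add: A_def)
  have C: "C > 0" using A \<mu> by (auto simp: C_def intro!: add_pos_pos)
  have "\<bar>mehler N \<mu> \<theta>\<bar> \<le> C * N powr (- (2 * \<mu> + 1))"
    if N: "N = real n + 1 / 2" and \<theta>: "0 < \<theta>" "\<theta> < pi" for N n \<theta>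
  proof -
    have N0: "N > 0" by (simp add: N)
    define w where "w \<phi> = (cos \<phi> - cos \<theta>) powr \<mu>" for \<phi>
    have int: "set_integrable lebesgue {0<..<\<theta>} (\<lambda>\<phi>. cos (N * \<phi>) * w \<phi>)"
      unfolding w_def N using \<mu> \<theta> by (intro mehler_expansion(1)) auto
    have w_le: "w \<phi> \<le> A * (\<theta> - \<phi>) powr (2 * \<mu>)" if "0 \<le> \<phi>" "\<phi> < \<theta>" for \<phi>
    proof -
      have "w \<phi> \<le> ((\<theta> - \<phi>)\<^sup>2 / 8) powr \<mu>"
        unfolding w_def using cos_diff_ge[of \<phi> \<theta>] that \<theta> \<mu> by (intro powr_mono2') auto
      also have "\<dots> = A * ((\<theta> - \<phi>)\<^sup>2) powr \<mu>"
        by (simp only: A_def powr_mult[symmetric]) simp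
      also have "((\<theta> - \<phi>)\<^sup>2) powr \<mu> = (\<theta> - \<phi>) powr (2 * \<mu>)"
        using that by (simp add: powr_powr flip: powr_numeral)
      finally show ?thesis .
    qed
    \<comment> \<open>For \<open>\<theta> \<le> 1 / N\<close> the cut is at 0 and the left part is
      empty.\<close>
    define s where "s = max 0 (\<theta> - 1 / N)"
    have s: "0 \<le> s" "s < \<theta>" "\<theta> - s \<le> 1 / N" using \<theta> N0 by (auto simp: s_def)
    have split: "mehler N \<mu> \<theta> = (LINT \<phi>:{0<..<s}|lebesgue. cos (N * \<phi>) * w \<phi>) + (LINT \<phi>:{s<..<\<theta>}|lebesgue. cos (N * \<phi>) * w \<phi>)"
      unfolding mehler_def using set_integral_split[OF int, of s] s by (simp add: w_def)
    have p1: "\<bar>LINT \<phi>:{0<..<s}|lebesgue. cos (N * \<phi>) * w \<phi>\<bar> \<le> 4 * A * N powr (- (2 * \<mu> + 1))"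
    proof (cases "s = 0")
      case True
      then show ?thesis using A by (simp add: set_lebesgue_integral_def)
    next
      case False
      then have s': "s = \<theta> - 1 / N" by (auto simp: s_def)
      have "\<bar>LINT \<phi>:{0<..<s}|lebesgue. cos (N * \<phi>) * w \<phi>\<bar> \<le> 2 * w s * (2 / N)"
      proof (rule second_mean_value_bound)
        show "w x \<le> w y" if "0 \<le> x" "x \<le> y" "y \<le> s" for x y
          unfolding w_def using that s \<theta> \<mu> cos_monotone_0_pi_le[of x y] cos_monotone_0_pi[of y \<theta>]
          by (intro powr_mono2') auto
        show "set_integrable lebesgue {0<..<s} (\<lambda>x. cos (N * x) * w x)"
          by (rule set_integrable_subset[OF int]) (use s in auto)
      qed (use s integral_cos_bound[OF N0] in \<open>auto simp: w_def intro!: continuous_intros\<close>)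
      also have "\<dots> \<le> 2 * (A * (1 / N) powr (2 * \<mu>)) * (2 / N)"
        using w_le[of s] s s' N0 by (intro mult_right_mono mult_left_mono) auto
      also have "\<dots> = 4 * A * ((1 / N) powr (2 * \<mu>) * (1 / N) powr 1)" using N0 by simp
      also have "(1 / N) powr (2 * \<mu>) * (1 / N) powr 1 = N powr (- (2 * \<mu> + 1))"
        using N0 by (simp only: one_div_powr powr_add[symmetric]) simp
      finally show ?thesis .
    qed
    have i2: "set_integrable lebesgue {s<..<\<theta>} (\<lambda>\<phi>. (\<theta> - \<phi>) powr (2 * \<mu>))"
      and v2: "(LINT \<phi>:{s<..<\<theta>}|lebesgue. (\<theta> - \<phi>) powr (2 * \<mu>)) = (\<theta> - s) powr (2 * \<mu> + 1) / (2 * \<mu> + 1)"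
    proof -
      have B: "set_integrable lebesgue {s<..<\<theta>} (\<lambda>x. (x - s) powr (1 - 1) * (\<theta> - x) powr (2 * \<mu> + 1 - 1))"
         "(LINT x:{s<..<\<theta>}|lebesgue. (x - s) powr (1 - 1) * (\<theta> - x) powr (2 * \<mu> + 1 - 1)) = (\<theta> - s) powr (1 + (2 * \<mu> + 1) - 1) * Beta 1 (2 * \<mu> + 1)"
        by (rule Beta_interval; use \<mu> s in simp)+
      have "set_integrable lebesgue {s<..<\<theta>} (\<lambda>x. (x - s) powr (1 - 1) * (\<theta> - x) powr (2 * \<mu> + 1 - 1)) \<longleftrightarrow> set_integrable lebesgue {s<..<\<theta>} (\<lambda>\<phi>. (\<theta> - \<phi>) powr (2 * \<mu>))"
        by (intro set_integrable_cong) auto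
      then show "set_integrable lebesgue {s<..<\<theta>} (\<lambda>\<phi>. (\<theta> - \<phi>) powr (2 * \<mu>))" using B(1) by (simp only:)
      have "(LINT x:{s<..<\<theta>}|lebesgue. (x - s) powr (1 - 1) * (\<theta> - x) powr (2 * \<mu> + 1 - 1)) = (LINT \<phi>:{s<..<\<theta>}|lebesgue. (\<theta> - \<phi>) powr (2 * \<mu>))"
        by (intro set_lebesgue_integral_cong) auto
      moreover have "Beta 1 (2 * \<mu> + 1) = 1 / (2 * \<mu> + 1)"
      proof -
        have pos: "2 * \<mu> + 1 > 0" using \<mu> by simp
        then have "2 * \<mu> + 1 \<notin> \<int>\<^sub>\<le>\<^sub>0" by (meson nonpos_Ints_nonpos not_less)
        then have "Gamma (2 * \<mu> + 1 + 1) = (2 * \<mu> + 1) * Gamma (2 * \<mu> + 1)"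
          by (rule Gamma_plus1)
        moreover have "Gamma (2 * \<mu> + 1) \<noteq> 0"
          using less_imp_neq[OF Gamma_real_pos[OF pos]] by simp
        ultimately show ?thesis by (simp add: Beta_def add_ac)
      qed
      ultimately show "(LINT \<phi>:{s<..<\<theta>}|lebesgue. (\<theta> - \<phi>) powr (2 * \<mu>)) = (\<theta> - s) powr (2 * \<mu> + 1) / (2 * \<mu> + 1)"
        using B(2) by (simp add: add.commute)
    qed
    have "\<bar>LINT \<phi>:{s<..<\<theta>}|lebesgue. cos (N * \<phi>) * w \<phi>\<bar> \<le> (LINT \<phi>:{s<..<\<theta>}|lebesgue. A * (\<theta> - \<phi>) powr (2 * \<mu>))"
    proof (rule set_integral_abs_le)
      show "set_integrable lebesgue {s<..<\<theta>} (\<lambda>\<phi>. cos (N * \<phi>) * w \<phi>)"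
        by (rule set_integrable_subset[OF int]) (use s in auto)
      show "set_integrable lebesgue {s<..<\<theta>} (\<lambda>\<phi>. A * (\<theta> - \<phi>) powr (2 * \<mu>))" using i2 by simp
      fix \<phi> assume \<phi>: "\<phi> \<in> {s<..<\<theta>}"
      have "\<bar>cos (N * \<phi>) * w \<phi>\<bar> \<le> 1 * w \<phi>"
        unfolding abs_mult by (intro mult_mono) (auto simp: w_def)
      also have "1 * w \<phi> \<le> A * (\<theta> - \<phi>) powr (2 * \<mu>)" using w_le[of \<phi>] \<phi> s by auto
      finally show "\<bar>cos (N * \<phi>) * w \<phi>\<bar> \<le> A * (\<theta> - \<phi>) powr (2 * \<mu>)" .
    qed
    also have "\<dots> = A / (2 * \<mu> + 1) * (\<theta> - s) powr (2 * \<mu> + 1)" using v2 by simp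
    also have "\<dots> \<le> A / (2 * \<mu> + 1) * (1 / N) powr (2 * \<mu> + 1)"
      using s A \<mu> by (intro mult_left_mono powr_mono2) auto
    also have "(1 / N) powr (2 * \<mu> + 1) = N powr (- (2 * \<mu> + 1))"
      using N0 by (rule one_div_powr)
    finally have p2: "\<bar>LINT \<phi>:{s<..<\<theta>}|lebesgue. cos (N * \<phi>) * w \<phi>\<bar> \<le> A / (2 * \<mu> + 1) * N powr (- (2 * \<mu> + 1))" .
    show ?thesis unfolding split C_def distrib_right using p1 p2 by linarith
  qed
  then show ?thesis using C by blast
qed

text \<open>The integrand is the exact derivative of a power of
  \<open>cos \<phi> - cos \<theta>\<close>. For \<open>\<mu> < 1\<close> it is singular at
  \<open>\<theta>\<close>, and its sign turns the existence of the integral into absolute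
  integrability.\<close>

lemma set_integral_sin_powr:
  assumes \<mu>: "\<mu> > 0" and s: "0 \<le> s" "s \<le> \<theta>" and \<theta>: "0 < \<theta>" "\<theta> < pi"
  shows "set_integrable lebesgue {s<..<\<theta>} (\<lambda>\<phi>. sin \<phi> * (cos \<phi> - cos \<theta>) powr (\<mu> - 1))"
    and "(LINT \<phi>:{s<..<\<theta>}|lebesgue. sin \<phi> * (cos \<phi> - cos \<theta>) powr (\<mu> - 1)) = (cos s - cos \<theta>) powr \<mu> / \<mu>"
proof -
  let ?F = "\<lambda>\<phi>. - ((cos \<phi> - cos \<theta>) powr \<mu> / \<mu>)" and ?f = "\<lambda>\<phi>. sin \<phi> * (cos \<phi> - cos \<theta>) powr (\<mu> - 1)"
  have cF: "continuous_on {s..\<theta>} ?F"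
    using \<mu> s \<theta> by (intro continuous_intros continuous_on_powr') (auto intro!: cos_monotone_0_pi_le)
  have dF: "(?F has_real_derivative ?f \<phi>) (at \<phi>)" if "s < \<phi>" "\<phi> < \<theta>" for \<phi>
  proof -
    have "cos \<theta> < cos \<phi>" using that s \<theta> by (intro cos_monotone_0_pi) auto
    then show ?thesis using \<mu> by (auto intro!: derivative_eq_intros)
  qed
  have "(?f has_integral ?F \<theta> - ?F s) {s..\<theta>}"
    using s cF dF by (intro fundamental_theorem_of_calculus_interior)
      (auto simp flip: has_real_derivative_iff_has_vector_derivative)
  then have hi: "(?f has_integral (cos s - cos \<theta>) powr \<mu> / \<mu>) {s<..<\<theta>}"
    using \<mu> by (simp add: has_integral_Icc_iff_Ioo)
  have "sin \<phi> \<ge> 0" if "s < \<phi>" "\<phi> < \<theta>" for \<phi> using that s \<theta> by (intro sin_ge_zero) auto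
  then show i: "set_integrable lebesgue {s<..<\<theta>} ?f"
    using hi by (intro nonnegative_absolutely_integrable_1) (auto simp: has_integral_iff)
  show "(LINT \<phi>:{s<..<\<theta>}|lebesgue. ?f \<phi>) = (cos s - cos \<theta>) powr \<mu> / \<mu>"
    using i hi by (simp add: set_lebesgue_integral_eq_integral integral_unique)
qed

text \<open>The boundary terms vanish at 0 because of the sine and at \<open>\<theta>\<close>
  because \<open>\<mu> > 0\<close>. A factor \<open>1 / N\<close> is gained at the price of lowering
  the exponent by one.\<close>

lemma mehler_by_parts:
  assumes \<mu>: "\<mu> > 0" and N: "N > 0" and \<theta>: "0 < \<theta>" "\<theta> < pi"
  shows "set_integrable lebesgue {0<..<\<theta>} (\<lambda>\<phi>. sin (N * \<phi>) * sin \<phi> * (cos \<phi> - cos \<theta>) powr (\<mu> - 1))"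
    and "mehler N \<mu> \<theta> = \<mu> / N * (LINT \<phi>:{0<..<\<theta>}|lebesgue. sin (N * \<phi>) * sin \<phi> * (cos \<phi> - cos \<theta>) powr (\<mu> - 1))"
proof -
  let ?w = "\<lambda>\<phi>. (cos \<phi> - cos \<theta>) powr \<mu>" and ?v = "\<lambda>\<phi>. sin \<phi> * (cos \<phi> - cos \<theta>) powr (\<mu> - 1)"
  have cw: "continuous_on {0..\<theta>} ?w"
    using \<mu> \<theta> by (intro continuous_intros continuous_on_powr') (auto intro!: cos_monotone_0_pi_le)
  have "set_integrable lebesgue {0<..<\<theta>} (\<lambda>\<phi>. ?v \<phi> * sin (N * \<phi>))"
    using \<mu> \<theta> by (intro set_integrable_mult_continuous set_integral_sin_powr continuous_intros) auto
  then show i1: "set_integrable lebesgue {0<..<\<theta>} (\<lambda>\<phi>. sin (N * \<phi>) * sin \<phi> * (cos \<phi> - cos \<theta>) powr (\<mu> - 1))"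
    by (simp add: mult_ac)
  have i2: "set_integrable lebesgue {0<..<\<theta>} (\<lambda>\<phi>. cos (N * \<phi>) * ?w \<phi>)"
    by (intro set_integrable_continuous continuous_intros cw)
  let ?F = "\<lambda>\<phi>. sin (N * \<phi>) / N * ?w \<phi>"
  have "(LINT \<phi>:{0<..<\<theta>}|lebesgue. cos (N * \<phi>) * ?w \<phi> - \<mu> / N * (sin (N * \<phi>) * sin \<phi> * (cos \<phi> - cos \<theta>) powr (\<mu> - 1))) = ?F \<theta> - ?F 0"
  proof (rule LINT_eq_diff)
    show "continuous_on {0..\<theta>} ?F" using N by (intro continuous_intros cw) auto
    fix \<phi> assume \<phi>: "0 < \<phi>" "\<phi> < \<theta>"
    then have "cos \<theta> < cos \<phi>" using \<theta> by (intro cos_monotone_0_pi) auto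
    then show "(?F has_real_derivative cos (N * \<phi>) * ?w \<phi> - \<mu> / N * (sin (N * \<phi>) * sin \<phi> * (cos \<phi> - cos \<theta>) powr (\<mu> - 1))) (at \<phi>)"
      using N by (auto intro!: derivative_eq_intros simp: field_simps)
  qed (use \<theta> i1 i2 in auto)
  also have "?F \<theta> - ?F 0 = 0" using \<mu> by simp
  finally show "mehler N \<mu> \<theta> = \<mu> / N * (LINT \<phi>:{0<..<\<theta>}|lebesgue. sin (N * \<phi>) * sin \<phi> * (cos \<phi> - cos \<theta>) powr (\<mu> - 1))"
    using i1 i2 by (simp add: mehler_def)
qed

text \<open>The factor \<open>sin x\<close> stays with the oscillating part, so that the weight left
  over in Mehler's integral is monotone. Of the 6, the boundary terms account for 2 and the length
  of the interval, at most \<open>pi < 4\<close>, for the rest.\<close>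

lemma integral_sin_sin_bound:
  fixes N c d :: real
  assumes "N > 0" "0 \<le> c" "c \<le> d" "d \<le> pi"
  shows "\<bar>integral {c..d} (\<lambda>x. sin (N * x) * sin x)\<bar> \<le> 6 / N"
proof -
  have i: "(\<lambda>x. cos (N * x) * cos x / N) integrable_on {c..d}"
    using assms by (intro integrable_continuous_interval continuous_intros) auto
  have "((\<lambda>x. sin (N * x) * sin x - cos (N * x) * cos x / N) has_integral (- cos (N * d) * sin d / N) - (- cos (N * c) * sin c / N)) {c..d}"
    using assms by (intro fundamental_theorem_of_calculus[of c d "\<lambda>x. - cos (N * x) * sin x / N"])
      (auto intro!: derivative_eq_intros simp: field_simps simp flip: has_real_derivative_iff_has_vector_derivative)
  from has_integral_add[OF this integrable_integral[OF i]]
  have "integral {c..d} (\<lambda>x. sin (N * x) * sin x) = (- cos (N * d) * sin d / N) - (- cos (N * c) * sin c / N) + integral {c..d} (\<lambda>x. cos (N * x) * cos x / N)"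
    by (simp add: integral_unique)
  moreover have "\<bar>integral {c..d} (\<lambda>x. cos (N * x) * cos x / N)\<bar> \<le> 4 / N"
  proof -
    have "norm (integral {c..d} (\<lambda>x. cos (N * x) * cos x / N)) \<le> integral {c..d} (\<lambda>x. 1 / N)"
    proof (rule integral_norm_bound_integral[OF i])
      fix x
      have "\<bar>cos (N * x) * cos x\<bar> \<le> 1" unfolding abs_mult by (intro mult_le_one) auto
      then show "norm (cos (N * x) * cos x / N) \<le> 1 / N" using assms by (simp add: divide_right_mono)
    qed auto
    also have "\<dots> = (d - c) / N" using assms by simp
    also have "\<dots> \<le> 4 / N" using assms pi_less_4 by (intro divide_right_mono) auto
    finally show ?thesis by simp
  qed
  moreover have "\<bar>- cos (N * x) * sin x / N\<bar> \<le> 1 / N" for x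
  proof -
    have "\<bar>cos (N * x) * sin x\<bar> \<le> 1" unfolding abs_mult by (intro mult_le_one) auto
    then show ?thesis using assms by (simp add: divide_right_mono)
  qed
  from this[of c] this[of d] have "\<bar>- cos (N * d) * sin d / N - (- cos (N * c) * sin c / N)\<bar> \<le> 1 / N + 1 / N"
    by linarith
  moreover have "6 / N = 1 / N + 1 / N + 4 / N" by (simp flip: add_divide_distrib)
  ultimately show ?thesis by linarith
qed

text \<open>After an integration by parts, split where \<open>cos \<phi> - cos \<theta> = 1 / N\<close>.\<close>

lemma mehler_bound_mid:
  assumes \<mu>: "0 < \<mu>" "\<mu> \<le> 1" and N: "N > 0" and \<theta>: "0 < \<theta>" "\<theta> < pi"
  shows "\<bar>mehler N \<mu> \<theta>\<bar> \<le> \<mu> * (12 + 1 / \<mu>) * N powr (- (\<mu> + 1))"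
proof -
  define w where "w \<phi> = (cos \<phi> - cos \<theta>) powr (\<mu> - 1)" for \<phi>
  let ?f = "\<lambda>\<phi>. sin (N * \<phi>) * sin \<phi> * w \<phi>"
  note parts = mehler_by_parts[OF \<mu>(1) N \<theta>, folded w_def]
  \<comment> \<open>Next to \<open>\<theta>\<close> the oscillation is dropped. The integrand
    without it has an exact primitive in \<open>cos \<phi>\<close>, which is why the cut is measured
    in the cosine and not in the angle.\<close>
  have tail: "\<bar>LINT \<phi>:{s<..<\<theta>}|lebesgue. ?f \<phi>\<bar> \<le> N powr (- \<mu>) / \<mu>"
    if s: "0 \<le> s" "s \<le> \<theta>" "cos s - cos \<theta> \<le> 1 / N" for s
  proof -
    have "\<bar>LINT \<phi>:{s<..<\<theta>}|lebesgue. ?f \<phi>\<bar> \<le> (LINT \<phi>:{s<..<\<theta>}|lebesgue. sin \<phi> * w \<phi>)"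
    proof (rule set_integral_abs_le)
      show "set_integrable lebesgue {s<..<\<theta>} ?f"
        by (rule set_integrable_subset[OF parts(1)]) (use s in auto)
      show "set_integrable lebesgue {s<..<\<theta>} (\<lambda>\<phi>. sin \<phi> * w \<phi>)"
        unfolding w_def using \<mu> s \<theta> by (intro set_integral_sin_powr) auto
      fix \<phi> assume "\<phi> \<in> {s<..<\<theta>}"
      then have "sin \<phi> \<ge> 0" using s \<theta> by (intro sin_ge_zero) auto
      then show "\<bar>?f \<phi>\<bar> \<le> sin \<phi> * w \<phi>"
        by (auto simp: abs_mult w_def mult.assoc intro!: mult_left_le_one_le)
    qed
    also have "\<dots> = (cos s - cos \<theta>) powr \<mu> / \<mu>"
      unfolding w_def using \<mu> s \<theta> by (intro set_integral_sin_powr) auto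
    also have "\<dots> \<le> (1 / N) powr \<mu> / \<mu>"
      using s \<mu> \<theta> cos_monotone_0_pi_le[of s \<theta>] by (intro divide_right_mono powr_mono2) auto
    also have "(1 / N) powr \<mu> = N powr (- \<mu>)"
      using N by (rule one_div_powr)
    finally show ?thesis .
  qed
  have K: "\<bar>LINT \<phi>:{0<..<\<theta>}|lebesgue. ?f \<phi>\<bar> \<le> (12 + 1 / \<mu>) * N powr (- \<mu>)"
  \<comment> \<open>If already \<open>\<phi> = 0\<close> satisfies the tail condition, the tail
    estimate covers the whole interval.\<close>
  proof (cases "1 - cos \<theta> \<le> 1 / N")
    case True
    have "\<bar>LINT \<phi>:{0<..<\<theta>}|lebesgue. ?f \<phi>\<bar> \<le> N powr (- \<mu>) / \<mu>" using tail[of 0] True \<theta> by simp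
    also have "\<dots> \<le> (12 + 1 / \<mu>) * N powr (- \<mu>)" by (simp add: distrib_right)
    finally show ?thesis .
  next
    case False
    define s where "s = arccos (cos \<theta> + 1 / N)"
    have c: "-1 \<le> cos \<theta>" "cos \<theta> + 1 / N \<le> 1" "0 < 1 / N" using False N by auto
    then have cs: "cos s = cos \<theta> + 1 / N" unfolding s_def by (intro cos_arccos) linarith+
    have s0: "0 \<le> s" unfolding s_def using c by (intro arccos_lbound) linarith+
    have "s < arccos (cos \<theta>)" unfolding s_def using c by (intro arccos_less_arccos) linarith+
    then have s1: "s < \<theta>" using \<theta> by (simp add: arccos_cos)
    have "\<bar>LINT \<phi>:{0<..<s}|lebesgue. ?f \<phi>\<bar> \<le> 2 * w s * (6 / N)"
    proof (rule second_mean_value_bound)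
      show "w x \<le> w y" if "0 \<le> x" "x \<le> y" "y \<le> s" for x y
        unfolding w_def using that s0 s1 \<theta> \<mu> cos_monotone_0_pi_le[of x y] cos_monotone_0_pi[of y \<theta>]
        by (intro powr_mono2') auto
      show "set_integrable lebesgue {0<..<s} ?f"
        by (rule set_integrable_subset[OF parts(1)]) (use s1 in auto)
    qed (use s0 s1 \<theta> integral_sin_sin_bound[OF N] in \<open>auto simp: w_def intro!: continuous_intros\<close>)
    also have "w s = (1 / N) powr (\<mu> - 1)" unfolding w_def cs by simp
    also have "2 * (1 / N) powr (\<mu> - 1) * (6 / N) = 12 * ((1 / N) powr (\<mu> - 1) * (1 / N) powr 1)"
      using N by simp
    also have "(1 / N) powr (\<mu> - 1) * (1 / N) powr 1 = N powr (- \<mu>)"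
      using N by (simp only: one_div_powr powr_add[symmetric]) simp
    finally have "\<bar>LINT \<phi>:{0<..<s}|lebesgue. ?f \<phi>\<bar> \<le> 12 * N powr (- \<mu>)" .
    moreover have "\<bar>LINT \<phi>:{s<..<\<theta>}|lebesgue. ?f \<phi>\<bar> \<le> N powr (- \<mu>) / \<mu>"
      using tail[of s] s0 s1 cs by simp
    moreover have "(LINT \<phi>:{0<..<\<theta>}|lebesgue. ?f \<phi>) = (LINT \<phi>:{0<..<s}|lebesgue. ?f \<phi>) + (LINT \<phi>:{s<..<\<theta>}|lebesgue. ?f \<phi>)"
      using s0 s1 by (intro set_integral_split parts(1)) auto
    moreover have "(12 + 1 / \<mu>) * N powr (- \<mu>) = 12 * N powr (- \<mu>) + N powr (- \<mu>) / \<mu>"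
      by (simp add: distrib_right)
    ultimately show ?thesis by linarith
  qed
  have "\<bar>mehler N \<mu> \<theta>\<bar> = \<mu> / N * \<bar>LINT \<phi>:{0<..<\<theta>}|lebesgue. ?f \<phi>\<bar>"
    unfolding parts(2) using \<mu> N by (simp add: abs_mult)
  also have "\<dots> \<le> \<mu> / N * ((12 + 1 / \<mu>) * N powr (- \<mu>))"
    using K \<mu> N by (intro mult_left_mono) auto
  also have "\<dots> = \<mu> * (12 + 1 / \<mu>) * (N powr (- \<mu>) / N powr 1)" using N by simp
  also have "N powr (- \<mu>) / N powr 1 = N powr (- (\<mu> + 1))"
    by (simp only: powr_diff[symmetric] minus_add_distrib diff_conv_add_uminus)
  finally show ?thesis .
qed

text \<open>Product to sum: \<open>sin (N * \<phi>) * sin \<phi>\<close> is half the difference of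
  the cosines with frequencies \<open>N - 1\<close> and \<open>N + 1\<close>, so the integration by
  parts stays within the family \<open>mehler\<close>.\<close>

lemma mehler_recurrence:
  assumes \<mu>: "\<mu> \<ge> 1" and N: "N > 0" and \<theta>: "0 < \<theta>" "\<theta> < pi"
  shows "mehler N \<mu> \<theta> = \<mu> / (2 * N) * (mehler (N - 1) (\<mu> - 1) \<theta> - mehler (N + 1) (\<mu> - 1) \<theta>)"
\<comment> \<open>For \<open>\<mu> = 1\<close> the lowered weight has exponent 0. Since
  \<open>0 powr 0 = 0\<close>, it jumps at \<open>\<theta>\<close>; instead of using continuity it
  is replaced by 1 on the open interval.\<close>
proof (cases "\<mu> = 1")
  case True
  have i: "set_integrable lebesgue {0<..<\<theta>} (\<lambda>\<phi>. cos (M * \<phi>))" for M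
    by (intro set_integrable_continuous continuous_intros)
  have m: "mehler M 0 \<theta> = (LINT \<phi>:{0<..<\<theta>}|lebesgue. cos (M * \<phi>))" for M
    unfolding mehler_def
  proof (rule set_lebesgue_integral_cong, simp, intro allI impI)
    fix x assume "x \<in> {0<..<\<theta>}"
    then have "cos \<theta> < cos x" using \<theta> by (intro cos_monotone_0_pi) auto
    then show "cos (M * x) * (cos x - cos \<theta>) powr 0 = cos (M * x)" by simp
  qed
  have a: "(LINT \<phi>:{0<..<\<theta>}|lebesgue. sin (N * \<phi>) * sin \<phi> * (cos \<phi> - cos \<theta>) powr (1 - 1))
    = (LINT \<phi>:{0<..<\<theta>}|lebesgue. (cos ((N - 1) * \<phi>) - cos ((N + 1) * \<phi>)) / 2)"
  proof (rule set_lebesgue_integral_cong, simp, intro allI impI)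
    fix x assume "x \<in> {0<..<\<theta>}"
    then have "cos \<theta> < cos x" using \<theta> by (intro cos_monotone_0_pi) auto
    then show "sin (N * x) * sin x * (cos x - cos \<theta>) powr (1 - 1) = (cos ((N - 1) * x) - cos ((N + 1) * x)) / 2"
      by (simp add: left_diff_distrib distrib_right cos_add cos_diff)
  qed
  have b: "mehler N 1 \<theta> = 1 / N * (LINT \<phi>:{0<..<\<theta>}|lebesgue. sin (N * \<phi>) * sin \<phi> * (cos \<phi> - cos \<theta>) powr (1 - 1))"
    by (rule mehler_by_parts(2)[OF _ N \<theta>]) simp
  show ?thesis unfolding True b a using i by (simp add: m)
next
  case False
  then have cw: "continuous_on {0..\<theta>} (\<lambda>\<phi>. (cos \<phi> - cos \<theta>) powr (\<mu> - 1))"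
    using \<mu> \<theta> by (intro continuous_intros continuous_on_powr') (auto intro!: cos_monotone_0_pi_le)
  have i: "set_integrable lebesgue {0<..<\<theta>} (\<lambda>\<phi>. cos (M * \<phi>) * (cos \<phi> - cos \<theta>) powr (\<mu> - 1))" for M
    by (intro set_integrable_continuous continuous_intros cw)
  have eq: "sin (N * x) * sin x * c = (cos ((N - 1) * x) * c - cos ((N + 1) * x) * c) / 2" for x c
    by (simp add: left_diff_distrib distrib_right cos_add cos_diff)
  have eq2: "(LINT \<phi>:{0<..<\<theta>}|lebesgue. sin (N * \<phi>) * sin \<phi> * (cos \<phi> - cos \<theta>) powr (\<mu> - 1))
     = (mehler (N - 1) (\<mu> - 1) \<theta> - mehler (N + 1) (\<mu> - 1) \<theta>) / 2"
    unfolding eq using i[of "N - 1"] i[of "N + 1"] by (simp add: mehler_def)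
  have "mehler N \<mu> \<theta> = \<mu> / N * (LINT \<phi>:{0<..<\<theta>}|lebesgue. sin (N * \<phi>) * sin \<phi> * (cos \<phi> - cos \<theta>) powr (\<mu> - 1))"
    by (rule mehler_by_parts(2)[OF _ N \<theta>]) (use \<mu> in simp)
  then show ?thesis unfolding eq2 by simp
qed

text \<open>Serves \<open>n = 0\<close>, where the recurrence would lead to the frequency
  \<open>-1 / 2\<close>, outside the frequencies \<open>real n + 1 / 2\<close> of the
  induction.\<close>

lemma mehler_trivial_bound:
  assumes \<mu>: "\<mu> > 0" and \<theta>: "0 < \<theta>" "\<theta> < pi"
  shows "\<bar>mehler N \<mu> \<theta>\<bar> \<le> 4 * 2 powr \<mu>"
proof -
  have cos_le: "0 \<le> cos \<phi> - cos \<theta>" if "\<phi> \<in> {0..\<theta>}" for \<phi>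
    using that \<theta> by (simp add: cos_monotone_0_pi_le)
  have "\<bar>mehler N \<mu> \<theta>\<bar> \<le> (LINT \<phi>:{0<..<\<theta>}|lebesgue. 2 powr \<mu>)"
    unfolding mehler_def
  proof (rule set_integral_abs_le)
    show "set_integrable lebesgue {0<..<\<theta>} (\<lambda>\<phi>. cos (N * \<phi>) * (cos \<phi> - cos \<theta>) powr \<mu>)"
      using \<mu> cos_le by (intro set_integrable_continuous continuous_intros continuous_on_powr') auto
    show "set_integrable lebesgue {0<..<\<theta>} (\<lambda>\<phi>. 2 powr \<mu>)"
      by (intro set_integrable_continuous continuous_intros)
    fix \<phi> assume "\<phi> \<in> {0<..<\<theta>}"
    then have "0 \<le> cos \<phi> - cos \<theta>" by (intro cos_le) auto
    moreover have "cos \<phi> - cos \<theta> \<le> 2" using cos_le_one[of \<phi>] cos_ge_minus_one[of \<theta>] by linarith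
    ultimately have "(cos \<phi> - cos \<theta>) powr \<mu> \<le> 2 powr \<mu>" using \<mu> by (intro powr_mono2) auto
    then have "\<bar>cos (N * \<phi>)\<bar> * (cos \<phi> - cos \<theta>) powr \<mu> \<le> 1 * 2 powr \<mu>"
      by (intro mult_mono) auto
    then show "\<bar>cos (N * \<phi>) * (cos \<phi> - cos \<theta>) powr \<mu>\<bar> \<le> 2 powr \<mu>" by (simp add: abs_mult)
  qed
  also have "(LINT \<phi>:{0<..<\<theta>}|lebesgue. 2 powr \<mu>) = 2 powr \<mu> * \<theta> - 2 powr \<mu> * 0"
    using \<theta> by (intro LINT_eq_diff set_integrable_continuous continuous_intros) (auto intro!: derivative_eq_intros)
  also have "\<dots> \<le> 2 powr \<mu> * 4" using \<theta> pi_less_4 by (simp add: mult_left_mono)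
  finally show ?thesis by simp
qed

text \<open>The two direct estimates cover \<open>g \<le> 3 / 2\<close>. Above this,
  \<open>mehler_recurrence\<close> lowers \<open>g\<close> by one and gains \<open>1 / N\<close>; it
  is applied only when \<open>g - 1 > 1 / 2\<close>, so the exponent stays in the branch
  \<open>g + 1 / 2\<close> of the minimum.\<close>

lemma mehler_bound:
  assumes "g > 0"
  shows "\<exists>C>0. \<forall>n \<theta>. 0 < \<theta> \<longrightarrow> \<theta> < pi \<longrightarrow>
    \<bar>mehler (real n + 1 / 2) (g - 1 / 2) \<theta>\<bar> \<le> C * (real n + 1 / 2) powr (- min (2 * g) (g + 1 / 2))"
proof -
  obtain r where "g \<le> real r + 3 / 2"
    using real_arch_simple[of g] by (metis add_increasing2 divide_nonneg_nonneg zero_le_numeral)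
  then show ?thesis using assms
  proof (induction r arbitrary: g)
    case (0 g)
    show ?case
    proof (cases "g \<le> 1 / 2")
      case True
      have "- min (2 * g) (g + 1 / 2) = - (2 * (g - 1 / 2) + 1)" using True by simp
      then show ?thesis using mehler_bound_low[of "g - 1 / 2"] True 0 by (simp only:)
    next
      case False
      define C where "C = (g - 1 / 2) * (12 + 1 / (g - 1 / 2))"
      have e: "- min (2 * g) (g + 1 / 2) = - (g - 1 / 2 + 1)" using False by simp
      have "C > 0" using False by (auto simp: C_def intro!: mult_pos_pos add_pos_pos)
      moreover have "\<bar>mehler (real n + 1 / 2) (g - 1 / 2) \<theta>\<bar> \<le> C * (real n + 1 / 2) powr (- min (2 * g) (g + 1 / 2))"
        if "0 < \<theta>" "\<theta> < pi" for n \<theta>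
        unfolding e C_def using that False 0 by (intro mehler_bound_mid) (auto intro: add_nonneg_pos)
      ultimately show ?thesis by blast
    qed
  next
    case (Suc r g)
    show ?case
    proof (cases "g \<le> 3 / 2")
      case True
      then show ?thesis using Suc.IH[of g] Suc.prems by auto
    next
      case False
      define s where "s = g - 1 / 2"
      have s: "s > 1" using False by (simp add: s_def)
      have e: "- min (2 * g) (g + 1 / 2) = - (s + 1)" "- min (2 * (g - 1)) (g - 1 + 1 / 2) = - s" "g - 1 - 1 / 2 = s - 1"
        using False by (simp_all add: s_def)
      have "\<exists>C>0. \<forall>n \<theta>. 0 < \<theta> \<longrightarrow> \<theta> < pi \<longrightarrow>
          \<bar>mehler (real n + 1 / 2) (g - 1 - 1 / 2) \<theta>\<bar> \<le> C * (real n + 1 / 2) powr (- min (2 * (g - 1)) (g - 1 + 1 / 2))"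
        by (rule Suc.IH) (use Suc.prems False in auto)
      then obtain C where C: "C > 0"
        "\<And>n \<theta>. 0 < \<theta> \<Longrightarrow> \<theta> < pi \<Longrightarrow> \<bar>mehler (real n + 1 / 2) (s - 1) \<theta>\<bar> \<le> C * (real n + 1 / 2) powr (- s)"
        unfolding e by blast
      \<comment> \<open>\<open>3 powr s\<close> pays for replacing \<open>N - 1\<close> and
        \<open>N + 1\<close> by \<open>N\<close>, both being at least \<open>N / 3\<close> once
        \<open>N \<ge> 3 / 2\<close>. The second summand covers \<open>n = 0\<close>, where the
        power of \<open>1 / 2\<close> is at least 1.\<close>
      define D where "D = s * C * 3 powr s + 4 * 2 powr s"
      have D: "D > 0" using C s by (auto simp: D_def intro!: add_pos_pos mult_pos_pos)
      have "\<bar>mehler (real n + 1 / 2) s \<theta>\<bar> \<le> D * (real n + 1 / 2) powr (- (s + 1))" if \<theta>: "0 < \<theta>" "\<theta> < pi" for n \<theta>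
      proof (cases "n = 0")
        case True
        have "\<bar>mehler (real n + 1 / 2) s \<theta>\<bar> \<le> 4 * 2 powr s" using s by (intro mehler_trivial_bound \<theta>) auto
        also have "\<dots> \<le> D" using C s by (simp add: D_def)
        also have "D = D * 1" by simp
        also have "\<dots> \<le> D * (real n + 1 / 2) powr (- (s + 1))"
          using D s True by (intro mult_left_mono) (auto simp: one_div_powr intro!: ge_one_powr_ge_zero)
        finally show ?thesis .
      next
        case False
        define N where "N = real n + 1 / 2"
        have N: "N \<ge> 3 / 2" using False by (simp add: N_def)
        have n1: "N - 1 = real (n - 1) + 1 / 2" "N + 1 = real (n + 1) + 1 / 2" using False by (auto simp: N_def of_nat_diff)
        have *: "M powr (- s) \<le> 3 powr s * N powr (- s)" if "M \<ge> N / 3" for M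
        proof -
          have "M powr (- s) \<le> (N / 3) powr (- s)" using that s N by (intro powr_mono2') auto
          also have "\<dots> = 3 powr s * N powr (- s)"
            using N by (simp add: powr_divide powr_minus divide_simps)
          finally show ?thesis .
        qed
        have b1: "\<bar>mehler (N - 1) (s - 1) \<theta>\<bar> \<le> C * (3 powr s * N powr (- s))"
          using C(2)[OF \<theta>, of "n - 1", folded n1] *[of "N - 1"] N C(1)
          by (elim order_trans) (auto intro!: mult_left_mono)
        have b2: "\<bar>mehler (N + 1) (s - 1) \<theta>\<bar> \<le> C * (3 powr s * N powr (- s))"
          using C(2)[OF \<theta>, of "n + 1", folded n1] *[of "N + 1"] N C(1)
          by (elim order_trans) (auto intro!: mult_left_mono)
        have "mehler N s \<theta> = s / (2 * N) * (mehler (N - 1) (s - 1) \<theta> - mehler (N + 1) (s - 1) \<theta>)"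
          using s N by (intro mehler_recurrence \<theta>) auto
        then have "\<bar>mehler N s \<theta>\<bar> = s / (2 * N) * \<bar>mehler (N - 1) (s - 1) \<theta> - mehler (N + 1) (s - 1) \<theta>\<bar>"
          using s N by (simp add: abs_mult)
        also have "\<dots> \<le> s / (2 * N) * (2 * (C * (3 powr s * N powr (- s))))"
          using b1 b2 s N by (intro mult_left_mono) (auto simp: abs_le_iff)
        also have "\<dots> = s * C * 3 powr s * (N powr (- s) / N powr 1)" using N by simp
        also have "N powr (- s) / N powr 1 = N powr (- (s + 1))"
          by (simp only: powr_diff[symmetric] minus_add_distrib diff_conv_add_uminus)
        also have "s * C * 3 powr s * N powr (- (s + 1)) \<le> D * N powr (- (s + 1))"
          by (intro mult_right_mono) (auto simp: D_def)
        finally show ?thesis by (simp add: N_def)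
      qed
      then show ?thesis unfolding e s_def[symmetric] using D by blast
    qed
  qed
qed

lemma legendre_tail_bound:
  assumes "g > 0"
  shows "\<exists>C>0. \<forall>n\<ge>1. \<forall>t\<in>I_ref. \<bar>legendre_tail n g t\<bar> \<le> C * real n powr (- min (2 * g) (g + 1 / 2))"
proof -
  obtain C where C: "C > 0" "\<And>n \<theta>. 0 < \<theta> \<Longrightarrow> \<theta> < pi \<Longrightarrow>
    \<bar>mehler (real n + 1 / 2) (g - 1 / 2) \<theta>\<bar> \<le> C * (real n + 1 / 2) powr (- min (2 * g) (g + 1 / 2))"
    using mehler_bound[OF assms] by blast
  define A where "A = sqrt 2 * Gamma g / (Gamma (g + 1 / 2) * sqrt pi)"
  have A: "A > 0" using assms by (auto simp: A_def intro!: divide_pos_pos mult_pos_pos Gamma_real_pos)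
  have "\<bar>legendre_tail n g t\<bar> \<le> A * C * real n powr (- min (2 * g) (g + 1 / 2))" if n: "n \<ge> 1" and t: "t \<in> I_ref" for n t
  proof -
    define \<theta> where "\<theta> = arccos t"
    have \<theta>: "0 < \<theta>" "\<theta> < pi" using t arccos_lt_bounded[of t] by (auto simp: \<theta>_def)
    have ct: "cos \<theta> = t" using t by (simp add: \<theta>_def)
    have "\<bar>legendre_tail n g t\<bar> = A * \<bar>mehler (real n + 1 / 2) (g - 1 / 2) \<theta>\<bar>"
      using legendre_tail_eq_mehler[OF assms \<theta>, of n] A unfolding ct A_def[symmetric] by (simp add: abs_mult)
    also have "\<dots> \<le> A * (C * (real n + 1 / 2) powr (- min (2 * g) (g + 1 / 2)))"
      using A by (intro mult_left_mono C(2) \<theta>) auto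
    also have "\<dots> \<le> A * (C * real n powr (- min (2 * g) (g + 1 / 2)))"
      using A C n assms by (intro mult_left_mono powr_mono2') auto
    finally show ?thesis by simp
  qed
  moreover have "A * C > 0" using A C by simp
  ultimately show ?thesis by blast
qed

section \<open>Test functions\<close>

definition smooth :: "(real \<Rightarrow> real) \<Rightarrow> bool" where
  "smooth f \<longleftrightarrow> (\<forall>n. (deriv ^^ n) f differentiable_on UNIV)"

text \<open>In a family closed under differentiation the iterated derivatives never leave the
  family, so no n-th derivative has to be computed.\<close>

lemma smooth_coinduct:
  assumes "f \<in> X" and "\<And>f. f \<in> X \<Longrightarrow> \<exists>g\<in>X. \<forall>x. (f has_real_derivative g x) (at x)"
  shows "smooth f"
proof -
  have "\<forall>f\<in>X. (deriv ^^ n) f differentiable_on UNIV" for n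
  proof (induction n)
    case 0
    show ?case using assms(2)
      by (fastforce simp: differentiable_on_def real_differentiable_def)
  next
    case (Suc n)
    show ?case
    proof
      fix f assume "f \<in> X"
      then obtain g where g: "g \<in> X" "\<And>x. (f has_real_derivative g x) (at x)"
        using assms(2) by blast
      then have "deriv f = g" by (auto intro: DERIV_imp_deriv)
      then show "(deriv ^^ Suc n) f differentiable_on UNIV"
        using Suc g(1) by (simp add: funpow_Suc_right del: funpow.simps)
    qed
  qed
  then show ?thesis using assms(1) by (auto simp: smooth_def)
qed

lemma smooth_DERIV: "smooth f \<Longrightarrow> (f has_real_derivative deriv f x) (at x)"
  unfolding smooth_def
  by (metis DERIV_deriv_iff_real_differentiable UNIV_I differentiable_on_def funpow_0)

lemma smooth_deriv: "smooth f \<Longrightarrow> smooth (deriv f)"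
  unfolding smooth_def by (metis funpow_Suc_right o_apply)

lemma smooth_deriv_funpow: "smooth f \<Longrightarrow> smooth ((deriv ^^ n) f)"
  by (induction n) (auto intro: smooth_deriv)

lemma smooth_antideriv:
  assumes "\<And>x. (f has_real_derivative g x) (at x)" "smooth g"
  shows "smooth f"
proof (rule smooth_coinduct[of _ "insert f (Collect smooth)"])
  fix h assume "h \<in> insert f (Collect smooth)"
  then show "\<exists>k\<in>insert f (Collect smooth). \<forall>x. (h has_real_derivative k x) (at x)"
    using assms smooth_DERIV smooth_deriv by blast
qed simp

text \<open>By the sum, product and chain rules this closure of the smooth functions is again closed
  under differentiation, so \<open>smooth_coinduct\<close> settles all four operations at once, with
  no Leibniz formula.\<close>

inductive_set smooth_span :: "(real \<Rightarrow> real) set" where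
  base: "smooth f \<Longrightarrow> f \<in> smooth_span"
| add: "f \<in> smooth_span \<Longrightarrow> g \<in> smooth_span \<Longrightarrow> (\<lambda>x. f x + g x) \<in> smooth_span"
| mult: "f \<in> smooth_span \<Longrightarrow> g \<in> smooth_span \<Longrightarrow> (\<lambda>x. f x * g x) \<in> smooth_span"
| affine: "f \<in> smooth_span \<Longrightarrow> (\<lambda>x. c * f (a * x + b)) \<in> smooth_span"

lemma smooth_span_smooth:
  assumes "f \<in> smooth_span"
  shows "smooth f"
proof (rule smooth_coinduct[OF assms])
  fix f :: "real \<Rightarrow> real" assume "f \<in> smooth_span"
  then show "\<exists>g\<in>smooth_span. \<forall>x. (f has_real_derivative g x) (at x)"
  proof induction
    case (base f)
    then show ?case using smooth_DERIV smooth_deriv smooth_span.base by blast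
  next
    case (add f g)
    then obtain f' g' where *: "f' \<in> smooth_span" "g' \<in> smooth_span"
      "\<And>x. (f has_real_derivative f' x) (at x)" "\<And>x. (g has_real_derivative g' x) (at x)" by blast
    show ?case
      by (intro bexI[of _ "\<lambda>x. f' x + g' x"] allI DERIV_add smooth_span.add *)
  next
    case (mult f g)
    then obtain f' g' where *: "f' \<in> smooth_span" "g' \<in> smooth_span"
      "\<And>x. (f has_real_derivative f' x) (at x)" "\<And>x. (g has_real_derivative g' x) (at x)" by blast
    show ?case
      by (intro bexI[of _ "\<lambda>x. f' x * g x + g' x * f x"] allI DERIV_mult smooth_span.add smooth_span.mult * mult.hyps)
  next
    case (affine f c a b)
    then obtain f' where *: "f' \<in> smooth_span" "\<And>x. (f has_real_derivative f' x) (at x)" by blast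
    have "((\<lambda>x. c * f (a * x + b)) has_real_derivative (c * a) * f' (a * x + b)) (at x)" for x
      by (rule derivative_eq_intros DERIV_chain2[OF *(2)] refl | simp)+
    then show ?case
      by (intro bexI[of _ "\<lambda>x. (c * a) * f' (a * x + b)"] allI smooth_span.affine *(1))
  qed
qed

text \<open>The polynomial in \<open>1 / x\<close> makes the family closed under differentiation:
  with \<open>y = 1 / x\<close> the derivative of \<open>p y * exp (- y)\<close> in \<open>x\<close>
  is \<open>y^2 * (p y - p' y) * exp (- y)\<close>. The case \<open>p = 1\<close> is the classical
  function that is flat at 0.\<close>

definition flat :: "real poly \<Rightarrow> real \<Rightarrow> real" where
  "flat p x = (if x \<le> 0 then 0 else poly p (1 / x) * exp (- (1 / x)))"

lemma poly_times_exp_tendsto_0: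
  fixes p :: "real poly"
  shows "((\<lambda>x. poly p x * exp (- x)) \<longlongrightarrow> 0) at_top"
proof -
  have "((\<lambda>x. \<Sum>i\<le>degree p. coeff p i * (x ^ i / exp x)) \<longlongrightarrow> (\<Sum>i\<le>degree p. coeff p i * 0)) at_top"
    by (intro tendsto_sum tendsto_mult_left tendsto_power_div_exp_0)
  then show ?thesis
    by (simp add: poly_altdef sum_distrib_right exp_minus divide_inverse mult.assoc)
qed

lemma DERIV_flat:
  "(flat p has_real_derivative flat ([:0, 0, 1:] * (p - pderiv p)) x) (at x)"
proof -
  consider "x < 0" | "x > 0" | "x = 0" by linarith
  then show ?thesis
  proof cases
    case 1
    have "((\<lambda>_. 0) has_real_derivative 0) (at x)" by simp
    then have "(flat p has_real_derivative 0) (at x)"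
      by (rule has_field_derivative_transform_within_open[of _ _ _ "{..<0}"]) (use 1 in \<open>auto simp: flat_def\<close>)
    then show ?thesis using 1 by (simp add: flat_def)
  next
    case 2
    have "((\<lambda>x. poly p (1 / x) * exp (- (1 / x))) has_real_derivative
       poly (pderiv p) (1 / x) * (- 1 / x\<^sup>2) * exp (- (1 / x)) + (exp (- (1 / x)) * (1 / x\<^sup>2)) * poly p (1 / x)) (at x)"
      by (rule DERIV_mult DERIV_chain2[OF poly_DERIV] | (rule derivative_eq_intros refl | use 2 in \<open>simp add: power2_eq_square\<close>)+)+
    then have "(flat p has_real_derivative
       poly (pderiv p) (1 / x) * (- 1 / x\<^sup>2) * exp (- (1 / x)) + (exp (- (1 / x)) * (1 / x\<^sup>2)) * poly p (1 / x)) (at x)"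
      by (rule has_field_derivative_transform_within_open[of _ _ _ "{0<..}"]) (use 2 in \<open>auto simp: flat_def\<close>)
    moreover have "poly (pderiv p) (1 / x) * (- 1 / x\<^sup>2) * exp (- (1 / x)) + (exp (- (1 / x)) * (1 / x\<^sup>2)) * poly p (1 / x)
       = flat ([:0, 0, 1:] * (p - pderiv p)) x"
      using 2 by (simp add: flat_def power2_eq_square field_simps)
    ultimately show ?thesis by (simp only:)
  next
    case 3
    have r: "((\<lambda>h. flat p h / h) \<longlongrightarrow> 0) (at_right 0)"
    proof -
      \<comment> \<open>Dividing by \<open>h\<close> multiplies by \<open>y = 1 / h\<close>, that
        is, replaces \<open>p\<close> by \<open>pCons 0 p\<close>; then \<open>y\<close> tends to
        infinity.\<close>
      have "((\<lambda>x. poly (pCons 0 p) (inverse x) * exp (- inverse x)) \<longlongrightarrow> 0) (at_right (0::real))"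
        by (rule filterlim_compose[OF poly_times_exp_tendsto_0 filterlim_inverse_at_top_right])
      then show ?thesis
        by (rule Lim_transform_eventually)
           (auto simp: flat_def eventually_at_right_field divide_inverse intro!: exI[of _ 1])
    qed
    have l: "((\<lambda>h. flat p h / h) \<longlongrightarrow> 0) (at_left 0)"
      by (rule Lim_transform_eventually[OF tendsto_const])
         (auto simp: flat_def eventually_at_left_field intro!: exI[of _ "-1"])
    have "((\<lambda>h. (flat p (0 + h) - flat p 0) / h) \<longlongrightarrow> 0) (at 0)"
      using filterlim_split_at[OF l r] by (simp add: flat_def)
    then have "(flat p has_real_derivative 0) (at 0)" by (simp add: DERIV_def)
    then show ?thesis using 3 by (simp add: flat_def)
  qed
qed

lemma smooth_flat: "smooth (flat p)"
  by (rule smooth_coinduct[of _ "range flat"]) (use DERIV_flat in blast)+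

text \<open>A smooth substitute for the indicator of the open interval: it is bounded by 1 and
  converges to the indicator as \<open>j\<close> grows, because \<open>exp (- 1 / (j * y))\<close>
  tends to 1 for \<open>y > 0\<close>.\<close>

definition bump :: "real \<Rightarrow> real \<Rightarrow> nat \<Rightarrow> real \<Rightarrow> real" where
  "bump a b j x = flat 1 (real j * (x - a)) * flat 1 (real j * (b - x))"

lemma smooth_bump: "smooth (bump a b j)"
proof -
  have "(\<lambda>x. (1 * flat 1 (real j * x + (- real j * a))) * (1 * flat 1 ((- real j) * x + real j * b))) \<in> smooth_span"
    by (intro smooth_span.intros smooth_flat)
  also have "(\<lambda>x. (1 * flat 1 (real j * x + (- real j * a))) * (1 * flat 1 ((- real j) * x + real j * b))) = bump a b j"
    by (simp add: bump_def fun_eq_iff algebra_simps)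
  finally show ?thesis by (rule smooth_span_smooth)
qed

lemma bump_nonneg: "0 \<le> bump a b j x" and bump_le_1: "bump a b j x \<le> 1"
  by (auto simp: bump_def flat_def intro!: mult_le_one)

lemma bump_eq_0: "x \<notin> {a<..<b} \<Longrightarrow> bump a b j x = 0"
  by (auto simp: bump_def flat_def mult_le_0_iff not_less)

lemma bump_pos: "x \<in> {a<..<b} \<Longrightarrow> j > 0 \<Longrightarrow> bump a b j x > 0"
  by (auto simp: bump_def flat_def mult_le_0_iff not_less)

lemma flat_1_tendsto:
  assumes "y > 0" shows "(\<lambda>j. flat 1 (real j * y)) \<longlonglongrightarrow> 1"
proof -
  have "(\<lambda>j. exp (- (1 / y * (1 / real j)))) \<longlonglongrightarrow> exp (- (1 / y * 0))"
    by (intro tendsto_intros lim_1_over_n)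
  then have "(\<lambda>j. exp (- (1 / y * (1 / real j)))) \<longlonglongrightarrow> 1" by simp
  then show ?thesis
    by (rule Lim_transform_eventually)
       (use assms in \<open>auto simp: flat_def eventually_sequentially mult_le_0_iff mult.commute intro!: exI[of _ 1]\<close>)
qed

lemma bump_tendsto: "(\<lambda>j. bump a b j x) \<longlonglongrightarrow> indicator {a<..<b} x"
proof (cases "x \<in> {a<..<b}")
  case True
  then have "(\<lambda>j. bump a b j x) \<longlonglongrightarrow> 1 * 1"
    unfolding bump_def by (intro tendsto_mult flat_1_tendsto) auto
  then show ?thesis using True by simp
qed (simp add: bump_eq_0)

section \<open>Test functions on the reference interval\<close>

lemma test_functionI:
  assumes "smooth f" "-1 < a" "b < 1" "\<And>x. x \<notin> {a..b} \<Longrightarrow> f x = 0"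
  shows "test_function I_ref f"
proof -
  have "closure {x. f x \<noteq> 0} \<subseteq> {a..b}"
    by (rule closure_minimal) (use assms(4) in blast, simp)
  moreover from this have "compact (closure {x. f x \<noteq> 0})"
    by (meson bounded_subset bounded_closed_interval closed_closure compact_eq_bounded_closed)
  ultimately show ?thesis using assms(1-3) by (auto simp: test_function_def smooth_def)
qed

lemma test_function_smooth: "test_function S f \<Longrightarrow> smooth f"
  by (simp add: test_function_def smooth_def)

lemma test_functionE:
  assumes "test_function I_ref f"
  obtains a b where "-1 < a" "a < b" "b < 1" "\<forall>x. x \<notin> {a..b} \<longrightarrow> f x = 0"
proof (cases "{x. f x \<noteq> 0} = {}")
  case True
  then show thesis using that[of "-1/2" "1/2"] by auto
next
  case False
  define K where "K = closure {x. f x \<noteq> 0}"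
  have K: "compact K" "K \<subseteq> I_ref" "K \<noteq> {}"
    using assms False by (auto simp: K_def test_function_def)
  obtain a b where ab: "a \<in> K" "b \<in> K" "\<And>x. x \<in> K \<Longrightarrow> a \<le> x \<and> x \<le> b"
    using compact_attains_inf[OF K(1,3)] compact_attains_sup[OF K(1,3)] by metis
  \<comment> \<open>The right end is moved from \<open>b\<close> to \<open>c\<close> because the
    support may be a single point, while the interval must be nondegenerate.\<close>
  obtain c where c: "b < c" "c < 1" using dense[of b 1] subsetD[OF K(2) ab(2)] by auto
  show thesis
  proof (rule that[of a c])
    show "\<forall>x. x \<notin> {a..c} \<longrightarrow> f x = 0"
    proof (intro allI impI, rule ccontr)
      fix x assume that: "x \<notin> {a..c}" "f x \<noteq> 0"
      then have "x \<in> K" using closure_subset[of "{x. f x \<noteq> 0}"] by (auto simp: K_def)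
      then show False using ab(3)[of x] c that by auto
    qed
  qed (use ab(1,2) ab(3)[OF ab(1)] K(2) c in auto)
qed

lemma test_function_deriv:
  assumes "test_function I_ref f"
  shows "test_function I_ref (deriv f)"
proof -
  obtain a b where ab: "-1 < a" "a < b" "b < 1" "\<forall>x. x \<notin> {a..b} \<longrightarrow> f x = 0"
    using test_functionE[OF assms] .
  have "deriv f x = 0" if "x \<notin> {a..b}" for x
  proof -
    have "((\<lambda>_. 0) has_real_derivative 0) (at x)" by simp
    then have "(f has_real_derivative 0) (at x)"
      by (rule has_field_derivative_transform_within_open[of _ _ _ "- {a..b}"]) (use ab that in auto)
    then show ?thesis by (rule DERIV_imp_deriv)
  qed
  then show ?thesis
    using ab smooth_deriv[OF test_function_smooth[OF assms]] by (intro test_functionI[of _ a b])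
qed

lemma test_function_funpow_deriv:
  "test_function I_ref f \<Longrightarrow> test_function I_ref ((deriv ^^ n) f)"
  by (induction n) (auto intro: test_function_deriv)

lemma test_function_bump:
  "-1 < a \<Longrightarrow> b < 1 \<Longrightarrow> test_function I_ref (bump a b j)"
  by (rule test_functionI[of _ a b]) (auto intro: smooth_bump bump_eq_0)

lemma test_function_linear_combination:
  assumes "test_function I_ref f" "test_function I_ref g"
  shows "test_function I_ref (\<lambda>x. f x + c * g x)"
proof -
  obtain a b where ab: "-1 < a" "a < b" "b < 1" "\<forall>x. x \<notin> {a..b} \<longrightarrow> f x = 0"
    using test_functionE[OF assms(1)] .
  obtain a' b' where ab': "-1 < a'" "a' < b'" "b' < 1" "\<forall>x. x \<notin> {a'..b'} \<longrightarrow> g x = 0"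
    using test_functionE[OF assms(2)] .
  have "(\<lambda>x. f x + c * g (1 * x + 0)) \<in> smooth_span"
    using assms by (intro smooth_span.intros) (auto intro: test_function_smooth)
  then have "smooth (\<lambda>x. f x + c * g x)" using smooth_span_smooth by simp
  then show ?thesis
  proof (rule test_functionI[of _ "min a a'" "max b b'"])
    fix x assume "x \<notin> {min a a'..max b b'}"
    then have "x \<notin> {a..b}" "x \<notin> {a'..b'}" by auto
    then show "f x + c * g x = 0" using ab(4) ab'(4) by simp
  qed (use ab ab' in auto)
qed

text \<open>The primitive vanishes to the left of the support by construction, and to the right of
  it because the total integral is zero.\<close>

lemma test_function_primitive:
  assumes f: "test_function I_ref f" and zero: "integral {-1..1} f = 0"
  obtains F where "test_function I_ref F" "deriv F = f"
proof -
  obtain a b where ab: "-1 < a" "a < b" "b < 1" "\<forall>x. x \<notin> {a..b} \<longrightarrow> f x = 0"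
    using test_functionE[OF f] .
  have sm: "smooth f" by (rule test_function_smooth[OF f])
  then have "continuous_on UNIV f"
    by (intro DERIV_continuous_on[of UNIV f "deriv f"]) (auto intro: smooth_DERIV)
  then have int: "f integrable_on {c..d}" and cont: "continuous_on {c..d} f" for c d
    by (auto intro: integrable_continuous_interval continuous_on_subset)
  \<comment> \<open>An integral over a reversed interval is 0, so at least one term vanishes and
    \<open>F\<close> is the oriented integral from \<open>a\<close>.\<close>
  define F where "F x = integral {a..x} f - integral {x..a} f" for x
  have F: "F x = integral {c..x} f - integral {c..a} f" if "c \<le> x" "c \<le> a" for c x
  proof (cases "x \<le> a")
    case True
    have "integral {c..x} f + integral {x..a} f = integral {c..a} f"
      by (rule Henstock_Kurzweil_Integration.integral_combine) (use True that int in auto)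
    moreover have "integral {a..x} f = 0" using True by (cases "a = x") auto
    ultimately show ?thesis by (simp add: F_def)
  next
    case False
    have "integral {c..a} f + integral {a..x} f = integral {c..x} f"
      by (rule Henstock_Kurzweil_Integration.integral_combine) (use False that int in auto)
    then show ?thesis using False by (simp add: F_def)
  qed
  have D: "(F has_real_derivative f x) (at x)" for x
  proof -
    define c where "c = min x a - 1"
    have "((\<lambda>u. integral {c..u} f) has_real_derivative f x) (at x within {c..x + 1})"
      by (rule integral_has_real_derivative[OF cont]) (auto simp: c_def)
    then have "((\<lambda>u. integral {c..u} f - integral {c..a} f) has_real_derivative f x) (at x within {c..x + 1})"
      by (auto intro!: derivative_eq_intros)
    moreover have "at x within {c..x + 1} = at x"
      by (rule at_within_Icc_at) (auto simp: c_def)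
    ultimately have "((\<lambda>u. integral {c..u} f - integral {c..a} f) has_real_derivative f x) (at x)"
      by simp
    then show ?thesis
    proof (rule has_field_derivative_transform_within_open[of _ _ _ "{c<..}"])
      fix y assume "y \<in> {c<..}"
      then have "c \<le> y" "c \<le> a" by (auto simp: c_def)
      then show "integral {c..y} f - integral {c..a} f = F y" by (simp add: F)
    qed (auto simp: c_def)
  qed
  have z: "integral {c..d} f = 0" if "d \<le> a \<or> b \<le> c" for c d
  proof -
    have "((\<lambda>_. 0) has_integral 0) {c..d}" by simp
    then have "(f has_integral 0) {c..d}"
      by (rule has_integral_spike_finite[of "{a, b}", rotated 2]) (use that ab in auto)
    then show ?thesis by (rule integral_unique)
  qed
  have F0: "F x = 0" if "x \<notin> {a..b}" for x
  proof (cases "x < a")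
    case True
    then show ?thesis by (simp add: F_def z)
  next
    case False
    then have x: "x > b" using that by auto
    have "integral {-1..1} f = integral {-1..a} f + integral {a..b} f + integral {b..1} f"
      using int ab by (simp add: Henstock_Kurzweil_Integration.integral_combine)
    then have "integral {a..b} f = 0" using zero by (simp add: z)
    moreover have "integral {a..x} f = integral {a..b} f + integral {b..x} f"
      using int ab x by (simp add: Henstock_Kurzweil_Integration.integral_combine)
    ultimately show ?thesis using x ab by (simp add: F_def z)
  qed
  show thesis
  proof
    show "test_function I_ref F"
      using ab F0 by (intro test_functionI[of _ a b] smooth_antideriv[OF D sm])
    show "deriv F = f" by (auto intro: DERIV_imp_deriv D)
  qed
qed

text \<open>The signed measure with density \<open>f\<close>, extended by 0 and made Borel, vanishes
  on intervals, hence by induction on all Borel sets. This determines its density up to a null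
  set.\<close>

lemma AE_eq_0_of_interval_integrals:
  fixes f :: "real \<Rightarrow> real"
  assumes int: "set_integrable lebesgue {a<..<b} f"
    and zero: "\<And>c d. a \<le> c \<Longrightarrow> c < d \<Longrightarrow> d \<le> b \<Longrightarrow> (LINT x:{c<..<d}|lebesgue. f x) = 0"
  shows "AE x in lebesgue. x \<in> {a<..<b} \<longrightarrow> f x = 0"
proof -
  define g where "g x = indicator {a<..<b} x * f x" for x
  have g: "integrable lebesgue g" using int by (simp add: set_integrable_def g_def[abs_def])
  then obtain h where [measurable]: "h \<in> borel_measurable lborel" and gh: "AE x in lborel. g x = h x"
    using completion_ex_borel_measurable_real[of g lborel] by auto
  have gh': "AE x in lebesgue. g x = h x" using gh by (rule AE_completion)
  have "integrable lebesgue h"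
    by (rule integrable_cong_AE_imp[OF g]) (use gh' in \<open>auto simp: measurable_completion\<close>)
  then have h: "integrable lborel h" by (simp add: integrable_completion)
  have sh: "set_integrable lborel A h" if "A \<in> sets borel" for A
    using integrable_mult_indicator[OF _ h] that by (simp add: set_integrable_def)
  have sg: "(LINT x:A|lborel. h x) = (LINT x:A|lebesgue. g x)" if A: "A \<in> sets borel" for A
  proof -
    have [measurable]: "A \<in> sets lborel" using A by simp
    have "(LINT x:A|lborel. h x) = (LINT x:A|lebesgue. h x)"
      unfolding set_lebesgue_integral_def by (rule integral_completion[symmetric]) measurable
    also have "\<dots> = (LINT x:A|lebesgue. g x)"
      using gh' g A by (intro set_lebesgue_integral_cong_AE) (auto simp: measurable_completion)
    finally show ?thesis .
  qed
  have gm: "(\<lambda>x. indicator A x * g x) \<in> borel_measurable lebesgue" if "A \<in> sets borel" for A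
    by (rule borel_measurable_times[OF borel_measurable_indicator borel_measurable_integrable[OF g]])
       (use that in auto)
  have iv: "(LINT x:A|lborel. h x) = 0" if A: "A \<in> sets borel" and "c \<le> d" "{c<..<d} \<subseteq> A" "A \<subseteq> {c..d}" for A c d
  proof -
    let ?c = "max a c" and ?d = "min b d"
    have "(LINT x:A|lebesgue. g x) = (LINT x:{c<..<d}|lebesgue. g x)"
    proof (rule set_integral_cong_set)
      have "AE x in lebesgue. x \<notin> {c, d}"
        by (intro AE_not_in) (simp add: negligible_iff_null_sets[symmetric])
      then show "AE x in lebesgue. (x \<in> {c<..<d}) = (x \<in> A)"
        by eventually_elim (use that in force)
    qed (use gm A in \<open>auto simp: set_borel_measurable_def\<close>)
    also have "\<dots> = (LINT x:{?c<..<?d}|lebesgue. f x)"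
      unfolding set_lebesgue_integral_def
      by (rule Bochner_Integration.integral_cong) (auto simp: g_def indicator_def)
    also have "\<dots> = 0"
    proof (cases "?c < ?d")
      case False
      then have "{?c<..<?d} = {}" by (subst greaterThanLessThan_empty_iff) linarith
      then show ?thesis by (simp add: set_lebesgue_integral_def)
    qed (rule zero, auto)
    finally show ?thesis using sg A by simp
  qed
  \<comment> \<open>Total mass 0 is what the induction needs for complements.\<close>
  have all0: "(LINT x|lborel. h x) = 0"
  proof -
    have "(LINT x|lborel. h x) = (LINT x:UNIV|lborel. h x)" by (simp add: set_lebesgue_integral_def)
    also have "\<dots> = (LINT x:UNIV|lebesgue. g x)" by (rule sg) simp
    also have "\<dots> = (LINT x:{a..b}|lebesgue. g x)"
      unfolding set_lebesgue_integral_def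
      by (rule Bochner_Integration.integral_cong) (auto simp: g_def indicator_def)
    also have "\<dots> = (LINT x:{a..b}|lborel. h x)" by (rule sg[symmetric]) simp
    also have "\<dots> = 0"
    proof (cases "a \<le> b")
      case True then show ?thesis by (intro iv[of _ a b]) auto
    next
      case False then have "{a..b} = {}" by simp
      then show ?thesis by (simp only:) (simp add: set_lebesgue_integral_def)
    qed
    finally show ?thesis .
  qed
  have "(LINT x:A|lborel. h x) = 0" if "A \<in> sets borel" for A
    using that
  proof (induction A rule: borel_set_induct)
    case empty then show ?case by (simp add: set_lebesgue_integral_def)
  next
    case (interval c d) then show ?case by (intro iv[of _ c d]) auto
  next
    case (compl A)
    have "(LINT x:A \<union> (- A)|lborel. h x) = (LINT x:A|lborel. h x) + (LINT x:- A|lborel. h x)"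
      using compl by (intro set_integral_Un sh) auto
    then show ?case using compl all0 by (simp add: set_lebesgue_integral_def)
  next
    case (union A)
    have "(LINT x:(\<Union>i. A i)|lborel. h x) = (\<Sum>i. LINT x:A i|lborel. h x)"
    proof (rule lebesgue_integral_countable_add)
      show "A i \<in> sets lborel" for i using union(2)[of i] by simp
      show "A i \<inter> A j = {}" if "i \<noteq> j" for i j
        using union(1) that by (auto simp: disjoint_family_on_def)
      show "set_integrable lborel (\<Union>i. A i) h"
        by (rule sh) (use union(2) in auto)
    qed
    then show ?case using union by simp
  qed
  then have "AE x in lborel. h x = 0"
    using density_unique_real[OF h, of "\<lambda>_. 0"] by (simp add: set_lebesgue_integral_def)
  then have "AE x in lebesgue. h x = 0" by (rule AE_completion)
  with gh' show ?thesis by eventually_elim (auto simp: g_def)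
qed

text \<open>The fundamental lemma of the calculus of variations. Bumps converge boundedly to
  indicators, so dominated convergence makes the interval integrals vanish. As \<open>f\<close> is
  only locally integrable, this is done on compact subintervals, countably many of which exhaust the
  interval.\<close>

lemma AE_eq_0_of_test_functions:
  assumes f: "f locally_integrable_on I_ref"
    and zero: "\<And>\<phi>. test_function I_ref \<phi> \<Longrightarrow> (LINT x:I_ref|lebesgue. f x * \<phi> x) = 0"
  shows "AE x in lebesgue. x \<in> I_ref \<longrightarrow> f x = 0"
proof -
  have ae: "AE x in lebesgue. x \<in> {a<..<b} \<longrightarrow> f x = 0" if ab: "-1 < a" "b < 1" for a b
  proof (rule AE_eq_0_of_interval_integrals)
    have int: "set_integrable lebesgue {a..b} f"
    proof -
      have "compact {a..b}" "{a..b} \<subseteq> I_ref" using ab by auto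
      then show ?thesis using f unfolding locally_integrable_on_def by blast
    qed
    then show "set_integrable lebesgue {a<..<b} f"
      by (rule set_integrable_subset) auto
    fix c d assume cd: "a \<le> c" "c < d" "d \<le> b"
    have int': "integrable lebesgue (\<lambda>x. indicator {a..b} x * f x)"
      using int by (simp add: set_integrable_def)
    have "(\<lambda>j. LINT x|lebesgue. bump c d j x * (indicator {a..b} x * f x)) \<longlonglongrightarrow>
          (LINT x|lebesgue. indicator {c<..<d} x * (indicator {a..b} x * f x))"
    proof (rule integral_dominated_convergence[where w = "\<lambda>x. \<bar>indicator {a..b} x * f x\<bar>"])
      show "AE x in lebesgue. (\<lambda>j. bump c d j x * (indicator {a..b} x * f x)) \<longlonglongrightarrow> indicator {c<..<d} x * (indicator {a..b} x * f x)"
        by (intro AE_I2 tendsto_mult_right bump_tendsto)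
      show "AE x in lebesgue. norm (bump c d j x * (indicator {a..b} x * f x)) \<le> \<bar>indicator {a..b} x * f x\<bar>" for j
        using bump_nonneg[of c d j] bump_le_1[of c d j]
        by (auto simp: abs_mult intro!: mult_left_le_one_le)
      have "bump c d j \<in> borel_measurable borel" for j
        by (intro borel_measurable_continuous_onI DERIV_continuous_on[of UNIV _ "deriv (bump c d j)"])
           (auto intro: smooth_DERIV smooth_bump)
      then have "bump c d j \<in> borel_measurable lebesgue" for j
        by (auto intro: measurable_completion)
      then show "(\<lambda>x. bump c d j x * (indicator {a..b} x * f x)) \<in> borel_measurable lebesgue" for j
      proof (rule borel_measurable_times)
        show "(\<lambda>x. indicator {a..b} x * f x) \<in> borel_measurable lebesgue"
          by (rule borel_measurable_integrable[OF int'])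
      qed
      show "(\<lambda>x. indicator {c<..<d} x * (indicator {a..b} x * f x)) \<in> borel_measurable lebesgue"
      proof (rule borel_measurable_times)
        show "(\<lambda>x. indicator {a..b} x * f x) \<in> borel_measurable lebesgue"
          by (rule borel_measurable_integrable[OF int'])
      qed (auto intro!: borel_measurable_indicator)
    qed (use int' in auto)
    moreover have "(LINT x|lebesgue. bump c d j x * (indicator {a..b} x * f x)) = 0" for j
    proof -
      have "(LINT x|lebesgue. bump c d j x * (indicator {a..b} x * f x)) = (LINT x:I_ref|lebesgue. f x * bump c d j x)"
        unfolding set_lebesgue_integral_def
      proof (rule Bochner_Integration.integral_cong)
        fix x
        show "bump c d j x * (indicator {a..b} x * f x) = indicator I_ref x *\<^sub>R (f x * bump c d j x)"
          using bump_eq_0[of x c d j] cd ab by (cases "x \<in> {c<..<d}") (auto simp: indicator_def)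
      qed simp
      then show ?thesis using zero[OF test_function_bump[of c d j]] cd ab by simp
    qed
    ultimately have "(LINT x|lebesgue. indicator {c<..<d} x * (indicator {a..b} x * f x)) = 0"
      by (simp add: LIMSEQ_const_iff)
    also have "(LINT x|lebesgue. indicator {c<..<d} x * (indicator {a..b} x * f x)) = (LINT x:{c<..<d}|lebesgue. f x)"
      unfolding set_lebesgue_integral_def
      by (rule Bochner_Integration.integral_cong) (use cd in \<open>auto simp: indicator_def\<close>)
    finally show "(LINT x:{c<..<d}|lebesgue. f x) = 0" .
  qed
  have "AE x in lebesgue. \<forall>n::nat. x \<in> {-1 + 1 / (real n + 1)<..<1 - 1 / (real n + 1)} \<longrightarrow> f x = 0"
    unfolding AE_all_countable by (intro allI ae) auto
  then show ?thesis
  proof eventually_elim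
    case (elim x)
    show ?case
    proof
      assume "x \<in> I_ref"
      then have "min (1 + x) (1 - x) > 0" by auto
      then obtain n where "inverse (real (Suc n)) < min (1 + x) (1 - x)"
        using reals_Archimedean by blast
      then have "1 / (real n + 1) < 1 + x" "1 / (real n + 1) < 1 - x"
        by (simp_all add: inverse_eq_divide add.commute)
      then show "f x = 0" using elim[rule_format, of n] by auto
    qed
  qed
qed

section \<open>Riemann--Liouville integrals\<close>

definition RL :: "real \<Rightarrow> (real \<Rightarrow> real) \<Rightarrow> real \<Rightarrow> real" where
  "RL g f x = (LINT t:{-1<..<x}|lebesgue. (x - t) powr (g - 1) * f t) / Gamma g"

lemma RL_cong_AE:
  assumes "AE t in lebesgue. t \<in> I_ref \<longrightarrow> f t = f' t" "x \<le> 1"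
  shows "RL g f x = RL g f' x"
proof -
  have "AE t in lebesgue. t \<in> {-1<..<x} \<longrightarrow> (x - t) powr (g - 1) * f t = (x - t) powr (g - 1) * f' t"
    using assms(1) by eventually_elim (use assms(2) in auto)
  then have "(LINT t:{-1<..<x}|lebesgue. (x - t) powr (g - 1) * f t) = (LINT t:{-1<..<x}|lebesgue. (x - t) powr (g - 1) * f' t)"
    by (rule set_integral_cong_AE) auto
  then show ?thesis by (simp add: RL_def)
qed

lemma RL_at_neg1 [simp]: "RL g f (-1) = 0"
  by (simp add: RL_def set_lebesgue_integral_def)

text \<open>Fubini on the triangle \<open>-1 < t < x < 1\<close>. The uniform bound \<open>B\<close>
  on the inner absolute integrals makes integrability of \<open>f\<close> enough for joint
  integrability. Of \<open>v\<close> only Borel measurability is asked, so that it may itself be a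
  truncated singular kernel, as in \<open>RL_semigroup\<close>.\<close>

lemma RL_swap:
  fixes f v :: "real \<Rightarrow> real"
  assumes f: "set_integrable lebesgue I_ref f" and v [measurable]: "v \<in> borel_measurable borel"
    and int: "\<And>t. t \<in> I_ref \<Longrightarrow> set_integrable lebesgue {t<..<1} (\<lambda>x. (x - t) powr (g - 1) * v x)"
    and bd: "\<And>t. t \<in> I_ref \<Longrightarrow> (LINT x:{t<..<1}|lebesgue. (x - t) powr (g - 1) * \<bar>v x\<bar>) \<le> B"
  shows "set_integrable lebesgue I_ref (\<lambda>x. RL g f x * v x)"
    and "set_integrable lebesgue I_ref (\<lambda>t. f t * (LINT x:{t<..<1}|lebesgue. (x - t) powr (g - 1) * v x))"
    and "(LINT x:I_ref|lebesgue. RL g f x * v x)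
           = (LINT t:I_ref|lebesgue. f t * (LINT x:{t<..<1}|lebesgue. (x - t) powr (g - 1) * v x)) / Gamma g"
proof -
  obtain h where h [measurable]: "h \<in> borel_measurable borel"
    and fh: "AE x in lebesgue. x \<in> I_ref \<longrightarrow> f x = h x" and inth: "integrable lborel h"
    using borel_representative[OF f] by auto
  define H where "H = (\<lambda>(t, x). if -1 < t \<and> t < x \<and> x < 1 then (x - t) powr (g - 1) * h t * v x else 0)"
  have [measurable]: "H \<in> borel_measurable (lborel \<Otimes>\<^sub>M lborel)"
    unfolding H_def by measurable
  have Ht: "H (t, x) = indicator I_ref t * (h t * (indicator {t<..<1} x * ((x - t) powr (g - 1) * v x)))" for t x
    by (auto simp: H_def indicator_def)
  have intv: "integrable lborel (\<lambda>x. indicator {t<..<1} x * ((x - t) powr (g - 1) * v x))" if "t \<in> I_ref" for t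
    using int[OF that] by (subst (asm) set_integral_lborel(2)) (auto simp: set_integrable_def)
  have Hint: "integrable (lborel \<Otimes>\<^sub>M lborel) H"
  proof (rule lborel_pair.Fubini_integrable)
    show "AE t in lborel. integrable lborel (\<lambda>x. H (t, x))"
    proof (rule AE_I2)
      fix t show "integrable lborel (\<lambda>x. H (t, x))"
        using intv[of t] unfolding Ht by (cases "t \<in> I_ref") auto
    qed
    show "integrable lborel (\<lambda>t. LINT x|lborel. norm (H (t, x)))"
    proof (rule Bochner_Integration.integrable_bound)
      show "integrable lborel (\<lambda>t. B * h t)" using inth by simp
      show "AE t in lborel. norm (LINT x|lborel. norm (H (t, x))) \<le> norm (B * h t)"
      proof (rule AE_I2)
        fix t
        show "norm (LINT x|lborel. norm (H (t, x))) \<le> norm (B * h t)"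
        proof (cases "t \<in> I_ref")
          case True
          have "(LINT x|lborel. norm (H (t, x))) = (LINT x|lborel. \<bar>h t\<bar> * (indicator {t<..<1} x * ((x - t) powr (g - 1) * \<bar>v x\<bar>)))"
            unfolding Ht using True
            by (intro Bochner_Integration.integral_cong) (auto simp: abs_mult indicator_def)
          also have "\<dots> = \<bar>h t\<bar> * (LINT x:{t<..<1}|lebesgue. (x - t) powr (g - 1) * \<bar>v x\<bar>)"
            by (subst set_integral_lborel(1)) (auto simp: set_lebesgue_integral_def)
          also have "\<dots> \<le> \<bar>h t\<bar> * B" by (intro mult_left_mono bd True) auto
          finally have "(LINT x|lborel. norm (H (t, x))) \<le> \<bar>h t\<bar> * B" .
          also have "\<dots> \<le> \<bar>h t\<bar> * \<bar>B\<bar>" by (intro mult_left_mono) auto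
          finally show ?thesis by (simp add: abs_mult mult.commute)
        qed (simp add: Ht)
      qed
    qed measurable
  qed measurable
  have Hx: "(LINT t|lborel. H (t, x)) = Gamma g * (indicator I_ref x * (RL g f x * v x))" if "Gamma g \<noteq> 0" for x
  proof (cases "x \<in> I_ref")
    case True
    have "(LINT t|lborel. H (t, x)) = (LINT t|lborel. (indicator {-1<..<x} t * ((x - t) powr (g - 1) * h t)) * v x)"
      using True by (intro Bochner_Integration.integral_cong) (auto simp: H_def indicator_def)
    also have "\<dots> = (LINT t:{-1<..<x}|lebesgue. (x - t) powr (g - 1) * h t) * v x"
      by (subst set_integral_lborel(1)) (auto simp: set_lebesgue_integral_def)
    also have "\<dots> = Gamma g * RL g h x * v x" using that by (simp add: RL_def)
    also have "RL g h x = RL g f x" using True by (intro RL_cong_AE[symmetric] fh) auto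
    finally show ?thesis using True by simp
  next
    case False
    then have "H (t, x) = 0" for t by (auto simp: H_def)
    then show ?thesis using False by simp
  qed
  define V where "V t = (LINT x:{t<..<1}|lebesgue. (x - t) powr (g - 1) * v x)" for t
  have Ht': "(LINT x|lborel. H (t, x)) = indicator I_ref t * (h t * V t)" for t
    unfolding Ht V_def by (subst set_integral_lborel(1)) (auto simp: set_lebesgue_integral_def)
  have "integrable lborel (\<lambda>x. LINT t|lborel. H (t, x))"
    using lborel_pair.integrable_snd[of "\<lambda>t x. H (t, x)"] Hint by (simp add: case_prod_beta')
  then have 1: "integrable lebesgue (\<lambda>x. LINT t|lborel. H (t, x))"
    by (simp add: integrable_completion borel_measurable_integrable)
  show i1: "set_integrable lebesgue I_ref (\<lambda>x. RL g f x * v x)"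
  \<comment> \<open>Division by zero gives 0, so for \<open>Gamma g = 0\<close> the function
    \<open>RL g f\<close> vanishes identically.\<close>
  proof (cases "Gamma g = 0")
    case True then show ?thesis by (simp add: RL_def set_integrable_def)
  next
    case False
    then have "integrable lebesgue (\<lambda>x. (1 / Gamma g) * (LINT t|lborel. H (t, x)))"
      using 1 by simp
    then show ?thesis using False by (simp add: Hx set_integrable_def)
  qed
  have "integrable lborel (\<lambda>t. LINT x|lborel. H (t, x))"
    using lborel_pair.integrable_fst'[OF Hint] .
  then have 2: "integrable lebesgue (\<lambda>t. LINT x|lborel. H (t, x))"
    by (simp add: integrable_completion borel_measurable_integrable)
  have hV: "AE t in lebesgue. t \<in> I_ref \<longrightarrow> h t * V t = f t * V t"
    using fh by eventually_elim auto
  have "set_integrable lebesgue I_ref (\<lambda>t. h t * V t)"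
    using 2 by (simp add: Ht' set_integrable_def)
  then show "set_integrable lebesgue I_ref (\<lambda>t. f t * (LINT x:{t<..<1}|lebesgue. (x - t) powr (g - 1) * v x))"
    using absolutely_integrable_cong_AE[OF hV] by (simp add: V_def)
  have fub: "(LINT x|lborel. LINT t|lborel. H (t, x)) = (LINT t|lborel. LINT x|lborel. H (t, x))"
    using lborel_pair.Fubini_integral[of "\<lambda>t x. H (t, x)"] Hint by (simp add: case_prod_beta')
  have "(LINT t|lborel. LINT x|lborel. H (t, x)) = (LINT t|lebesgue. LINT x|lborel. H (t, x))"
    by (rule integral_completion[symmetric]) measurable
  also have "\<dots> = (LINT t:I_ref|lebesgue. h t * V t)"
    by (simp add: Ht' set_lebesgue_integral_def)
  also have "\<dots> = (LINT t:I_ref|lebesgue. f t * V t)"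
    by (rule set_integral_cong_AE[OF hV]) auto
  finally have r: "(LINT t|lborel. LINT x|lborel. H (t, x)) = (LINT t:I_ref|lebesgue. f t * V t)" .
  show "(LINT x:I_ref|lebesgue. RL g f x * v x)
           = (LINT t:I_ref|lebesgue. f t * (LINT x:{t<..<1}|lebesgue. (x - t) powr (g - 1) * v x)) / Gamma g"
  proof (cases "Gamma g = 0")
    case True then show ?thesis by (simp add: RL_def set_lebesgue_integral_def)
  next
    case False
    have "(LINT x|lborel. LINT t|lborel. H (t, x)) = (LINT x|lebesgue. LINT t|lborel. H (t, x))"
      by (rule integral_completion[symmetric]) measurable
    also have "\<dots> = Gamma g * (LINT x:I_ref|lebesgue. RL g f x * v x)"
      using False by (simp add: Hx set_lebesgue_integral_def)
    finally show ?thesis using fub r False by (simp add: V_def field_simps)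
  qed
qed

lemma RL_swap_continuous:
  fixes f v :: "real \<Rightarrow> real"
  assumes f: "set_integrable lebesgue I_ref f" and v: "continuous_on UNIV v" and g: "g > 0"
  shows "set_integrable lebesgue I_ref (\<lambda>x. RL g f x * v x)"
    and "set_integrable lebesgue I_ref (\<lambda>t. f t * (LINT x:{t<..<1}|lebesgue. (x - t) powr (g - 1) * v x))"
    and "(LINT x:I_ref|lebesgue. RL g f x * v x)
           = (LINT t:I_ref|lebesgue. f t * (LINT x:{t<..<1}|lebesgue. (x - t) powr (g - 1) * v x)) / Gamma g"
proof -
  have "bounded (v ` {-1..1})"
    by (intro compact_imp_bounded compact_continuous_image continuous_on_subset[OF v]) auto
  then obtain V where V: "\<forall>x\<in>{-1..1}. \<bar>v x\<bar> \<le> V"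
    unfolding bounded_iff by auto
  have "V \<ge> 0" using V by (auto dest!: bspec[of _ _ 0])
  have meas: "v \<in> borel_measurable borel" by (rule borel_measurable_continuous_onI[OF v])
  have i0: "set_integrable lebesgue {t<..<1} (\<lambda>x. (x - t) powr (g - 1))" for t
    by (rule set_integrable_powr_left) (use g in simp)
  have int: "set_integrable lebesgue {t<..<1} (\<lambda>x. (x - t) powr (g - 1) * v x)"
       and int': "set_integrable lebesgue {t<..<1} (\<lambda>x. (x - t) powr (g - 1) * \<bar>v x\<bar>)" for t
    by (intro set_integrable_mult_continuous[OF i0] continuous_on_rabs continuous_on_subset[OF v] subset_UNIV)+
  have bd: "(LINT x:{t<..<1}|lebesgue. (x - t) powr (g - 1) * \<bar>v x\<bar>) \<le> V * (2 powr g * Beta g 1)"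
    if t: "t \<in> I_ref" for t
  proof -
    have "(LINT x:{t<..<1}|lebesgue. (x - t) powr (g - 1) * \<bar>v x\<bar>) \<le> (LINT x:{t<..<1}|lebesgue. (x - t) powr (g - 1) * V)"
      by (rule set_integral_mono[OF int']) (use i0 V t in \<open>auto intro!: mult_left_mono\<close>)
    also have "\<dots> = V * (LINT x:{t<..<1}|lebesgue. (x - t) powr (g - 1) * (1 - x) powr (1 - 1))"
    proof -
      have "(LINT x:{t<..<1}|lebesgue. (x - t) powr (g - 1)) = (LINT x:{t<..<1}|lebesgue. (x - t) powr (g - 1) * (1 - x) powr (1 - 1))"
        by (rule set_lebesgue_integral_cong) auto
      then show ?thesis by (subst set_integral_mult_left) (simp only: mult.commute)
    qed
    also have "\<dots> = V * ((1 - t) powr g * Beta g 1)"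
      using Beta_interval(2)[of g 1 t 1] t g by simp
    also have "\<dots> \<le> V * (2 powr g * Beta g 1)"
      using t g \<open>V \<ge> 0\<close> by (intro mult_left_mono mult_right_mono powr_mono2) (auto simp: Beta_def)
    finally show ?thesis .
  qed
  note * = RL_swap[OF f meas int bd]
  show "set_integrable lebesgue I_ref (\<lambda>x. RL g f x * v x)"
    and "set_integrable lebesgue I_ref (\<lambda>t. f t * (LINT x:{t<..<1}|lebesgue. (x - t) powr (g - 1) * v x))"
    and "(LINT x:I_ref|lebesgue. RL g f x * v x)
           = (LINT t:I_ref|lebesgue. f t * (LINT x:{t<..<1}|lebesgue. (x - t) powr (g - 1) * v x)) / Gamma g"
    by (rule *; assumption)+
qed

lemma set_integrable_RL:
  assumes "set_integrable lebesgue I_ref f" "g > 0"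
  shows "set_integrable lebesgue I_ref (RL g f)"
  using RL_swap_continuous(1)[OF assms(1) _ assms(2), of "\<lambda>_. 1"] by simp

text \<open>The outer kernel, cut off at \<open>X\<close>, plays the role of \<open>v\<close> in
  \<open>RL_swap\<close>, and the inner integral is a Beta integral. The condition
  \<open>a + b \<ge> 1\<close> keeps \<open>(X - t) powr (a + b - 1)\<close> bounded as
  \<open>t\<close> approaches \<open>X\<close>, so the identity holds at every point and not only
  almost everywhere.\<close>

lemma RL_semigroup:
  assumes f: "set_integrable lebesgue I_ref f" and ab: "a > 0" "b > 0" "a + b \<ge> 1"
    and X: "X \<in> {-1..1}"
  shows "RL a (RL b f) X = RL (a + b) f X"
proof -
  define v where "v x = (if x < X then (X - x) powr (a - 1) else 0)" for x
  have [measurable]: "v \<in> borel_measurable borel" unfolding v_def by measurable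
  have eq: "indicator {t<..<1} x * ((x - t) powr (b - 1) * v x)
      = indicator {t<..<X} x * ((x - t) powr (b - 1) * (X - x) powr (a - 1))" for t x
    using X by (auto simp: v_def indicator_def)
  have int: "set_integrable lebesgue {t<..<1} (\<lambda>x. (x - t) powr (b - 1) * v x)" for t
  proof (cases "t < X")
    case True
    then show ?thesis using Beta_interval(1)[OF ab(2,1), of t X]
      by (simp add: set_integrable_def eq)
  next
    case False
    then show ?thesis by (simp add: set_integrable_def eq)
  qed
  have val: "(LINT x:{t<..<1}|lebesgue. (x - t) powr (b - 1) * v x)
     = (if t < X then (X - t) powr (a + b - 1) * Beta b a else 0)" for t
  proof (cases "t < X")
    case True
    then show ?thesis using Beta_interval(2)[OF ab(2,1), of t X]
      by (simp add: set_lebesgue_integral_def eq add.commute)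
  next
    case False
    then show ?thesis by (simp add: set_lebesgue_integral_def eq)
  qed
  have v_abs: "\<bar>v x\<bar> = v x" for x by (simp add: v_def)
  have B: "Beta b a \<ge> 0" using ab by (simp add: Beta_def)
  have bd: "(LINT x:{t<..<1}|lebesgue. (x - t) powr (b - 1) * \<bar>v x\<bar>) \<le> 2 powr (a + b - 1) * Beta b a"
    if "t \<in> I_ref" for t
    using that X ab B unfolding v_abs val by (auto intro!: mult_right_mono powr_mono2)
  have "Gamma a * RL a (RL b f) X = (LINT x:I_ref|lebesgue. RL b f x * v x)"
  proof -
    have "(LINT x:I_ref|lebesgue. RL b f x * v x) = (LINT x:{-1<..<X}|lebesgue. (X - x) powr (a - 1) * RL b f x)"
      unfolding set_lebesgue_integral_def
      by (rule Bochner_Integration.integral_cong) (use X in \<open>auto simp: v_def indicator_def\<close>)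
    then show ?thesis using Gamma_real_pos[OF ab(1)] by (simp add: RL_def[of a])
  qed
  also have "\<dots> = (LINT t:I_ref|lebesgue. f t * (if t < X then (X - t) powr (a + b - 1) * Beta b a else 0)) / Gamma b"
    using RL_swap(3)[OF f _ int bd] by (simp add: val)
  also have "(LINT t:I_ref|lebesgue. f t * (if t < X then (X - t) powr (a + b - 1) * Beta b a else 0))
     = (LINT t:{-1<..<X}|lebesgue. Beta b a * ((X - t) powr (a + b - 1) * f t))"
    unfolding set_lebesgue_integral_def
    by (rule Bochner_Integration.integral_cong) (use X in \<open>auto simp: indicator_def\<close>)
  also have "\<dots> = Beta b a * (Gamma (a + b) * RL (a + b) f X)"
    using Gamma_real_pos[OF add_pos_pos[OF ab(1,2)]] by (auto simp: RL_def[of "a + b"])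
  finally have "Gamma a * RL a (RL b f) X = Beta b a * (Gamma (a + b) * RL (a + b) f X) / Gamma b" .
  moreover have "Gamma a \<noteq> 0" "Gamma b \<noteq> 0" "Gamma (a + b) \<noteq> 0"
    using less_imp_neq[OF Gamma_real_pos[OF ab(1)]] less_imp_neq[OF Gamma_real_pos[OF ab(2)]]
      less_imp_neq[OF Gamma_real_pos[OF add_pos_pos[OF ab(1,2)]]] by auto
  ultimately show ?thesis
    by (simp add: Beta_def add.commute)
qed

lemma RL_powr:
  assumes "a > 0" "b > -1" "X \<in> {-1..1}"
  shows "RL a (\<lambda>x. (1 + x) powr b) X = Gamma (b + 1) / Gamma (a + b + 1) * (1 + X) powr (a + b)"
proof (cases "X = -1")
  case False
  then have "(LINT x:{-1<..<X}|lebesgue. (x - (-1)) powr (b + 1 - 1) * (X - x) powr (a - 1)) = (X - (-1)) powr (b + 1 + a - 1) * Beta (b + 1) a"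
    using assms by (intro Beta_interval) auto
  then have "(LINT x:{-1<..<X}|lebesgue. (X - x) powr (a - 1) * (1 + x) powr b) = (1 + X) powr (a + b) * Beta (b + 1) a"
    by (simp add: algebra_simps)
  then show ?thesis using Gamma_real_pos[OF assms(1)]
    by (simp add: RL_def Beta_def add_ac)
qed (use assms in simp)

text \<open>For \<open>a \<ge> 1\<close> the kernel is bounded, so both products are integrable at
  every \<open>x\<close>. For \<open>a < 1\<close> a merely integrable factor may fail at some
  \<open>x\<close>, where the default value of the integral would break additivity.\<close>

lemma RL_add:
  assumes "set_integrable lebesgue I_ref f" "set_integrable lebesgue I_ref f'" "a \<ge> 1" "x \<in> {-1..1}"
  shows "RL a (\<lambda>t. f t + f' t) x = RL a f x + RL a f' x"
proof -
  have "set_integrable lebesgue {-1<..<x} (\<lambda>t. (x - t) powr (a - 1) * h t)"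
    if "set_integrable lebesgue I_ref h" for h
  proof -
    have h: "set_integrable lebesgue {-1<..<x} h"
      by (rule set_integrable_subset[OF that]) (use assms in auto)
    \<comment> \<open>At \<open>t = x\<close> the kernel with exponent 0 would have the value
      \<open>0 powr 0 = 0\<close>, hence the separate value for \<open>a = 1\<close>.\<close>
    have "continuous_on {-1..x} (\<lambda>t. if a = 1 then 1 else (x - t) powr (a - 1))"
      using assms by (cases "a = 1") (auto intro!: continuous_intros continuous_on_powr')
    from set_integrable_mult_continuous[OF h this]
    have "set_integrable lebesgue {-1<..<x} (\<lambda>t. h t * (if a = 1 then 1 else (x - t) powr (a - 1)))" .
    also have "?this \<longleftrightarrow> ?thesis"
      by (intro set_integrable_cong) auto
    finally show ?thesis .
  qed
  then show ?thesis
    using assms by (simp add: RL_def ring_distribs add_divide_distrib)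
qed

section \<open>Integrals of order one and integration by parts\<close>

lemma RL_1: "RL 1 f x = (LINT t:{-1<..<x}|lebesgue. f t)"
proof -
  have "(LINT t:{-1<..<x}|lebesgue. (x - t) powr (1 - 1) * f t) = (LINT t:{-1<..<x}|lebesgue. f t)"
    by (rule set_lebesgue_integral_cong) auto
  then show ?thesis by (simp add: RL_def)
qed

lemma continuous_on_RL_1:
  assumes "set_integrable lebesgue I_ref f"
  shows "continuous_on {-1..1} (RL 1 f)"
proof -
  have i: "f integrable_on {-1<..<1}" using assms by (rule set_lebesgue_integral_eq_integral)
  then have "f integrable_on {-1..1}" by (simp add: integrable_on_Icc_iff_Ioo)
  then have "continuous_on {-1..1} (\<lambda>x. integral {-1..x} f)"
    by (rule indefinite_integral_continuous_1)
  also have "?this \<longleftrightarrow> continuous_on {-1..1} (RL 1 f)"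
  proof (rule continuous_on_cong[OF refl])
    fix x :: real assume x: "x \<in> {-1..1}"
    have "set_integrable lebesgue {-1<..<x} f"
      by (rule set_integrable_subset[OF assms]) (use x in auto)
    then show "integral {-1..x} f = RL 1 f x"
      by (simp add: RL_1 set_lebesgue_integral_eq_integral integral_open_interval_real)
  qed
  finally show ?thesis .
qed

lemma RL_1_by_parts:
  assumes G: "set_integrable lebesgue I_ref G"
    and v: "\<And>x. (v has_real_derivative v' x) (at x)" "continuous_on UNIV v'"
  shows "(LINT x:I_ref|lebesgue. (c + RL 1 G x) * v' x)
    = (c + RL 1 G 1) * v 1 - c * v (-1) - (LINT x:I_ref|lebesgue. G x * v x)"
proof -
  have cv: "continuous_on UNIV v" using v(1) by (intro DERIV_continuous_on[of _ v v']) auto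
  have iv: "set_integrable lebesgue I_ref v'"
    by (intro set_integrable_continuous continuous_on_subset[OF v(2)]) auto
  have iGv: "set_integrable lebesgue I_ref (\<lambda>x. G x * v x)"
    by (intro set_integrable_mult_continuous G continuous_on_subset[OF cv]) auto
  have inner: "(LINT x:{t<..<1}|lebesgue. v' x) = v 1 - v t" if "t \<le> 1" for t
    using v that by (intro LINT_eq_diff set_integrable_continuous continuous_on_subset[OF cv] continuous_on_subset[OF v(2)]) auto
  have inner': "(LINT x:{t<..<1}|lebesgue. (x - t) powr (1 - 1) * v' x) = v 1 - v t" if "t \<in> I_ref" for t
  proof -
    have "(LINT x:{t<..<1}|lebesgue. (x - t) powr (1 - 1) * v' x) = (LINT x:{t<..<1}|lebesgue. v' x)"
      by (rule set_lebesgue_integral_cong) auto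
    then show ?thesis using inner[of t] that by simp
  qed
  have "(LINT x:I_ref|lebesgue. RL 1 G x * v' x) = (LINT t:I_ref|lebesgue. G t * (LINT x:{t<..<1}|lebesgue. (x - t) powr (1 - 1) * v' x))"
    using RL_swap_continuous(3)[OF G v(2), of 1] by simp
  also have "\<dots> = (LINT t:I_ref|lebesgue. G t * v 1 - G t * v t)"
  proof (rule set_lebesgue_integral_cong; (intro allI impI)?)
    fix t assume "t \<in> I_ref"
    then show "G t * (LINT x:{t<..<1}|lebesgue. (x - t) powr (1 - 1) * v' x) = G t * v 1 - G t * v t"
      by (simp only: inner' right_diff_distrib)
  qed simp
  also have "\<dots> = RL 1 G 1 * v 1 - (LINT t:I_ref|lebesgue. G t * v t)"
    using G iGv by (simp add: RL_1)
  finally have *: "(LINT x:I_ref|lebesgue. RL 1 G x * v' x) = RL 1 G 1 * v 1 - (LINT t:I_ref|lebesgue. G t * v t)" .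
  have "(LINT x:I_ref|lebesgue. (c + RL 1 G x) * v' x) = (LINT x:I_ref|lebesgue. c * v' x) + (LINT x:I_ref|lebesgue. RL 1 G x * v' x)"
    using iv RL_swap_continuous(1)[OF G v(2), of 1] by (simp add: distrib_right)
  also have "(LINT x:I_ref|lebesgue. c * v' x) = c * (v 1 - v (-1))"
    using inner[of "-1"] by simp
  finally show ?thesis using * by (simp add: algebra_simps)
qed

section \<open>Weak derivatives on the reference interval\<close>

text \<open>\<open>d i\<close> is the value of the i-th derivative at -1. The recursion integrates
  \<open>g\<close> first with the constant of highest index, so \<open>d 0\<close> is the last
  constant added.\<close>

fun antideriv :: "(nat \<Rightarrow> real) \<Rightarrow> nat \<Rightarrow> (real \<Rightarrow> real) \<Rightarrow> real \<Rightarrow> real" where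
  "antideriv d 0 g = g"
| "antideriv d (Suc n) g = antideriv d n (\<lambda>x. d n + RL 1 g x)"

lemma antideriv_cong: "(\<And>i. i < n \<Longrightarrow> d i = d' i) \<Longrightarrow> antideriv d n g = antideriv d' n g"
  by (induction n arbitrary: g) auto

lemma antideriv_add: "antideriv d (i + j) g = antideriv d i (antideriv (\<lambda>l. d (i + l)) j g)"
  by (induction j arbitrary: g) auto

lemma antideriv_Suc_outer: "antideriv d (Suc n) g = (\<lambda>x. d 0 + RL 1 (antideriv (\<lambda>l. d (Suc l)) n g) x)"
  using antideriv_add[of d 1 n g] by simp

lemma set_integrable_const_RL_1:
  assumes "set_integrable lebesgue I_ref g"
  shows "set_integrable lebesgue I_ref (\<lambda>x. c + RL 1 g x)"
  by (intro set_integral_add set_integrable_RL assms)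
     (auto intro: set_integrable_continuous)

lemma set_integrable_antideriv:
  assumes "set_integrable lebesgue I_ref g"
  shows "set_integrable lebesgue I_ref (antideriv d n g)"
  using assms by (induction n arbitrary: g) (auto intro: set_integrable_const_RL_1)

lemma RL_antideriv:
  assumes "set_integrable lebesgue I_ref g" "a > 0" "x \<in> {-1..1}" "n = 0 \<or> a \<ge> 1"
  shows "RL a (antideriv d n g) x = (\<Sum>j<n. d j * (1 + x) powr (a + j) / Gamma (a + j + 1)) + RL (a + n) g x"
  using assms(1,4)
proof (induction n arbitrary: g)
  case (Suc n)
  have "RL a (antideriv d (Suc n) g) x = (\<Sum>j<n. d j * (1 + x) powr (a + j) / Gamma (a + j + 1)) + RL (a + n) (\<lambda>x. d n + RL 1 g x) x"
    using Suc by (simp add: set_integrable_const_RL_1)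
  also have "RL (a + n) (\<lambda>x. d n + RL 1 g x) x = RL (a + n) (\<lambda>x. d n) x + RL (a + n) (RL 1 g) x"
    using Suc.prems assms by (intro RL_add set_integrable_RL) (auto intro: set_integrable_continuous)
  also have "RL (a + n) (RL 1 g) x = RL (a + Suc n) g x"
    using Suc.prems assms by (subst RL_semigroup) (auto simp: add_ac)
  also have "RL (a + n) (\<lambda>x. d n) x = d n * RL (a + n) (\<lambda>x. (1 + x) powr 0) x"
  proof -
    have "(LINT t:{-1<..<x}|lebesgue. (x - t) powr (a + n - 1) * d n) = (LINT t:{-1<..<x}|lebesgue. ((x - t) powr (a + n - 1) * (1 + t) powr 0) * d n)"
      by (rule set_lebesgue_integral_cong) auto
    then show ?thesis by (simp add: RL_def)
  qed
  also have "\<dots> = d n * (1 + x) powr (a + n) / Gamma (a + n + 1)"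
    using assms by (subst RL_powr) auto
  finally show ?case by simp
qed simp

lemma locally_integrable_onI:
  assumes "set_integrable lebesgue I_ref f"
  shows "f locally_integrable_on I_ref"
  unfolding locally_integrable_on_def
proof (intro allI impI, elim conjE)
  fix K :: "real set" assume K: "compact K" "K \<subseteq> I_ref"
  have "K \<in> sets borel" using K(1) by (rule borel_compact)
  then have "K \<in> sets lebesgue" by simp
  then show "set_integrable lebesgue K f"
    by (rule set_integrable_subset[OF assms _ K(2)])
qed

lemma test_function_continuous: "test_function S \<phi> \<Longrightarrow> continuous_on T \<phi>"
  by (rule DERIV_continuous_on[of T \<phi> "deriv \<phi>"])
     (rule has_field_derivative_at_within[OF smooth_DERIV[OF test_function_smooth]])

lemma test_function_boundary: "test_function I_ref \<phi> \<Longrightarrow> \<phi> 1 = 0 \<and> \<phi> (-1) = 0"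
  by (erule test_functionE) auto

lemma set_integrable_mult_test:
  assumes "set_integrable lebesgue I_ref f" "test_function I_ref \<phi>"
  shows "set_integrable lebesgue I_ref (\<lambda>x. f x * \<phi> x)"
  by (intro set_integrable_mult_continuous assms test_function_continuous[OF assms(2)])

lemma RL_1_weak_deriv:
  assumes "set_integrable lebesgue I_ref g" "test_function I_ref \<phi>"
  shows "(LINT x:I_ref|lebesgue. (c + RL 1 g x) * deriv \<phi> x) = - (LINT x:I_ref|lebesgue. g x * \<phi> x)"
  using RL_1_by_parts[OF assms(1) smooth_DERIV[OF test_function_smooth[OF assms(2)]]
      test_function_continuous[OF test_function_deriv[OF assms(2)]], of c]
    test_function_boundary[OF assms(2)] by simp

lemma antideriv_weak_deriv:
  assumes "set_integrable lebesgue I_ref g" "test_function I_ref \<phi>"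
  shows "(LINT x:I_ref|lebesgue. antideriv d n g x * (deriv ^^ n) \<phi> x) = (-1) ^ n * (LINT x:I_ref|lebesgue. g x * \<phi> x)"
  using assms
proof (induction n arbitrary: g \<phi>)
  case (Suc n)
  have "(LINT x:I_ref|lebesgue. antideriv d (Suc n) g x * (deriv ^^ Suc n) \<phi> x)
     = (LINT x:I_ref|lebesgue. antideriv d n (\<lambda>x. d n + RL 1 g x) x * (deriv ^^ n) (deriv \<phi>) x)"
    by (simp only: antideriv.simps funpow_Suc_right o_apply)
  also have "\<dots> = (-1) ^ n * (LINT x:I_ref|lebesgue. (d n + RL 1 g x) * deriv \<phi> x)"
    using Suc.prems by (intro Suc.IH set_integrable_const_RL_1 test_function_deriv)
  also have "\<dots> = (-1) ^ Suc n * (LINT x:I_ref|lebesgue. g x * \<phi> x)"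
    using RL_1_weak_deriv[OF Suc.prems] by simp
  finally show ?case .
qed simp

lemma has_weak_deriv_antideriv:
  assumes "set_integrable lebesgue I_ref g"
  shows "has_weak_deriv I_ref n (antideriv d n g) g"
  unfolding has_weak_deriv_def
  by (auto intro: locally_integrable_onI set_integrable_antideriv assms antideriv_weak_deriv)

lemma funpow_deriv_linear:
  assumes "smooth f" "smooth g"
  shows "(deriv ^^ n) (\<lambda>x. f x + c * g x) = (\<lambda>x. (deriv ^^ n) f x + c * (deriv ^^ n) g x)"
proof (induction n)
  case (Suc n)
  have "((\<lambda>x. (deriv ^^ n) f x + c * (deriv ^^ n) g x) has_real_derivative
      deriv ((deriv ^^ n) f) x + c * deriv ((deriv ^^ n) g) x) (at x)" for x
    by (intro DERIV_add DERIV_cmult smooth_DERIV smooth_deriv_funpow assms)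
  then show ?case using Suc by (auto intro: DERIV_imp_deriv)
qed simp

text \<open>The du Bois-Reymond lemma, by induction. The functional \<open>L\<close> of the step
  vanishes on derivatives of test functions. Every test function is such a derivative plus a
  multiple of one fixed \<open>\<rho>\<close> with nonzero integral, so \<open>L\<close> is a
  multiple of the integral; the factor yields the missing constant of integration
  \<open>c\<close>.\<close>

lemma weak_deriv_imp_antideriv:
  assumes "set_integrable lebesgue I_ref f" "set_integrable lebesgue I_ref g"
    and "\<And>\<phi>. test_function I_ref \<phi> \<Longrightarrow> (LINT x:I_ref|lebesgue. f x * (deriv ^^ n) \<phi> x)
       = (-1) ^ n * (LINT x:I_ref|lebesgue. g x * \<phi> x)"
  shows "\<exists>d. AE x in lebesgue. x \<in> I_ref \<longrightarrow> f x = antideriv d n g x"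
  using assms(2,3)
proof (induction n arbitrary: g)
  case 0
  have "AE x in lebesgue. x \<in> I_ref \<longrightarrow> f x - g x = 0"
  proof (rule AE_eq_0_of_test_functions)
    show "(\<lambda>x. f x - g x) locally_integrable_on I_ref"
      by (intro locally_integrable_onI set_integral_diff assms(1) 0)
    fix \<phi> assume "test_function I_ref \<phi>"
    then show "(LINT x:I_ref|lebesgue. (f x - g x) * \<phi> x) = 0"
      using 0(2)[of \<phi>] set_integrable_mult_test[of f \<phi>] set_integrable_mult_test[of g \<phi>] assms(1) 0(1)
      by (simp add: left_diff_distrib)
  qed
  then show ?case by simp
next
  case (Suc n)
  define G where "G = RL 1 g"
  have G: "set_integrable lebesgue I_ref G" unfolding G_def by (intro set_integrable_RL Suc.prems) simp
  \<comment> \<open>\<open>L\<close> measures how far \<open>G\<close> is from being the n-th weak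
    derivative of \<open>f\<close>.\<close>
  define L where "L \<psi> = (LINT x:I_ref|lebesgue. f x * (deriv ^^ n) \<psi> x) - (-1) ^ n * (LINT x:I_ref|lebesgue. G x * \<psi> x)" for \<psi>
  have L_deriv: "L (deriv \<phi>) = 0" if "test_function I_ref \<phi>" for \<phi>
  proof -
    have "(LINT x:I_ref|lebesgue. f x * (deriv ^^ n) (deriv \<phi>) x) = (-1) ^ Suc n * (LINT x:I_ref|lebesgue. g x * \<phi> x)"
      using Suc.prems(2)[OF that] by (simp only: funpow_Suc_right o_apply)
    moreover have "(LINT x:I_ref|lebesgue. G x * deriv \<phi> x) = - (LINT x:I_ref|lebesgue. g x * \<phi> x)"
      using RL_1_weak_deriv[OF Suc.prems(1) that, of 0] by (simp add: G_def)
    ultimately show ?thesis by (simp add: L_def)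
  qed
  have L_lin: "L (\<lambda>x. \<phi> x + c * \<psi> x) = L \<phi> + c * L \<psi>"
    if "test_function I_ref \<phi>" "test_function I_ref \<psi>" for \<phi> \<psi> c
  proof -
    have "(LINT x:I_ref|lebesgue. f x * (deriv ^^ n) (\<lambda>x. \<phi> x + c * \<psi> x) x)
      = (LINT x:I_ref|lebesgue. f x * (deriv ^^ n) \<phi> x + c * (f x * (deriv ^^ n) \<psi> x))"
      using that by (subst funpow_deriv_linear) (auto simp: algebra_simps dest: test_function_smooth)
    also have "\<dots> = (LINT x:I_ref|lebesgue. f x * (deriv ^^ n) \<phi> x) + c * (LINT x:I_ref|lebesgue. f x * (deriv ^^ n) \<psi> x)"
      using set_integrable_mult_test[OF assms(1) test_function_funpow_deriv[OF that(1)], of n]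
        set_integrable_mult_test[OF assms(1) test_function_funpow_deriv[OF that(2)], of n] by simp
    finally have 1: "(LINT x:I_ref|lebesgue. f x * (deriv ^^ n) (\<lambda>x. \<phi> x + c * \<psi> x) x)
      = (LINT x:I_ref|lebesgue. f x * (deriv ^^ n) \<phi> x) + c * (LINT x:I_ref|lebesgue. f x * (deriv ^^ n) \<psi> x)" .
    have "(LINT x:I_ref|lebesgue. G x * (\<phi> x + c * \<psi> x)) = (LINT x:I_ref|lebesgue. G x * \<phi> x + c * (G x * \<psi> x))"
      by (simp add: algebra_simps)
    also have "\<dots> = (LINT x:I_ref|lebesgue. G x * \<phi> x) + c * (LINT x:I_ref|lebesgue. G x * \<psi> x)"
      using set_integrable_mult_test[OF G that(1)] set_integrable_mult_test[OF G that(2)] by simp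
    finally show ?thesis unfolding L_def 1 by (simp add: algebra_simps)
  qed
  define \<rho> where "\<rho> = bump (-1/2) (1/2) 1"
  have \<rho>: "test_function I_ref \<rho>" unfolding \<rho>_def by (rule test_function_bump) auto
  have tint: "\<phi> integrable_on {-1..1}" if "test_function I_ref \<phi>" for \<phi>
    by (intro integrable_continuous_interval test_function_continuous[OF that])
  define \<kappa> where "\<kappa> = integral {-1..1} \<rho>"
  have "\<kappa> \<noteq> 0"
  proof
    assume "\<kappa> = 0"
    then have "(\<rho> has_integral 0) (cbox (-1) 1)"
      using tint[OF \<rho>] by (simp add: \<kappa>_def has_integral_iff)
    then have "\<rho> 0 = 0"
      by (rule has_integral_0_cbox_imp_0[rotated 2])
         (auto intro: test_function_continuous[OF \<rho>], auto simp: \<rho>_def bump_nonneg)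
    then show False using bump_pos[of 0 "-1/2" "1/2" 1] by (simp add: \<rho>_def)
  qed
  define c where "c = (-1) ^ n * (L \<rho> / \<kappa>)"
  have key: "(LINT x:I_ref|lebesgue. f x * (deriv ^^ n) \<psi> x) = (-1) ^ n * (LINT x:I_ref|lebesgue. (c + G x) * \<psi> x)"
    if \<psi>: "test_function I_ref \<psi>" for \<psi>
  proof -
    define I where "I = integral {-1..1} \<psi>"
    have "test_function I_ref (\<lambda>x. \<psi> x + (- (I / \<kappa>)) * \<rho> x)"
      by (rule test_function_linear_combination[OF \<psi> \<rho>])
    moreover have "integral {-1..1} (\<lambda>x. \<psi> x + (- (I / \<kappa>)) * \<rho> x) = 0"
    proof -
      have "((\<lambda>x. \<psi> x + (- (I / \<kappa>)) * \<rho> x) has_integral I + (- (I / \<kappa>)) * \<kappa>) {-1..1}"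
        unfolding I_def \<kappa>_def
        by (intro has_integral_add has_integral_mult_right integrable_integral tint \<psi> \<rho>)
      then show ?thesis using \<open>\<kappa> \<noteq> 0\<close> by (simp add: integral_unique)
    qed
    ultimately obtain F where "test_function I_ref F" "deriv F = (\<lambda>x. \<psi> x + (- (I / \<kappa>)) * \<rho> x)"
      by (rule test_function_primitive)
    then have "L \<psi> = I * (L \<rho> / \<kappa>)"
      using L_deriv[of F] L_lin[OF \<psi> \<rho>, of "- (I / \<kappa>)"] by simp
    moreover have "I = (LINT x:I_ref|lebesgue. \<psi> x)"
      using set_integrable_continuous[OF test_function_continuous[OF \<psi>], of "-1" 1]
      by (simp add: I_def set_lebesgue_integral_eq_integral integral_open_interval_real)
    ultimately have "L \<psi> = (-1) ^ n * (LINT x:I_ref|lebesgue. c * \<psi> x)"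
      by (simp add: c_def flip: power_mult_distrib)
    moreover have "(LINT x:I_ref|lebesgue. (c + G x) * \<psi> x) = (LINT x:I_ref|lebesgue. c * \<psi> x) + (LINT x:I_ref|lebesgue. G x * \<psi> x)"
      using set_integrable_mult_test[OF G \<psi>] set_integrable_continuous[OF test_function_continuous[OF \<psi>], of "-1" 1]
      by (simp add: distrib_right)
    ultimately show ?thesis by (simp add: L_def algebra_simps)
  qed
  have "set_integrable lebesgue I_ref (\<lambda>x. c + G x)"
    unfolding G_def by (rule set_integrable_const_RL_1[OF Suc.prems(1)])
  then obtain d where d: "AE x in lebesgue. x \<in> I_ref \<longrightarrow> f x = antideriv d n (\<lambda>x. c + G x) x"
    using Suc.IH key by blast
  have eq: "antideriv d n (\<lambda>x. c + G x) = antideriv (d(n := c)) (Suc n) g"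
    by (auto simp: G_def intro!: antideriv_cong[THEN fun_cong])
  show ?case by (rule exI) (rule d[unfolded eq])
qed

lemma has_weak_deriv_unique:
  assumes "has_weak_deriv I_ref n f g" "has_weak_deriv I_ref n f g'"
  shows "AE x in lebesgue. x \<in> I_ref \<longrightarrow> g x = g' x"
proof -
  have li: "g locally_integrable_on I_ref" "g' locally_integrable_on I_ref"
    using assms by (auto simp: has_weak_deriv_def)
  have "AE x in lebesgue. x \<in> I_ref \<longrightarrow> g x - g' x = 0"
  proof (rule AE_eq_0_of_test_functions)
    show "(\<lambda>x. g x - g' x) locally_integrable_on I_ref"
      unfolding locally_integrable_on_def
    proof (intro allI impI)
      fix K assume K: "compact K \<and> K \<subseteq> I_ref"
      have "set_integrable lebesgue K g" "set_integrable lebesgue K g'"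
        using li K unfolding locally_integrable_on_def by blast+
      then show "set_integrable lebesgue K (\<lambda>x. g x - g' x)" by (rule set_integral_diff(1))
    qed
    fix \<phi> assume \<phi>: "test_function I_ref \<phi>"
    have "(LINT x:I_ref|lebesgue. g x * \<phi> x) = (LINT x:I_ref|lebesgue. g' x * \<phi> x)"
    proof -
      have "(-1) ^ n * (LINT x:I_ref|lebesgue. g x * \<phi> x) = (-1) ^ n * (LINT x:I_ref|lebesgue. g' x * \<phi> x)"
        using assms \<phi> by (simp add: has_weak_deriv_def)
      then show ?thesis by simp
    qed
    moreover have "set_integrable lebesgue I_ref (\<lambda>x. h x * \<phi> x)" if h: "h locally_integrable_on I_ref" for h
    proof -
      obtain a b where ab: "-1 < a" "a < b" "b < 1" "\<forall>x. x \<notin> {a..b} \<longrightarrow> \<phi> x = 0"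
        using test_functionE[OF \<phi>] .
      have "compact {a..b}" "{a..b} \<subseteq> I_ref" using ab by auto
      then have "set_integrable lebesgue {a..b} h"
        using h unfolding locally_integrable_on_def by blast
      then have "set_integrable lebesgue {a<..<b} h"
        by (rule set_integrable_subset) auto
      then have "set_integrable lebesgue {a<..<b} (\<lambda>x. h x * \<phi> x)"
        by (intro set_integrable_mult_continuous test_function_continuous[OF \<phi>])
      then have "set_integrable lebesgue {a..b} (\<lambda>x. h x * \<phi> x)"
        by (simp add: absolutely_integrable_on_Icc_iff_Ioo)
      then have "set_integrable lebesgue (I_ref \<inter> {a..b}) (\<lambda>x. h x * \<phi> x)"
        by (rule set_integrable_subset) auto
      moreover have "indicator (I_ref \<inter> {a..b}) x *\<^sub>R (h x * \<phi> x) = indicator I_ref x *\<^sub>R (h x * \<phi> x)" for x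
        using ab by (cases "x \<in> {a..b}") (auto simp: indicator_def)
      ultimately show ?thesis unfolding set_integrable_def by (simp only:)
    qed
    ultimately show "(LINT x:I_ref|lebesgue. (g x - g' x) * \<phi> x) = 0"
      using li by (simp add: left_diff_distrib)
  qed
  then show ?thesis by simp
qed

lemma has_weak_deriv_cong_AE:
  assumes "has_weak_deriv I_ref n f g" "AE x in lebesgue. x \<in> I_ref \<longrightarrow> f x = f' x"
  shows "has_weak_deriv I_ref n f' g"
proof -
  have "f' locally_integrable_on I_ref"
    unfolding locally_integrable_on_def
  proof (intro allI impI)
    fix K assume K: "compact K \<and> K \<subseteq> I_ref"
    have "AE x in lebesgue. x \<in> K \<longrightarrow> f x = f' x"
      using assms(2) by eventually_elim (use K in auto)
    moreover have "f absolutely_integrable_on K"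
      using assms(1) K by (auto simp: has_weak_deriv_def locally_integrable_on_def)
    ultimately show "f' absolutely_integrable_on K" by (rule absolutely_integrable_cong_AE)
  qed
  moreover have "(LINT x:I_ref|lebesgue. f' x * \<psi> x) = (LINT x:I_ref|lebesgue. f x * \<psi> x)" for \<psi>
  proof (rule set_integral_cong_AE)
    show "AE x in lebesgue. x \<in> I_ref \<longrightarrow> f' x * \<psi> x = f x * \<psi> x"
      using assms(2) by eventually_elim auto
  qed simp
  ultimately show ?thesis using assms(1) by (simp add: has_weak_deriv_def)
qed

section \<open>The fractional Taylor expansion\<close>

text \<open>The points of the open interval where two continuous functions differ form an open null
  set, which is empty; continuity then reaches the endpoints.\<close>

lemma continuous_AE_eq_imp_eq:
  assumes "continuous_on {-1..1} F" "continuous_on {-1..1} G"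
    and "AE x in lebesgue. x \<in> I_ref \<longrightarrow> F x = G x" and x: "x \<in> {-1..1::real}"
  shows "F x = (G x :: real)"
proof -
  have c: "continuous_on {-1..1} (\<lambda>x. F x - G x)" by (intro continuous_intros assms)
  define U where "U = {x \<in> I_ref. F x - G x \<in> - {0}}"
  have "open U"
    unfolding U_def
    by (rule continuous_open_preimage[unfolded vimage_def, of I_ref "\<lambda>x. F x - G x" "- {0}", simplified Int_def mem_Collect_eq])
       (auto intro: continuous_on_subset[OF c])
  moreover have "negligible U"
  proof -
    obtain N where N: "N \<in> null_sets lebesgue" "{x \<in> space lebesgue. \<not> (x \<in> I_ref \<longrightarrow> F x = G x)} \<subseteq> N"
      using AE_E[OF assms(3)] by (metis (no_types, lifting) null_setsI)
    then have "U \<subseteq> N" by (auto simp: U_def)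
    then show ?thesis using N(1) negligible_subset by (auto simp: negligible_iff_null_sets)
  qed
  ultimately have "U = {}" using open_not_negligible by blast
  then have z: "\<And>x. x \<in> I_ref \<Longrightarrow> F x - G x = 0" by (auto simp: U_def)
  have "F x - G x = 0"
    by (rule continuous_constant_on_closure[of I_ref "\<lambda>x. F x - G x"]) (use c x z in auto)
  then show ?thesis by simp
qed

lemma cont_rep_eq:
  assumes "continuous_on {-1..1} F" "AE x in lebesgue. x \<in> I_ref \<longrightarrow> f x = F x" "x \<in> {-1..1}"
  shows "cont_rep I_ref f x = F x"
proof -
  let ?P = "\<lambda>F. continuous_on (closure I_ref) F \<and> (AE x in lebesgue. x \<in> I_ref \<longrightarrow> F x = f x)"
  have "AE x in lebesgue. x \<in> I_ref \<longrightarrow> F x = f x"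
    using assms(2) by eventually_elim auto
  then have "?P F" using assms(1) by simp
  then have *: "?P (cont_rep I_ref f)" unfolding cont_rep_def by (rule someI[where P = ?P])
  have "AE x in lebesgue. x \<in> I_ref \<longrightarrow> cont_rep I_ref f x = F x"
    using assms(2) conjunct2[OF *] by eventually_elim auto
  then show ?thesis
    using * assms by (intro continuous_AE_eq_imp_eq[of "cont_rep I_ref f" F]) auto
qed

lemma continuous_on_const_RL_1:
  "set_integrable lebesgue I_ref g \<Longrightarrow> continuous_on {-1..1} (\<lambda>x. c + RL 1 g x)"
  by (intro continuous_intros continuous_on_RL_1)

lemma caputo_eq_RL: "caputo k \<alpha> \<omega> = RL (real k - \<alpha>) (weak_deriv I_ref k \<omega>)"
  by (simp add: caputo_def RL_def fun_eq_iff)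

lemma sobolev1_weak_deriv:
  assumes "f \<in> sobolev1 I_ref n" "i \<le> n"
  shows "has_weak_deriv I_ref i f (weak_deriv I_ref i f)"
    and "set_integrable lebesgue I_ref (weak_deriv I_ref i f)"
proof -
  obtain g where g: "set_integrable lebesgue I_ref g" "has_weak_deriv I_ref i f g"
    using assms by (auto simp: sobolev1_def)
  then show 1: "has_weak_deriv I_ref i f (weak_deriv I_ref i f)"
    unfolding weak_deriv_def by (metis someI_ex)
  show "set_integrable lebesgue I_ref (weak_deriv I_ref i f)"
    by (rule absolutely_integrable_cong_AE[OF has_weak_deriv_unique[OF g(2) 1] g(1)])
qed

lemma sobolev1_antideriv:
  assumes "f \<in> sobolev1 I_ref n"
  obtains d where "AE x in lebesgue. x \<in> I_ref \<longrightarrow> f x = antideriv d n (weak_deriv I_ref n f) x"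
proof -
  have "set_integrable lebesgue I_ref f" using assms by (simp add: sobolev1_def)
  then have "\<exists>d. AE x in lebesgue. x \<in> I_ref \<longrightarrow> f x = antideriv d n (weak_deriv I_ref n f) x"
    using sobolev1_weak_deriv[OF assms order_refl]
    by (intro weak_deriv_imp_antideriv) (auto simp: has_weak_deriv_def)
  then show thesis using that by blast
qed

text \<open>This identifies the constants of integration with the boundary values in the semi-norm.
  By \<open>antideriv_add\<close> the i-th weak derivative is almost everywhere
  \<open>d i + RL 1 K\<close>, which is continuous up to -1 and equals \<open>d i\<close>
  there.\<close>

lemma sobolev1_boundary_value:
  assumes f: "f \<in> sobolev1 I_ref n" and i: "i < n"
    and d: "AE x in lebesgue. x \<in> I_ref \<longrightarrow> f x = antideriv d n (weak_deriv I_ref n f) x"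
  shows "Lim (at_right (-1)) (cont_rep I_ref (weak_deriv I_ref i f)) = d i"
proof -
  define h where "h = weak_deriv I_ref n f"
  have h: "set_integrable lebesgue I_ref h"
    unfolding h_def by (rule sobolev1_weak_deriv[OF f order_refl])
  obtain j where j: "n = i + Suc j" using i less_iff_Suc_add by auto
  define G where "G = antideriv (\<lambda>l. d (i + l)) (Suc j) h"
  have G: "set_integrable lebesgue I_ref G" unfolding G_def by (rule set_integrable_antideriv[OF h])
  have "antideriv d n h = antideriv d i G" unfolding G_def j by (rule antideriv_add)
  then have "has_weak_deriv I_ref i (antideriv d n h) G" using has_weak_deriv_antideriv[OF G] by simp
  moreover have "AE x in lebesgue. x \<in> I_ref \<longrightarrow> antideriv d n h x = f x"
    using d by eventually_elim (simp add: h_def)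
  ultimately have "has_weak_deriv I_ref i f G" by (rule has_weak_deriv_cong_AE)
  then have ae: "AE x in lebesgue. x \<in> I_ref \<longrightarrow> weak_deriv I_ref i f x = G x"
    using sobolev1_weak_deriv(1)[OF f, of i] i by (intro has_weak_deriv_unique) auto
  define K where "K = antideriv (\<lambda>l. d (i + Suc l)) j h"
  have Geq: "G = (\<lambda>x. d i + RL 1 K x)" unfolding G_def K_def antideriv_Suc_outer by simp
  have K: "set_integrable lebesgue I_ref K" unfolding K_def by (rule set_integrable_antideriv[OF h])
  have cG: "continuous_on {-1..1} G" unfolding Geq by (rule continuous_on_const_RL_1[OF K])
  have "(cont_rep I_ref (weak_deriv I_ref i f) \<longlongrightarrow> d i) (at_right (-1))"
  proof -
    have "(G \<longlongrightarrow> G (-1)) (at (-1) within {-1..1})"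
      using cG by (auto simp: continuous_on_def)
    then have "(G \<longlongrightarrow> d i) (at_right (-1))"
      by (simp add: at_within_Icc_at_right Geq)
    moreover have "eventually (\<lambda>x. G x = cont_rep I_ref (weak_deriv I_ref i f) x) (at_right (-1))"
      using eventually_at_right_real[of "-1" 1]
      by (auto elim!: eventually_mono intro!: cont_rep_eq[symmetric] cG ae)
    ultimately show ?thesis by (rule Lim_transform_eventually)
  qed
  then show ?thesis by (intro tendsto_Lim) auto
qed

text \<open>Unlike \<open>RL_antideriv\<close> this allows \<open>a < 1\<close>, as is required for
  \<open>\<alpha> < 1\<close>. The outermost integration is peeled off first: \<open>RL 1 K\<close>
  is continuous, so the singular kernel may be applied to \<open>d 0\<close> and to
  \<open>RL 1 K\<close> separately, and the semigroup law raises the order to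
  \<open>a + 1\<close>.\<close>

lemma RL_antideriv_add:
  assumes "set_integrable lebesgue I_ref h" "a > 0" "m \<ge> 1" "x \<in> {-1..1}"
  shows "RL a (antideriv d m h) x = (\<Sum>j<m. d j * (1 + x) powr (a + j) / Gamma (a + j + 1)) + RL (a + m) h x"
proof -
  obtain n where m: "m = Suc n" using assms(3) by (cases m) auto
  define K where "K = antideriv (\<lambda>l. d (Suc l)) n h"
  have K: "set_integrable lebesgue I_ref K" unfolding K_def by (rule set_integrable_antideriv[OF assms(1)])
  have int: "set_integrable lebesgue {-1<..<x} (\<lambda>t. (x - t) powr (a - 1) * c)"
    and int2: "set_integrable lebesgue {-1<..<x} (\<lambda>t. (x - t) powr (a - 1) * RL 1 K t)" for c
  proof -
    have c1: "continuous_on {-1..x} (RL 1 K)"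
      using assms(4) by (intro continuous_on_subset[OF continuous_on_RL_1[OF K]]) auto
    have i: "set_integrable lebesgue {-1<..<x} (\<lambda>t. (x - t) powr (a - 1))"
    proof (cases "-1 < x")
      case True
      have "set_integrable lebesgue {-1<..<x} (\<lambda>t. (t - (-1)) powr (1 - 1) * (x - t) powr (a - 1))"
        by (rule Beta_interval) (use True assms in auto)
      also have "?this \<longleftrightarrow> ?thesis" by (intro set_integrable_cong) auto
      finally show ?thesis .
    qed (simp add: set_integrable_def)
    show "set_integrable lebesgue {-1<..<x} (\<lambda>t. (x - t) powr (a - 1) * c)"
      using i by simp
    show "set_integrable lebesgue {-1<..<x} (\<lambda>t. (x - t) powr (a - 1) * RL 1 K t)"
      by (rule set_integrable_mult_continuous[OF i c1])
  qed
  have "antideriv d m h = (\<lambda>x. d 0 + RL 1 K x)" unfolding m K_def by (rule antideriv_Suc_outer)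
  then have "RL a (antideriv d m h) x = RL a (\<lambda>x. d 0) x + RL a (RL 1 K) x"
    using int[of "d 0"] int2 by (simp add: RL_def[of a] ring_distribs add_divide_distrib)
  also have "RL a (RL 1 K) x = RL (a + 1) K x"
    using assms by (intro RL_semigroup K) auto
  also have "\<dots> = (\<Sum>j<n. d (Suc j) * (1 + x) powr (a + 1 + j) / Gamma (a + 1 + j + 1)) + RL (a + 1 + n) h x"
    unfolding K_def using assms by (intro RL_antideriv) auto
  also have "RL a (\<lambda>x. d 0) x = d 0 * RL a (\<lambda>x. (1 + x) powr 0) x"
  proof -
    have "(LINT t:{-1<..<x}|lebesgue. (x - t) powr (a - 1) * d 0) = (LINT t:{-1<..<x}|lebesgue. ((x - t) powr (a - 1) * (1 + t) powr 0) * d 0)"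
      by (rule set_lebesgue_integral_cong) auto
    then show ?thesis by (simp add: RL_def)
  qed
  also have "\<dots> = d 0 * (1 + x) powr a / Gamma (a + 1)"
    using assms by (subst RL_powr) auto
  finally show ?thesis
    unfolding m sum.lessThan_Suc_shift by (simp add: add_ac)
qed

text \<open>The termwise derivative of \<open>frac_expansion\<close>. It may be unbounded at -1, but
  for \<open>a > 0\<close> and \<open>m \<ge> 1\<close> all exponents exceed -1 and the order of the
  last term is positive, so it is integrable.\<close>

definition frac_density :: "real \<Rightarrow> nat \<Rightarrow> real poly \<Rightarrow> (nat \<Rightarrow> real) \<Rightarrow> (real \<Rightarrow> real) \<Rightarrow> real \<Rightarrow> real" where
  "frac_density a m q d h x = poly (pderiv q) x + (\<Sum>i<m. d i * (1 + x) powr (a + i - 1) / Gamma (a + i)) + RL (a + m - 1) h x"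

definition frac_expansion :: "real \<Rightarrow> nat \<Rightarrow> real poly \<Rightarrow> (nat \<Rightarrow> real) \<Rightarrow> (real \<Rightarrow> real) \<Rightarrow> real \<Rightarrow> real" where
  "frac_expansion a m q d h x = poly q x + (\<Sum>i<m. d i * (1 + x) powr (a + i) / Gamma (a + i + 1)) + RL (a + m) h x"

lemma set_integrable_frac_density:
  assumes "set_integrable lebesgue I_ref h" "a > 0" "m \<ge> 1"
  shows "set_integrable lebesgue I_ref (frac_density a m q d h)"
proof -
  have "set_integrable lebesgue I_ref (\<lambda>x. d i * (1 + x) powr (a + i - 1) / Gamma (a + i))" for i
    using set_integrable_powr_left[of "a + i - 1" "-1" 1] assms by (simp add: add.commute)
  then have "set_integrable lebesgue I_ref (\<lambda>x. \<Sum>i<m. d i * (1 + x) powr (a + i - 1) / Gamma (a + i))"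
    by (intro set_integral_sum(2)) auto
  moreover have "set_integrable lebesgue I_ref (\<lambda>x. poly (pderiv q) x)"
    by (intro set_integrable_continuous continuous_intros)
  ultimately show ?thesis
    unfolding frac_density_def[abs_def] using assms
    by (intro set_integral_add set_integrable_RL) auto
qed

text \<open>A constant plus \<open>RL 1\<close> of an integrable density is the form of absolute
  continuity on which the treatment of the projections is built.\<close>

lemma frac_expansion_eq_RL_1:
  assumes h: "set_integrable lebesgue I_ref h" and a: "a > 0" "m \<ge> 1" and x: "x \<in> {-1..1}"
  shows "frac_expansion a m q d h x = poly q (-1) + RL 1 (frac_density a m q d h) x"
proof -
  have ip: "set_integrable lebesgue I_ref (\<lambda>x. d i * (1 + x) powr (a + i - 1) / Gamma (a + i))" for i
    using set_integrable_powr_left[of "a + i - 1" "-1" 1] a by (simp add: add.commute)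
  have isum: "set_integrable lebesgue I_ref (\<lambda>x. \<Sum>i<n. d i * (1 + x) powr (a + i - 1) / Gamma (a + i))" for n
    using ip by (intro set_integral_sum(2)) auto
  have iq: "set_integrable lebesgue I_ref (\<lambda>x. poly (pderiv q) x)"
    by (intro set_integrable_continuous continuous_intros)
  have iR: "set_integrable lebesgue I_ref (RL (a + m - 1) h)"
    using a by (intro set_integrable_RL h) auto
  have 1: "RL 1 (\<lambda>x. poly (pderiv q) x) x = poly q x - poly q (-1)"
    unfolding RL_1 by (rule LINT_eq_diff) (use x in \<open>auto intro!: set_integrable_continuous continuous_intros poly_DERIV\<close>)
  have 2: "RL 1 (\<lambda>x. \<Sum>i<n. d i * (1 + x) powr (a + i - 1) / Gamma (a + i)) x = (\<Sum>i<n. d i * (1 + x) powr (a + i) / Gamma (a + i + 1))" for n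
  proof (induction n)
    case 0 show ?case by (simp add: RL_1 set_lebesgue_integral_def)
  next
    case (Suc n)
    have "RL 1 (\<lambda>x. d n * (1 + x) powr (a + n - 1) / Gamma (a + n)) x = d n / Gamma (a + n) * RL 1 (\<lambda>x. (1 + x) powr (a + n - 1)) x"
      by (simp add: RL_1)
    also have "\<dots> = d n / Gamma (a + n) * (Gamma (a + n) / Gamma (a + n + 1) * (1 + x) powr (a + n))"
      using a x by (subst RL_powr) (auto simp: add_ac)
    also have "\<dots> = d n * (1 + x) powr (a + n) / Gamma (a + n + 1)"
    proof -
      have "Gamma (a + n) \<noteq> 0" using less_imp_neq[OF Gamma_real_pos[of "a + n"]] a by auto
      then show ?thesis by simp
    qed
    finally show ?case
      unfolding sum.lessThan_Suc using Suc x by (subst RL_add) (auto intro: isum ip)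
  qed
  have 3: "RL 1 (RL (a + m - 1) h) x = RL (a + m) h x"
    using a x by (subst RL_semigroup) (auto intro: h)
  show ?thesis
    unfolding frac_density_def[abs_def] frac_expansion_def
    using x by (simp add: RL_add isum iq iR 1 2 3 set_integral_add)
qed

text \<open>The k-fold integral of the k-th weak derivative factors into \<open>RL \<alpha>\<close>
  after \<open>RL (k - \<alpha>)\<close>, and the inner part is the Caputo derivative. That in turn
  is an m-fold antiderivative of \<open>h\<close> up to a null set, which \<open>RL \<alpha>\<close>
  does not see.\<close>

lemma U_space_expansion:
  assumes k: "k \<ge> 1" and m: "m \<ge> 1" and \<alpha>: "real k - 1 < \<alpha>" "\<alpha> < real k"
    and \<omega>: "\<omega> \<in> U_space k \<alpha> m"
  obtains q d h where "degree q < k" "set_integrable lebesgue I_ref h"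
    "AE x in lebesgue. x \<in> I_ref \<longrightarrow> \<omega> x = frac_expansion \<alpha> m q d h x"
    "U_seminorm k \<alpha> m \<omega> = (LINT x:I_ref|lebesgue. \<bar>h x\<bar>) + (\<Sum>i<m. \<bar>d i\<bar>)"
proof -
  define g where "g = weak_deriv I_ref k \<omega>"
  define C where "C = caputo k \<alpha> \<omega>"
  define h where "h = weak_deriv I_ref m C"
  have sob: "\<omega> \<in> sobolev1 I_ref k" "C \<in> sobolev1 I_ref m"
    using \<omega> by (auto simp: U_space_def C_def)
  have g: "set_integrable lebesgue I_ref g" and h: "set_integrable lebesgue I_ref h"
    unfolding g_def h_def by (rule sobolev1_weak_deriv[OF _ order_refl], rule sob)+
  have a0: "\<alpha> > 0" using k \<alpha> by linarith
  obtain c where c: "AE x in lebesgue. x \<in> I_ref \<longrightarrow> \<omega> x = antideriv c k g x"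
    using sobolev1_antideriv[OF sob(1)] unfolding g_def by blast
  obtain d where d: "AE x in lebesgue. x \<in> I_ref \<longrightarrow> C x = antideriv d m h x"
    using sobolev1_antideriv[OF sob(2)] unfolding h_def by blast
  obtain n where n: "k = Suc n" using k by (cases k) auto
  define q where "q = (\<Sum>j<k. smult (c j / fact j) ([:1, 1:] ^ j))"
  have q: "poly q x = (\<Sum>j<k. c j * (1 + x) ^ j / fact j)" for x
    by (simp add: q_def poly_sum poly_power)
  have key: "antideriv c k g x = frac_expansion \<alpha> m q d h x" if x: "x \<in> I_ref" for x
  proof -
    have x': "x \<in> {-1..1}" using x by auto
    have "antideriv c k g x = c 0 + RL 1 (antideriv (\<lambda>l. c (Suc l)) n g) x" unfolding n antideriv_Suc_outer ..
    also have "\<dots> = c 0 + ((\<Sum>j<n. c (Suc j) * (1 + x) powr (1 + j) / Gamma (1 + j + 1)) + RL (1 + n) g x)"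
      using x' by (subst RL_antideriv[OF g]) auto
    also have "(\<Sum>j<n. c (Suc j) * (1 + x) powr (1 + j) / Gamma (1 + j + 1)) = (\<Sum>j<n. c (Suc j) * (1 + x) ^ Suc j / fact (Suc j))"
    proof (rule sum.cong[OF refl])
      fix j
      have "(1 + x) powr (1 + real j) = (1 + x) ^ Suc j"
        using x powr_realpow[of "1 + x" "Suc j"] by (simp add: add.commute)
      moreover have "Gamma (1 + real j + 1) = fact (Suc j)"
        using Gamma_fact[of "Suc j", where ?'a = real] by (simp add: add_ac)
      ultimately show "c (Suc j) * (1 + x) powr (1 + j) / Gamma (1 + j + 1) = c (Suc j) * (1 + x) ^ Suc j / fact (Suc j)"
        by simp
    qed
    also have "c 0 + (\<dots> + RL (1 + n) g x) = poly q x + RL k g x"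
      unfolding q n sum.lessThan_Suc_shift by simp
    also have "RL k g x = RL \<alpha> (RL (k - \<alpha>) g) x"
      using \<alpha> a0 k x' by (subst RL_semigroup[OF g]) auto
    also have "RL (k - \<alpha>) g = C" by (simp add: C_def g_def caputo_eq_RL)
    also have "RL \<alpha> C x = RL \<alpha> (antideriv d m h) x"
      using x by (intro RL_cong_AE d) auto
    also have "\<dots> = (\<Sum>j<m. d j * (1 + x) powr (\<alpha> + j) / Gamma (\<alpha> + j + 1)) + RL (\<alpha> + m) h x"
      by (rule RL_antideriv_add[OF h a0 m x'])
    finally show ?thesis by (simp add: frac_expansion_def)
  qed
  have ae: "AE x in lebesgue. x \<in> I_ref \<longrightarrow> \<omega> x = frac_expansion \<alpha> m q d h x"
    using c by eventually_elim (use key in auto)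
  have "degree q \<le> n"
    unfolding q_def
  proof (rule degree_sum_le)
    fix j assume "j \<in> {..<k}"
    then show "degree (smult (c j / fact j) ([:1, 1:] ^ j)) \<le> n"
      using degree_power_le[of "[:1, 1::real:]" j] n
      by (intro order_trans[OF degree_smult_le]) auto
  qed simp
  then have "degree q < k" using n by simp
  moreover have "U_seminorm k \<alpha> m \<omega> = (LINT x:I_ref|lebesgue. \<bar>h x\<bar>) + (\<Sum>i<m. \<bar>d i\<bar>)"
    using sobolev1_boundary_value[OF sob(2) _ d[unfolded h_def]]
    by (simp add: U_seminorm_def L1_norm_def h_def C_def)
  ultimately show thesis using that h ae by blast
qed

section \<open>Gauss--Radau projections\<close>

context
  fixes W w :: "real \<Rightarrow> real" and c :: real
  assumes w: "set_integrable lebesgue I_ref w"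
    and W_eq: "\<And>x. x \<in> {-1..1} \<Longrightarrow> W x = c + RL 1 w x"
begin

lemma W_cont: "continuous_on {-1..1} W"
  using continuous_on_const_RL_1[OF w, of c] by (rule continuous_on_eq) (simp add: W_eq)

text \<open>The projection error is orthogonal to \<open>pderiv (legendre n)\<close>, whose degree
  is at most \<open>p\<close>. Integration by parts leaves the boundary terms and \<open>w\<close>
  against \<open>legendre n\<close>; the projection itself contributes no integral because its
  derivative is orthogonal to \<open>legendre n\<close>. The two admissible \<open>n\<close> give
  two equations for the two endpoint errors.\<close>

lemma leg_proj_endpoints:
  assumes n: "n = p \<or> n = Suc p"
  shows "(W 1 - poly (leg_proj W p) 1) - (-1) ^ n * (W (-1) - poly (leg_proj W p) (-1))
    = (LINT x:I_ref|lebesgue. w x * poly (legendre n) x)"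
proof -
  let ?P = "legendre n" and ?\<Pi> = "leg_proj W p"
  have ip: "set_integrable lebesgue I_ref (poly q)" for q
    by (intro set_integrable_continuous continuous_intros)
  have d: "degree (pderiv ?P) \<le> p" using n by (auto simp: degree_pderiv degree_legendre)
  have 1: "(LINT x:I_ref|lebesgue. W x * poly (pderiv ?P) x) = W 1 - W (-1) * (-1) ^ n - (LINT x:I_ref|lebesgue. w x * poly ?P x)"
  proof -
    have "(LINT x:I_ref|lebesgue. W x * poly (pderiv ?P) x) = (LINT x:I_ref|lebesgue. (c + RL 1 w x) * poly (pderiv ?P) x)"
      by (rule set_lebesgue_integral_cong) (auto simp: W_eq)
    also have "\<dots> = (c + RL 1 w 1) * poly ?P 1 - c * poly ?P (-1) - (LINT x:I_ref|lebesgue. w x * poly ?P x)"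
      by (rule RL_1_by_parts[OF w poly_DERIV]) (intro continuous_intros)
    finally show ?thesis using W_eq[of 1] W_eq[of "-1"] by simp
  qed
  have 2: "(LINT x:I_ref|lebesgue. poly ?\<Pi> x * poly (pderiv ?P) x) = poly ?\<Pi> 1 - poly ?\<Pi> (-1) * (-1) ^ n"
  proof -
    have o: "(LINT x:I_ref|lebesgue. poly ?P x * poly (pderiv ?\<Pi>) x) = 0"
    proof (cases "pderiv ?\<Pi> = 0")
      case False
      then have "degree ?\<Pi> > 0" by (metis pderiv_eq_0_iff neq0_conv)
      then show ?thesis
        using n degree_leg_proj[of W p] by (intro legendre_orthogonal) (auto simp: degree_pderiv)
    qed (simp add: set_lebesgue_integral_def)
    have "(LINT x:I_ref|lebesgue. poly (pderiv (?\<Pi> * ?P)) x) = poly (?\<Pi> * ?P) 1 - poly (?\<Pi> * ?P) (-1)"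
      by (rule LINT_eq_diff[OF _ _ poly_DERIV ip]) (auto intro!: continuous_intros)
    moreover have "(LINT x:I_ref|lebesgue. poly (pderiv (?\<Pi> * ?P)) x)
      = (LINT x:I_ref|lebesgue. poly (?\<Pi> * pderiv ?P) x) + (LINT x:I_ref|lebesgue. poly (?P * pderiv ?\<Pi>) x)"
      unfolding pderiv_mult poly_add by (rule set_integral_add(2)[OF ip ip])
    ultimately show ?thesis using o by (simp add: poly_mult)
  qed
  have "(LINT x:I_ref|lebesgue. (W x - poly ?\<Pi> x) * poly (pderiv ?P) x) = 0"
    by (rule leg_proj_orthogonal[OF W_cont d])
  also have "(LINT x:I_ref|lebesgue. (W x - poly ?\<Pi> x) * poly (pderiv ?P) x)
    = (LINT x:I_ref|lebesgue. W x * poly (pderiv ?P) x) - (LINT x:I_ref|lebesgue. poly ?\<Pi> x * poly (pderiv ?P) x)"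
    using set_integral_diff(2)[OF leg_int(1)[OF W_cont] leg_int(2)[OF W_cont], of "pderiv ?P" ?\<Pi> "pderiv ?P"]
    by (simp add: left_diff_distrib)
  finally show ?thesis using 1 2 by (simp add: algebra_simps)
qed

context
  fixes \<omega> :: "real \<Rightarrow> real" and a :: real and p :: nat
  assumes \<omega>: "AE x in lebesgue. x \<in> I_ref \<longrightarrow> \<omega> x = W x" and a: "a = 1 \<or> a = -1" and p: "p \<ge> 1"
begin

definition radau_shift :: real where
  "radau_shift = (W a - poly (leg_proj W p) a) / poly (legendre p) a"

text \<open>Orthogonality to all degrees below \<open>p\<close> leaves only the coefficient of
  \<open>legendre p\<close> free, and interpolation at \<open>a\<close> fixes it because
  \<open>legendre p\<close> is nonzero at both endpoints. The same argument gives the uniqueness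
  that the definite description demands.\<close>

lemma radau_proj_eq: "radau_proj a p \<omega> = leg_proj W p + smult radau_shift (legendre p)"
proof -
  let ?Q = "leg_proj W p + smult radau_shift (legendre p)"
  have nz: "poly (legendre p) a \<noteq> 0" using a by auto
  have Wa: "cont_rep I_ref \<omega> a = W a"
    by (rule cont_rep_eq[OF W_cont \<omega>]) (use a in auto)
  have cong: "(LINT \<xi>:I_ref|lebesgue. (poly q \<xi> - \<omega> \<xi>) * poly v \<xi>) = - (LINT \<xi>:I_ref|lebesgue. (W \<xi> - poly q \<xi>) * poly v \<xi>)" for q v
  proof -
    have "AE x in lebesgue. x \<in> I_ref \<longrightarrow> (poly q x - \<omega> x) * poly v x = (-1) * ((W x - poly q x) * poly v x)"
      using \<omega> by eventually_elim (auto simp: algebra_simps)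
    then have "(LINT \<xi>:I_ref|lebesgue. (poly q \<xi> - \<omega> \<xi>) * poly v \<xi>) = (LINT \<xi>:I_ref|lebesgue. (-1) * ((W \<xi> - poly q \<xi>) * poly v \<xi>))"
      by (rule set_integral_cong_AE) simp
    then show ?thesis by (simp only: set_integral_mult_right)
  qed
  have Qorth: "(LINT \<xi>:I_ref|lebesgue. (W \<xi> - poly ?Q \<xi>) * poly v \<xi>) = 0" if v: "degree v < p" for v
  proof -
    have "(LINT \<xi>:I_ref|lebesgue. (W \<xi> - poly ?Q \<xi>) * poly v \<xi>)
      = (LINT \<xi>:I_ref|lebesgue. (W \<xi> - poly (leg_proj W p) \<xi>) * poly v \<xi> - poly (smult radau_shift (legendre p)) \<xi> * poly v \<xi>)"
      by (simp add: algebra_simps)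
    also have "\<dots> = (LINT \<xi>:I_ref|lebesgue. (W \<xi> - poly (leg_proj W p) \<xi>) * poly v \<xi>) - (LINT \<xi>:I_ref|lebesgue. poly (smult radau_shift (legendre p)) \<xi> * poly v \<xi>)"
      by (rule set_integral_diff(2)[OF leg_int(3)[OF W_cont] leg_int(2)[OF W_cont]])
    also have "\<dots> = 0"
      using leg_proj_orthogonal[OF W_cont, of v p] legendre_orthogonal[OF v] v by (simp add: mult.assoc)
    finally show ?thesis .
  qed
  have Qa: "poly ?Q a = W a" using nz by (simp add: radau_shift_def)
  have degQ: "degree ?Q \<le> p"
    by (intro degree_add_le degree_leg_proj order_trans[OF degree_smult_le]) (simp add: degree_legendre)
  show ?thesis
    unfolding radau_proj_def
  proof (rule the_equality)
    show "degree ?Q \<le> p \<and> (\<forall>v. degree v < p \<longrightarrow> (LINT \<xi>:I_ref|lebesgue. (poly ?Q \<xi> - \<omega> \<xi>) * poly v \<xi>) = 0) \<and> poly ?Q a = cont_rep I_ref \<omega> a"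
      using degQ Qorth Qa Wa unfolding cong by simp
  next
    fix q
    assume q: "degree q \<le> p \<and> (\<forall>v. degree v < p \<longrightarrow> (LINT \<xi>:I_ref|lebesgue. (poly q \<xi> - \<omega> \<xi>) * poly v \<xi>) = 0) \<and> poly q a = cont_rep I_ref \<omega> a"
    define r where "r = q - ?Q"
    have ro: "(LINT \<xi>:I_ref|lebesgue. poly v \<xi> * poly r \<xi>) = 0" if v: "degree v < p" for v
    proof -
      have "(LINT \<xi>:I_ref|lebesgue. (W \<xi> - poly ?Q \<xi>) * poly v \<xi> - (W \<xi> - poly q \<xi>) * poly v \<xi>)
        = (LINT \<xi>:I_ref|lebesgue. (W \<xi> - poly ?Q \<xi>) * poly v \<xi>) - (LINT \<xi>:I_ref|lebesgue. (W \<xi> - poly q \<xi>) * poly v \<xi>)"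
        by (rule set_integral_diff(2)[OF leg_int(3)[OF W_cont] leg_int(3)[OF W_cont]])
      also have "\<dots> = 0" using q v Qorth[OF v] unfolding cong by simp
      finally have 1: "(LINT \<xi>:I_ref|lebesgue. (W \<xi> - poly ?Q \<xi>) * poly v \<xi> - (W \<xi> - poly q \<xi>) * poly v \<xi>) = 0" .
      have "poly v \<xi> * poly r \<xi> = (W \<xi> - poly ?Q \<xi>) * poly v \<xi> - (W \<xi> - poly q \<xi>) * poly v \<xi>" for \<xi>
        by (simp add: r_def algebra_simps)
      then show ?thesis using 1 by (simp only:)
    qed
    have "degree r \<le> p"
      unfolding r_def using q degQ by (intro degree_diff_le) auto
    then obtain b where b: "r = (\<Sum>n\<le>p. smult (b n) (legendre n))" by (rule legendre_span)
    have b0: "b n = 0" if n: "n < p" for n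
    proof -
      have "0 = (LINT \<xi>:I_ref|lebesgue. poly (legendre n) \<xi> * poly r \<xi>)"
        by (rule ro[symmetric]) (simp add: degree_legendre n)
      also have "\<dots> = (\<Sum>j\<le>p. b j * (LINT x:I_ref|lebesgue. poly (legendre n) x * poly (legendre j) x))"
        unfolding b by (rule set_integral_poly_sum) (rule leg_int(2)[OF W_cont])
      also have "\<dots> = b n * (2 / (2 * real n + 1))"
        using n by (simp add: legendre_orthogonality if_distrib cong: if_cong)
      finally show ?thesis by (simp add: add_nonneg_eq_0_iff)
    qed
    have "r = (\<Sum>n\<in>{p}. smult (b n) (legendre n))"
      unfolding b by (rule sum.mono_neutral_right) (auto simp: b0)
    then have r: "r = smult (b p) (legendre p)" by simp
    have "poly r a = 0" using q Qa Wa by (simp add: r_def)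
    then have "b p = 0" using nz by (simp add: r)
    then show "q = ?Q" using r by (simp add: r_def)
  qed
qed

text \<open>The shift has degree at most \<open>p\<close>, so it adds to the projection error in
  squares. The squared norm of \<open>legendre p\<close> is at most \<open>1 / p\<close>, whence the
  factor \<open>p powr (- 1 / 2)\<close> on the endpoint error.\<close>

lemma radau_L2:
  "L2_norm I_ref (\<lambda>\<xi>. \<omega> \<xi> - poly (radau_proj a p \<omega>) \<xi>)
     \<le> sqrt (leg_err W p) + \<bar>W a - poly (leg_proj W p) a\<bar> * real p powr (- 1 / 2)"
proof -
  have ab: "\<bar>poly (legendre p) a\<bar> = 1" using a by auto
  have sh: "\<bar>radau_shift\<bar> = \<bar>W a - poly (leg_proj W p) a\<bar>" by (simp add: radau_shift_def ab)
  let ?r = "smult radau_shift (legendre p)"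
  have "(LINT \<xi>:I_ref|lebesgue. (\<omega> \<xi> - poly (radau_proj a p \<omega>) \<xi>)\<^sup>2) = (LINT \<xi>:I_ref|lebesgue. (W \<xi> - poly (leg_proj W p) \<xi> - poly ?r \<xi>)\<^sup>2)"
  proof (rule set_integral_cong_AE)
    show "AE x in lebesgue. x \<in> I_ref \<longrightarrow> (\<omega> x - poly (radau_proj a p \<omega>) x)\<^sup>2 = (W x - poly (leg_proj W p) x - poly ?r x)\<^sup>2"
      using \<omega> by eventually_elim (auto simp: radau_proj_eq algebra_simps)
  qed simp
  also have "\<dots> = leg_err W p + (LINT \<xi>:I_ref|lebesgue. (poly ?r \<xi>)\<^sup>2)"
    by (rule leg_err_pythagoras[OF W_cont]) (auto intro: order_trans[OF degree_smult_le] simp: degree_legendre)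
  also have "(LINT \<xi>:I_ref|lebesgue. (poly ?r \<xi>)\<^sup>2) = (LINT \<xi>:I_ref|lebesgue. radau_shift\<^sup>2 * (poly (legendre p) \<xi> * poly (legendre p) \<xi>))"
    by (simp add: power2_eq_square mult_ac)
  also have "\<dots> = radau_shift\<^sup>2 * (2 / (2 * real p + 1))"
    by (simp only: set_integral_mult_right legendre_norm)
  also have "\<dots> \<le> radau_shift\<^sup>2 * (1 / real p)"
    using p by (intro mult_left_mono) (auto simp: field_simps)
  also have "\<dots> = (\<bar>radau_shift\<bar> * real p powr (- 1 / 2))\<^sup>2"
  proof -
    have "real p powr (- 1 / 2) = 1 / sqrt (real p)"
      using p powr_minus_divide[of "real p" "1 / 2"] by (simp add: powr_half_sqrt)
    then show ?thesis using p by (simp add: power_mult_distrib power_divide)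
  qed
  finally have "(LINT \<xi>:I_ref|lebesgue. (\<omega> \<xi> - poly (radau_proj a p \<omega>) \<xi>)\<^sup>2) \<le> leg_err W p + (\<bar>radau_shift\<bar> * real p powr (- 1 / 2))\<^sup>2" by simp
  then have "L2_norm I_ref (\<lambda>\<xi>. \<omega> \<xi> - poly (radau_proj a p \<omega>) \<xi>) \<le> sqrt (leg_err W p + (\<bar>radau_shift\<bar> * real p powr (- 1 / 2))\<^sup>2)"
    by (simp add: L2_norm_def)
  also have "\<dots> \<le> sqrt (leg_err W p) + sqrt ((\<bar>radau_shift\<bar> * real p powr (- 1 / 2))\<^sup>2)"
    by (rule sqrt_add_le_add_sqrt) (auto intro: leg_err_nonneg[OF W_cont])
  also have "sqrt ((\<bar>radau_shift\<bar> * real p powr (- 1 / 2))\<^sup>2) = \<bar>W a - poly (leg_proj W p) a\<bar> * real p powr (- 1 / 2)"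
    by (simp add: sh abs_mult)
  finally show ?thesis by simp
qed

text \<open>The shift carries the error at \<open>a\<close> to \<open>- a\<close> with the sign
  \<open>(-1) ^ p\<close>. The two endpoint errors then combine, up to sign, into the left side of
  \<open>leg_proj_endpoints\<close> with \<open>n = p\<close>.\<close>

lemma radau_opposite_endpoint:
  "\<bar>cont_rep I_ref \<omega> (- a) - poly (radau_proj a p \<omega>) (- a)\<bar> = \<bar>LINT x:I_ref|lebesgue. w x * poly (legendre p) x\<bar>"
proof -
  have Wa: "cont_rep I_ref \<omega> (- a) = W (- a)"
    by (rule cont_rep_eq[OF W_cont \<omega>]) (use a in auto)
  have s: "(-1::real) ^ p = 1 \<or> (-1::real) ^ p = -1" by (cases "even p") auto
  show ?thesis
    unfolding Wa radau_proj_eq leg_proj_endpoints[of p p, simplified, symmetric]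
    using a s by (auto simp: radau_shift_def abs_if)
qed

end

end

section \<open>Error estimates\<close>

lemma linear_combination_bound:
  fixes f :: "nat \<Rightarrow> nat \<Rightarrow> real"
  assumes "\<And>i. i < m \<Longrightarrow> \<exists>C>0. \<forall>n\<ge>1. \<bar>f i n\<bar> \<le> C * real n powr (- s)"
  shows "\<exists>C>0. \<forall>n\<ge>1. \<forall>d. \<bar>\<Sum>i<m. d i * f i n\<bar> \<le> C * real n powr (- s) * (\<Sum>i<m. \<bar>d i\<bar>)"
  using assms
proof (induction m)
  case 0
  show ?case by (intro exI[of _ 1]) simp
next
  case (Suc m)
  have "\<exists>C>0. \<forall>n\<ge>1. \<forall>d. \<bar>\<Sum>i<m. d i * f i n\<bar> \<le> C * real n powr (- s) * (\<Sum>i<m. \<bar>d i\<bar>)"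
    by (rule Suc.IH) (rule Suc.prems, simp)
  then obtain C where C: "C > 0" "\<And>n d. n \<ge> 1 \<Longrightarrow> \<bar>\<Sum>i<m. d i * f i n\<bar> \<le> C * real n powr (- s) * (\<Sum>i<m. \<bar>d i\<bar>)"
    by blast
  obtain D where D: "D > 0" "\<And>n. n \<ge> 1 \<Longrightarrow> \<bar>f m n\<bar> \<le> D * real n powr (- s)"
    using Suc.prems[of m] by auto
  have "\<bar>\<Sum>i<Suc m. d i * f i n\<bar> \<le> (C + D) * real n powr (- s) * (\<Sum>i<Suc m. \<bar>d i\<bar>)" if n: "n \<ge> 1" for n d
  proof -
    have "\<bar>\<Sum>i<Suc m. d i * f i n\<bar> \<le> \<bar>\<Sum>i<m. d i * f i n\<bar> + \<bar>d m\<bar> * \<bar>f m n\<bar>"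
      using abs_triangle_ineq[of "\<Sum>i<m. d i * f i n" "d m * f m n"] by (simp add: abs_mult)
    also have "\<dots> \<le> C * real n powr (- s) * (\<Sum>i<m. \<bar>d i\<bar>) + \<bar>d m\<bar> * (D * real n powr (- s))"
      by (intro add_mono C(2) n mult_left_mono D(2)) auto
    also have "\<dots> \<le> (C + D) * real n powr (- s) * (\<Sum>i<m. \<bar>d i\<bar>) + \<bar>d m\<bar> * ((C + D) * real n powr (- s))"
      using C(1) D(1) by (intro add_mono mult_right_mono mult_left_mono sum_nonneg) auto
    finally show ?thesis by (simp add: algebra_simps)
  qed
  then show ?case using C(1) D(1) by (intro exI[of _ "C + D"]) auto
qed

text \<open>The exponents, divisors and the order are left free to serve both
  \<open>frac_density\<close> and \<open>frac_expansion\<close>. Orthogonality removes the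
  polynomial, and exchanging integrals tests \<open>h\<close> against
  \<open>legendre_tail\<close>.\<close>

lemma legendre_functional:
  assumes q: "degree q < n" and e: "\<And>i. i < m \<Longrightarrow> e i > -1" and g: "g > 0"
    and h: "set_integrable lebesgue I_ref h"
  shows "(LINT x:I_ref|lebesgue. (poly q x + (\<Sum>i<m. d i * (1 + x) powr e i / G i) + RL g h x) * poly (legendre n) x)
    = (\<Sum>i<m. d i * (moment n (e i) / G i)) + (LINT t:I_ref|lebesgue. h t * legendre_tail n g t) / Gamma g"
proof -
  let ?P = "legendre n"
  have i1: "set_integrable lebesgue I_ref (\<lambda>x. poly ?P x * poly q x)"
    by (intro set_integrable_continuous continuous_intros)
  have i2: "set_integrable lebesgue I_ref (\<lambda>x. d i / G i * ((1 + x) powr e i * poly ?P x))" if "i < m" for i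
    using set_integrable_powr_poly[OF e[OF that], of ?P] by simp
  have iS: "set_integrable lebesgue I_ref (\<lambda>x. \<Sum>i<m. d i / G i * ((1 + x) powr e i * poly ?P x))"
    using i2 by (intro set_integral_sum) auto
  have i3: "set_integrable lebesgue I_ref (\<lambda>x. RL g h x * poly ?P x)"
    by (rule RL_swap_continuous(1)[OF h _ g]) (intro continuous_intros)
  have "(LINT x:I_ref|lebesgue. (poly q x + (\<Sum>i<m. d i * (1 + x) powr e i / G i) + RL g h x) * poly ?P x)
    = (LINT x:I_ref|lebesgue. poly ?P x * poly q x + (\<Sum>i<m. d i / G i * ((1 + x) powr e i * poly ?P x)) + RL g h x * poly ?P x)"
  proof -
    have "(poly q x + (\<Sum>i<m. d i * (1 + x) powr e i / G i) + RL g h x) * poly ?P x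
      = poly ?P x * poly q x + (\<Sum>i<m. d i / G i * ((1 + x) powr e i * poly ?P x)) + RL g h x * poly ?P x" for x
      unfolding distrib_right sum_distrib_right by (simp add: mult_ac)
    then show ?thesis by (simp only:)
  qed
  also have "\<dots> = (LINT x:I_ref|lebesgue. poly ?P x * poly q x) + (LINT x:I_ref|lebesgue. \<Sum>i<m. d i / G i * ((1 + x) powr e i * poly ?P x))
      + (LINT x:I_ref|lebesgue. RL g h x * poly ?P x)"
    by (simp only: set_integral_add(2)[OF set_integral_add(1)[OF i1 iS] i3] set_integral_add(2)[OF i1 iS])
  also have "(LINT x:I_ref|lebesgue. \<Sum>i<m. d i / G i * ((1 + x) powr e i * poly ?P x)) = (\<Sum>i<m. LINT x:I_ref|lebesgue. d i / G i * ((1 + x) powr e i * poly ?P x))"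
    using i2 by (intro set_integral_sum) auto
  also have "\<dots> = (\<Sum>i<m. d i * (moment n (e i) / G i))"
    by (simp add: moment_def)
  also have "(LINT x:I_ref|lebesgue. RL g h x * poly ?P x) = (LINT t:I_ref|lebesgue. h t * legendre_tail n g t) / Gamma g"
    unfolding legendre_tail_def by (rule RL_swap_continuous(3)[OF h _ g]) (intro continuous_intros)
  finally show ?thesis using legendre_orthogonal[OF q] by simp
qed

lemma tail_functional_bound:
  assumes g: "g > 0"
  shows "\<exists>C>0. \<forall>n\<ge>1. \<forall>h. set_integrable lebesgue I_ref h \<longrightarrow>
    \<bar>(LINT t:I_ref|lebesgue. h t * legendre_tail n g t) / Gamma g\<bar>
      \<le> C * real n powr (- min (2 * g) (g + 1 / 2)) * (LINT t:I_ref|lebesgue. \<bar>h t\<bar>)"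
proof -
  obtain C where C: "C > 0" "\<And>n t. n \<ge> 1 \<Longrightarrow> t \<in> I_ref \<Longrightarrow> \<bar>legendre_tail n g t\<bar> \<le> C * real n powr (- min (2 * g) (g + 1 / 2))"
    using legendre_tail_bound[OF g] by blast
  have G: "Gamma g > 0" by (rule Gamma_real_pos[OF g])
  have "\<bar>(LINT t:I_ref|lebesgue. h t * legendre_tail n g t) / Gamma g\<bar>
      \<le> C / Gamma g * real n powr (- min (2 * g) (g + 1 / 2)) * (LINT t:I_ref|lebesgue. \<bar>h t\<bar>)"
    if n: "n \<ge> 1" and h: "set_integrable lebesgue I_ref h" for n h
  proof -
    have "set_integrable lebesgue I_ref (\<lambda>t. h t * legendre_tail n g t)"
      unfolding legendre_tail_def by (rule RL_swap_continuous(2)[OF h _ g]) (intro continuous_intros)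
    then have "\<bar>LINT t:I_ref|lebesgue. h t * legendre_tail n g t\<bar> \<le> C * real n powr (- min (2 * g) (g + 1 / 2)) * (LINT t:I_ref|lebesgue. \<bar>h t\<bar>)"
      by (intro set_integral_mult_bound h C(2) n)
    then have "\<bar>LINT t:I_ref|lebesgue. h t * legendre_tail n g t\<bar> / Gamma g \<le> C * real n powr (- min (2 * g) (g + 1 / 2)) * (LINT t:I_ref|lebesgue. \<bar>h t\<bar>) / Gamma g"
      using G by (intro divide_right_mono) auto
    then show ?thesis using G by simp
  qed
  then show ?thesis using C G by (intro exI[of _ "C / Gamma g"]) auto
qed

lemma powr_neg_mono: "n \<ge> 1 \<Longrightarrow> t \<le> s \<Longrightarrow> real n powr (- s) \<le> real n powr (- t)"
  by (intro powr_mono) auto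

lemma moment_combination_bound:
  fixes e G :: "nat \<Rightarrow> real"
  assumes e: "\<And>i. i < m \<Longrightarrow> e i > -1" and s: "\<And>i. i < m \<Longrightarrow> s \<le> 2 * e i + 2"
  shows "\<exists>C>0. \<forall>n\<ge>1. \<forall>d. \<bar>\<Sum>i<m. d i * (moment n (e i) / G i)\<bar> \<le> C * real n powr (- s) * (\<Sum>i<m. \<bar>d i\<bar>)"
    and "\<exists>C>0. \<forall>n\<ge>1. \<forall>d. \<bar>\<Sum>i<m. d i * ((moment n (e i) + moment (Suc n) (e i)) / G i)\<bar> \<le> C * real n powr (- (s + 1)) * (\<Sum>i<m. \<bar>d i\<bar>)"
proof -
  have ex: "\<exists>C>0. (\<forall>n\<ge>1. \<bar>moment n (e i) / G i\<bar> \<le> C * real n powr (- s)) \<and>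
      (\<forall>n\<ge>1. \<bar>(moment n (e i) + moment (Suc n) (e i)) / G i\<bar> \<le> C * real n powr (- (s + 1)))" if i: "i < m" for i
  proof -
    obtain C where C: "C > 0" "\<And>n. n \<ge> 1 \<Longrightarrow> \<bar>moment n (e i)\<bar> \<le> C * real n powr (- (2 * e i + 2))"
      using moment_bound[OF e[OF i]] by blast
    \<comment> \<open>The factor \<open>1 + (2 * e i + 2)\<close> dominates both 1, for a single
      moment, and \<open>2 * e i + 2\<close>, for the sum in \<open>moment_add_Suc\<close>. The
      conditional allows for division by \<open>G i = 0\<close>, which gives 0.\<close>
    define D where "D = C * (1 + (2 * e i + 2)) / (if G i = 0 then 1 else \<bar>G i\<bar>)"
    have ei: "2 * e i + 2 > 0" using e[OF i] by simp
    have D: "D > 0" using C ei by (auto simp: D_def intro!: divide_pos_pos mult_pos_pos)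
    have mom: "\<bar>moment n (e i)\<bar> \<le> C * real n powr (- s)" if n: "n \<ge> 1" for n
    proof -
      have "C * real n powr (- (2 * e i + 2)) \<le> C * real n powr (- s)"
        using C(1) s[OF i] n by (intro mult_left_mono powr_neg_mono) auto
      then show ?thesis using C(2)[OF n] by linarith
    qed
    have div: "\<bar>z / G i\<bar> \<le> D * r" if z: "\<bar>z\<bar> \<le> C * (1 + (2 * e i + 2)) * r" and r: "r \<ge> 0" for z r
    proof (cases "G i = 0")
      case True then show ?thesis using D r by simp
    next
      case False
      have "\<bar>z\<bar> / \<bar>G i\<bar> \<le> C * (1 + (2 * e i + 2)) * r / \<bar>G i\<bar>"
        using z by (intro divide_right_mono) auto
      then show ?thesis using False by (simp add: D_def)
    qed
    have "\<bar>moment n (e i) / G i\<bar> \<le> D * real n powr (- s)" if n: "n \<ge> 1" for n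
    proof (rule div)
      have "C * real n powr (- s) * 1 \<le> C * real n powr (- s) * (1 + (2 * e i + 2))"
        using C(1) ei by (intro mult_left_mono) auto
      then show "\<bar>moment n (e i)\<bar> \<le> C * (1 + (2 * e i + 2)) * real n powr (- s)"
        using mom[OF n] by (simp add: mult_ac)
    qed simp
    moreover have "\<bar>(moment n (e i) + moment (Suc n) (e i)) / G i\<bar> \<le> D * real n powr (- (s + 1))" if n: "n \<ge> 1" for n
    proof (rule div)
      have n0: "real n > 0" using n by simp
      have "\<bar>moment n (e i) + moment (Suc n) (e i)\<bar> = (2 * e i + 2) / (real n + e i + 2) * \<bar>moment n (e i)\<bar>"
        unfolding moment_add_Suc[OF e[OF i]] using e[OF i] by (simp add: abs_mult)
      also have "\<dots> \<le> (1 + (2 * e i + 2)) / real n * (C * real n powr (- s))"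
        using mom[OF n] ei n0 by (intro mult_mono frac_le) auto
      also have "\<dots> = C * (1 + (2 * e i + 2)) * (real n powr (- s) / real n powr 1)" using n0 by simp
      also have "real n powr (- s) / real n powr 1 = real n powr (- (s + 1))"
        by (simp only: powr_diff[symmetric] minus_add_distrib diff_conv_add_uminus)
      finally show "\<bar>moment n (e i) + moment (Suc n) (e i)\<bar> \<le> C * (1 + (2 * e i + 2)) * real n powr (- (s + 1))" .
    qed simp
    ultimately show ?thesis using D by blast
  qed
  show "\<exists>C>0. \<forall>n\<ge>1. \<forall>d. \<bar>\<Sum>i<m. d i * (moment n (e i) / G i)\<bar> \<le> C * real n powr (- s) * (\<Sum>i<m. \<bar>d i\<bar>)"
  proof (rule linear_combination_bound[where f = "\<lambda>i n. moment n (e i) / G i"])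
    fix i assume "i < m"
    from ex[OF this] show "\<exists>C>0. \<forall>n\<ge>1. \<bar>moment n (e i) / G i\<bar> \<le> C * real n powr (- s)" by blast
  qed
  show "\<exists>C>0. \<forall>n\<ge>1. \<forall>d. \<bar>\<Sum>i<m. d i * ((moment n (e i) + moment (Suc n) (e i)) / G i)\<bar> \<le> C * real n powr (- (s + 1)) * (\<Sum>i<m. \<bar>d i\<bar>)"
  proof (rule linear_combination_bound[where f = "\<lambda>i n. (moment n (e i) + moment (Suc n) (e i)) / G i"])
    fix i assume "i < m"
    from ex[OF this] show "\<exists>C>0. \<forall>n\<ge>1. \<bar>(moment n (e i) + moment (Suc n) (e i)) / G i\<bar> \<le> C * real n powr (- (s + 1))" by blast
  qed
qed

lemma add_bound:
  fixes n :: nat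
  assumes "\<bar>x\<bar> \<le> A * real n powr (- s) * X" "\<bar>y\<bar> \<le> B * real n powr (- t) * Y"
    and "n \<ge> 1" "r \<le> s" "r \<le> t" "A \<ge> 0" "B \<ge> 0" "X \<ge> 0" "Y \<ge> 0"
  shows "\<bar>x + y\<bar> \<le> (A + B) * real n powr (- r) * (Y + X)"
proof -
  have "\<bar>x + y\<bar> \<le> \<bar>x\<bar> + \<bar>y\<bar>" by (rule abs_triangle_ineq)
  also have "\<bar>x\<bar> \<le> (A + B) * real n powr (- r) * X"
    by (rule order_trans[OF assms(1)]) (use assms in \<open>intro mult_right_mono mult_mono powr_neg_mono; simp\<close>)
  also have "\<bar>y\<bar> \<le> (A + B) * real n powr (- r) * Y"
    by (rule order_trans[OF assms(2)]) (use assms in \<open>intro mult_right_mono mult_mono powr_neg_mono; simp\<close>)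
  finally show ?thesis by (simp add: algebra_simps)
qed

text \<open>In the second bound only the moments gain a power of \<open>n\<close>, through
  \<open>moment_add_Suc\<close>; the two tails are added by the triangle inequality.\<close>

lemma density_functional_bound:
  assumes \<alpha>: "\<alpha> > 0" and m: "m \<ge> 1"
  shows "\<exists>C>0. \<forall>n\<ge>1. \<forall>q d h. degree q < n \<longrightarrow> set_integrable lebesgue I_ref h \<longrightarrow>
    \<bar>LINT x:I_ref|lebesgue. frac_density \<alpha> m q d h x * poly (legendre n) x\<bar>
      \<le> C * real n powr (- min (2 * \<alpha>) (\<alpha> + real m - 1 / 2)) * ((LINT t:I_ref|lebesgue. \<bar>h t\<bar>) + (\<Sum>i<m. \<bar>d i\<bar>))"
    and "\<exists>C>0. \<forall>n\<ge>1. \<forall>q d h. degree q < n \<longrightarrow> set_integrable lebesgue I_ref h \<longrightarrow>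
    \<bar>(LINT x:I_ref|lebesgue. frac_density \<alpha> m q d h x * poly (legendre n) x)
       + (LINT x:I_ref|lebesgue. frac_density \<alpha> m q d h x * poly (legendre (Suc n)) x)\<bar>
      \<le> C * real n powr (- (min (2 * \<alpha> + 1) (\<alpha> + real m - 1 / 2) - 1 / 2)) * ((LINT t:I_ref|lebesgue. \<bar>h t\<bar>) + (\<Sum>i<m. \<bar>d i\<bar>))"
proof -
  define g where "g = \<alpha> + real m - 1"
  have g: "g > 0" using \<alpha> m by (simp add: g_def)
  define G where "G i = Gamma (\<alpha> + real i)" for i
  define e where "e i = \<alpha> + real i - 1" for i
  have e: "e i > -1" "2 * \<alpha> \<le> 2 * e i + 2" for i using \<alpha> by (auto simp: e_def)
  have mom: "\<exists>C>0. \<forall>n\<ge>1. \<forall>d. \<bar>\<Sum>i<m. d i * (moment n (e i) / G i)\<bar> \<le> C * real n powr (- (2 * \<alpha>)) * (\<Sum>i<m. \<bar>d i\<bar>)"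
    and mom2: "\<exists>C>0. \<forall>n\<ge>1. \<forall>d. \<bar>\<Sum>i<m. d i * ((moment n (e i) + moment (Suc n) (e i)) / G i)\<bar> \<le> C * real n powr (- (2 * \<alpha> + 1)) * (\<Sum>i<m. \<bar>d i\<bar>)"
    by (rule moment_combination_bound; rule e)+
  obtain C1 where C1: "C1 > 0" "\<And>n d. n \<ge> 1 \<Longrightarrow> \<bar>\<Sum>i<m. d i * (moment n (e i) / G i)\<bar> \<le> C1 * real n powr (- (2 * \<alpha>)) * (\<Sum>i<m. \<bar>d i\<bar>)"
    using mom by blast
  obtain C2 where C2: "C2 > 0" "\<And>n d. n \<ge> 1 \<Longrightarrow> \<bar>\<Sum>i<m. d i * ((moment n (e i) + moment (Suc n) (e i)) / G i)\<bar> \<le> C2 * real n powr (- (2 * \<alpha> + 1)) * (\<Sum>i<m. \<bar>d i\<bar>)"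
    using mom2 by blast
  define T where "T h n = (LINT t:I_ref|lebesgue. h t * legendre_tail n g t) / Gamma g" for h n
  define r where "r = min (2 * g) (g + 1 / 2)"
  obtain C3 where C3: "C3 > 0" "\<And>n h. n \<ge> 1 \<Longrightarrow> set_integrable lebesgue I_ref h \<Longrightarrow> \<bar>T h n\<bar> \<le> C3 * real n powr (- r) * (LINT t:I_ref|lebesgue. \<bar>h t\<bar>)"
    unfolding T_def r_def using tail_functional_bound[OF g] by blast
  have fn: "(LINT x:I_ref|lebesgue. frac_density \<alpha> m q d h x * poly (legendre n) x) = (\<Sum>i<m. d i * (moment n (e i) / G i)) + T h n"
    if "degree q < n" "set_integrable lebesgue I_ref h" for q d h n
    unfolding frac_density_def T_def g_def e_def G_def
    using that e g by (intro legendre_functional) (auto simp: e_def g_def degree_pderiv)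
  let ?U = "\<lambda>h d. (LINT t:I_ref|lebesgue. \<bar>h t\<bar>) + (\<Sum>i<m. \<bar>d i\<bar>)"
  have "\<bar>LINT x:I_ref|lebesgue. frac_density \<alpha> m q d h x * poly (legendre n) x\<bar>
      \<le> (C1 + C3) * real n powr (- min (2 * \<alpha>) (\<alpha> + real m - 1 / 2)) * ?U h d"
    if n: "n \<ge> 1" and q: "degree q < n" and h: "set_integrable lebesgue I_ref h" for n q d h
    unfolding fn[OF q h]
  proof (rule add_bound[OF C1(2)[OF n] C3(2)[OF n h] n])
    show "min (2 * \<alpha>) (\<alpha> + real m - 1 / 2) \<le> r"
    \<comment> \<open>For \<open>m = 1\<close> the order \<open>g\<close> is
      \<open>\<alpha>\<close>, possibly below \<open>1 / 2\<close>, and the two minima coincide. For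
      \<open>m \<ge> 2\<close> it exceeds 1, so \<open>r = g + 1 / 2\<close>.\<close>
    proof (cases "m = 1")
      case False
      then have "real m \<ge> 2" using m by linarith
      then show ?thesis using \<alpha> by (simp add: r_def g_def min_def)
    qed (simp add: r_def g_def)
  qed (use C1 C3 in \<open>auto intro!: sum_nonneg set_integral_abs_nonneg\<close>)
  then show "\<exists>C>0. \<forall>n\<ge>1. \<forall>q d h. degree q < n \<longrightarrow> set_integrable lebesgue I_ref h \<longrightarrow>
    \<bar>LINT x:I_ref|lebesgue. frac_density \<alpha> m q d h x * poly (legendre n) x\<bar>
      \<le> C * real n powr (- min (2 * \<alpha>) (\<alpha> + real m - 1 / 2)) * ?U h d"
    using C1 C3 by (intro exI[of _ "C1 + C3"]) auto
  have "\<bar>(LINT x:I_ref|lebesgue. frac_density \<alpha> m q d h x * poly (legendre n) x)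
       + (LINT x:I_ref|lebesgue. frac_density \<alpha> m q d h x * poly (legendre (Suc n)) x)\<bar>
      \<le> (C2 + 2 * C3) * real n powr (- (min (2 * \<alpha> + 1) (\<alpha> + real m - 1 / 2) - 1 / 2)) * ?U h d"
    if n: "n \<ge> 1" and q: "degree q < n" and h: "set_integrable lebesgue I_ref h" for n q d h
  proof -
    let ?H = "LINT t:I_ref|lebesgue. \<bar>h t\<bar>"
    have eq: "(LINT x:I_ref|lebesgue. frac_density \<alpha> m q d h x * poly (legendre n) x)
       + (LINT x:I_ref|lebesgue. frac_density \<alpha> m q d h x * poly (legendre (Suc n)) x)
      = (\<Sum>i<m. d i * ((moment n (e i) + moment (Suc n) (e i)) / G i)) + (T h n + T h (Suc n))"
      using q by (simp add: fn[OF q h] fn[OF _ h] add_divide_distrib distrib_left sum.distrib)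
    have "\<bar>T h (Suc n)\<bar> \<le> C3 * real (Suc n) powr (- r) * ?H" by (rule C3(2)[OF _ h]) simp
    also have "\<dots> \<le> C3 * real n powr (- r) * ?H"
      using C3 n g by (intro mult_right_mono mult_left_mono powr_mono2' set_integral_abs_nonneg) (auto simp: r_def)
    finally have T: "\<bar>T h n + T h (Suc n)\<bar> \<le> (2 * C3) * real n powr (- r) * ?H"
      using C3(2)[OF n h] by linarith
    show ?thesis
      unfolding eq
    proof (rule add_bound[OF C2(2)[OF n] T n])
      \<comment> \<open>The left side is at most \<open>\<alpha> + real m - 1 = g\<close>, and
        \<open>g \<le> r\<close>.\<close>
      show "min (2 * \<alpha> + 1) (\<alpha> + real m - 1 / 2) - 1 / 2 \<le> r"
        using g by (simp add: r_def g_def min_def)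
    qed (use C2 C3 in \<open>auto intro!: sum_nonneg set_integral_abs_nonneg simp: min_def\<close>)
  qed
  then show "\<exists>C>0. \<forall>n\<ge>1. \<forall>q d h. degree q < n \<longrightarrow> set_integrable lebesgue I_ref h \<longrightarrow>
    \<bar>(LINT x:I_ref|lebesgue. frac_density \<alpha> m q d h x * poly (legendre n) x)
       + (LINT x:I_ref|lebesgue. frac_density \<alpha> m q d h x * poly (legendre (Suc n)) x)\<bar>
      \<le> C * real n powr (- (min (2 * \<alpha> + 1) (\<alpha> + real m - 1 / 2) - 1 / 2)) * ?U h d"
    using C2 C3 by (intro exI[of _ "C2 + 2 * C3"]) auto
qed

text \<open>The normalising factor \<open>(2 * n + 1) / 2\<close> costs one power, so the inner
  product must decay one power faster. Moments with exponents at least \<open>\<alpha>\<close> give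
  \<open>2 * \<alpha> + 2\<close>, and the order \<open>g = \<alpha> + m \<ge> 1\<close> puts the
  tail into the branch \<open>g + 1 / 2\<close>.\<close>

lemma leg_coeff_expansion_bound:
  assumes \<alpha>: "\<alpha> > 0" and m: "m \<ge> 1"
  shows "\<exists>C>0. \<forall>n\<ge>1. \<forall>q d h. degree q < n \<longrightarrow> set_integrable lebesgue I_ref h \<longrightarrow>
    \<bar>leg_coeff (frac_expansion \<alpha> m q d h) n\<bar>
      \<le> C * real n powr (- min (2 * \<alpha> + 1) (\<alpha> + real m - 1 / 2)) * ((LINT t:I_ref|lebesgue. \<bar>h t\<bar>) + (\<Sum>i<m. \<bar>d i\<bar>))"
proof -
  define g where "g = \<alpha> + real m"
  have g: "g \<ge> 1" using \<alpha> m by (simp add: g_def)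
  define G where "G i = Gamma (\<alpha> + real i + 1)" for i
  define e where "e i = \<alpha> + real i" for i
  have e: "e i > -1" "2 * \<alpha> + 2 \<le> 2 * e i + 2" for i using \<alpha> by (auto simp: e_def)
  have mom: "\<exists>C>0. \<forall>n\<ge>1. \<forall>d. \<bar>\<Sum>i<m. d i * (moment n (e i) / G i)\<bar> \<le> C * real n powr (- (2 * \<alpha> + 2)) * (\<Sum>i<m. \<bar>d i\<bar>)"
    by (rule moment_combination_bound(1); rule e)
  obtain C1 where C1: "C1 > 0" "\<And>n d. n \<ge> 1 \<Longrightarrow> \<bar>\<Sum>i<m. d i * (moment n (e i) / G i)\<bar> \<le> C1 * real n powr (- (2 * \<alpha> + 2)) * (\<Sum>i<m. \<bar>d i\<bar>)"
    using mom by blast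
  define T where "T h n = (LINT t:I_ref|lebesgue. h t * legendre_tail n g t) / Gamma g" for h n
  obtain C3 where C3: "C3 > 0" "\<And>n h. n \<ge> 1 \<Longrightarrow> set_integrable lebesgue I_ref h \<Longrightarrow> \<bar>T h n\<bar> \<le> C3 * real n powr (- min (2 * g) (g + 1 / 2)) * (LINT t:I_ref|lebesgue. \<bar>h t\<bar>)"
    unfolding T_def using tail_functional_bound[of g] g by fastforce
  let ?U = "\<lambda>h d. (LINT t:I_ref|lebesgue. \<bar>h t\<bar>) + (\<Sum>i<m. \<bar>d i\<bar>)"
  define s where "s = min (2 * \<alpha> + 1) (\<alpha> + real m - 1 / 2)"
  have "\<bar>leg_coeff (frac_expansion \<alpha> m q d h) n\<bar> \<le> 2 * (C1 + C3) * real n powr (- s) * ?U h d"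
    if n: "n \<ge> 1" and q: "degree q < n" and h: "set_integrable lebesgue I_ref h" for n q d h
  proof -
    have n0: "real n > 0" "real n \<ge> 1" using n by auto
    have "(LINT x:I_ref|lebesgue. frac_expansion \<alpha> m q d h x * poly (legendre n) x) = (\<Sum>i<m. d i * (moment n (e i) / G i)) + T h n"
      unfolding frac_expansion_def T_def g_def e_def G_def
      using q h e g by (intro legendre_functional) (auto simp: e_def g_def)
    moreover have "\<bar>(\<Sum>i<m. d i * (moment n (e i) / G i)) + T h n\<bar> \<le> (C1 + C3) * real n powr (- (s + 1)) * ?U h d"
    proof (rule add_bound[OF C1(2)[OF n] C3(2)[OF n h] n])
      show "s + 1 \<le> min (2 * g) (g + 1 / 2)" using g by (simp add: s_def g_def min_def)
    qed (use C1 C3 in \<open>auto intro!: sum_nonneg set_integral_abs_nonneg simp: s_def\<close>)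
    ultimately have "\<bar>LINT x:I_ref|lebesgue. frac_expansion \<alpha> m q d h x * poly (legendre n) x\<bar> \<le> (C1 + C3) * real n powr (- (s + 1)) * ?U h d"
      by simp
    then have "(2 * real n + 1) / 2 * \<bar>LINT x:I_ref|lebesgue. frac_expansion \<alpha> m q d h x * poly (legendre n) x\<bar>
       \<le> (2 * real n) * ((C1 + C3) * real n powr (- (s + 1)) * ?U h d)"
      using n0 by (intro mult_mono) auto
    also have "\<dots> = 2 * (C1 + C3) * (real n powr 1 * real n powr (- (s + 1))) * ?U h d" using n0 by simp
    also have "real n powr 1 * real n powr (- (s + 1)) = real n powr (- s)" by (simp only: powr_add[symmetric]) simp
    finally show ?thesis by (simp add: leg_coeff_def abs_mult)
  qed
  then show ?thesis unfolding s_def using C1 C3 by (intro exI[of _ "2 * (C1 + C3)"]) auto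
qed

lemma half_abs_le:
  fixes z y R :: real
  assumes "2 * z = y" "\<bar>y\<bar> \<le> R"
  shows "\<bar>z\<bar> \<le> R"
  using assms by linarith

lemma half_abs_diff_le:
  fixes z x y R :: real
  assumes "2 * z = x - y" "\<bar>y\<bar> \<le> R" "\<bar>x\<bar> \<le> R"
  shows "\<bar>z\<bar> \<le> R"
  using assms by linarith

theorem theorem2:
  fixes \<alpha> :: real and k m :: nat
  assumes "k \<ge> 1" and "m \<ge> 1" and "real k - 1 < \<alpha>" and "\<alpha> < real k"
  shows "\<exists>C>0. \<forall>p::nat. 1 / 2 < \<alpha> + real m \<and> \<alpha> + real m < real p + 1 \<longrightarrow>
    (\<forall>\<omega> \<in> U_space k \<alpha> m.
       L2_norm I_ref (\<lambda>\<xi>. \<omega> \<xi> - poly (radau_minus p \<omega>) \<xi>)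
         \<le> C * real p powr (- min (2 * \<alpha> + 1) (\<alpha> + real m - 1 / 2)) * U_seminorm k \<alpha> m \<omega> \<and>
       L2_norm I_ref (\<lambda>\<xi>. \<omega> \<xi> - poly (radau_plus p \<omega>) \<xi>)
         \<le> C * real p powr (- min (2 * \<alpha> + 1 / 2) (\<alpha> + real m - 1 / 2)) * U_seminorm k \<alpha> m \<omega> \<and>
       \<bar>cont_rep I_ref \<omega> 1 - poly (radau_plus p \<omega>) 1\<bar>
         \<le> C * real p powr (- min (2 * \<alpha>) (\<alpha> + real m - 1 / 2)) * U_seminorm k \<alpha> m \<omega> \<and>
       \<bar>cont_rep I_ref \<omega> (-1) - poly (radau_minus p \<omega>) (-1)\<bar>
         \<le> C * real p powr (- min (2 * \<alpha>) (\<alpha> + real m - 1 / 2)) * U_seminorm k \<alpha> m \<omega>)"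
proof -
  have \<alpha>: "\<alpha> > 0" using assms by linarith
  note m = assms(2)
  define s1 s2 s3 where "s1 = min (2 * \<alpha> + 1) (\<alpha> + real m - 1 / 2)"
    and "s2 = min (2 * \<alpha> + 1 / 2) (\<alpha> + real m - 1 / 2)"
    and "s3 = min (2 * \<alpha>) (\<alpha> + real m - 1 / 2)"
  \<comment> \<open>\<open>s2 \<le> s1\<close> absorbs the projection error into the bound for
    \<open>radau_plus\<close>, and \<open>s2 \<le> s3 + 1 / 2\<close> the correction at -1.\<close>
  have s: "s1 > 0" "s2 \<le> s1" "s2 \<le> s3 + 1 / 2" "s3 > 0" using \<alpha> m by (auto simp: s1_def s2_def s3_def)
  let ?U = "\<lambda>h d. (LINT t:I_ref|lebesgue. \<bar>h t\<bar>) + (\<Sum>i<m. \<bar>d i\<bar>)"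
  define b where "b q d h n = (LINT x:I_ref|lebesgue. frac_density \<alpha> m q d h x * poly (legendre n) x)" for q d h n
  obtain C1 where C1: "C1 > 0" "\<And>n q d h. n \<ge> 1 \<Longrightarrow> degree q < n \<Longrightarrow> set_integrable lebesgue I_ref h \<Longrightarrow>
      \<bar>b q d h n\<bar> \<le> C1 * real n powr (- s3) * ?U h d"
    using density_functional_bound(1)[OF \<alpha> m] unfolding b_def s3_def by blast
  obtain C2 where C2: "C2 > 0" "\<And>n q d h. n \<ge> 1 \<Longrightarrow> degree q < n \<Longrightarrow> set_integrable lebesgue I_ref h \<Longrightarrow>
      \<bar>b q d h n + b q d h (Suc n)\<bar> \<le> C2 * real n powr (- (s1 - 1 / 2)) * ?U h d"
    using density_functional_bound(2)[OF \<alpha> m] unfolding b_def s1_def by blast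
  obtain C3 where C3: "C3 > 0" "\<And>n q d h. n \<ge> 1 \<Longrightarrow> degree q < n \<Longrightarrow> set_integrable lebesgue I_ref h \<Longrightarrow>
      \<bar>leg_coeff (frac_expansion \<alpha> m q d h) n\<bar> \<le> C3 * real n powr (- s1) * ?U h d"
    using leg_coeff_expansion_bound[OF \<alpha> m] unfolding s1_def by blast
  \<comment> \<open>\<open>C3 / sqrt (2 * s1)\<close> is for the \<open>L2\<close> projection error,
    by \<open>leg_err_bound\<close>; \<open>C2\<close> for the correction at 1; \<open>C1\<close>
    for the correction at -1 and for the free endpoint values.\<close>
  define C where "C = C3 / sqrt (2 * s1) + C2 + C1"
  have C: "C > 0" using C1 C2 C3 s by (auto simp: C_def intro!: add_pos_pos divide_pos_pos)
  have main: "L2_norm I_ref (\<lambda>\<xi>. \<omega> \<xi> - poly (radau_minus p \<omega>) \<xi>) \<le> C * real p powr (- s1) * U_seminorm k \<alpha> m \<omega> \<and>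
       L2_norm I_ref (\<lambda>\<xi>. \<omega> \<xi> - poly (radau_plus p \<omega>) \<xi>) \<le> C * real p powr (- s2) * U_seminorm k \<alpha> m \<omega> \<and>
       \<bar>cont_rep I_ref \<omega> 1 - poly (radau_plus p \<omega>) 1\<bar> \<le> C * real p powr (- s3) * U_seminorm k \<alpha> m \<omega> \<and>
       \<bar>cont_rep I_ref \<omega> (-1) - poly (radau_minus p \<omega>) (-1)\<bar> \<le> C * real p powr (- s3) * U_seminorm k \<alpha> m \<omega>"
    if p: "\<alpha> + real m < real p + 1" and \<omega>: "\<omega> \<in> U_space k \<alpha> m" for p \<omega>
  proof -
    \<comment> \<open>From \<open>k - 1 < \<alpha>\<close> and \<open>m \<ge> 1\<close>. Hence the
      polynomial part has degree below \<open>p\<close> and is invisible to all functionals with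
      \<open>n \<ge> p\<close>.\<close>
    have kp: "k \<le> p" using p assms by linarith
    then have p1: "p \<ge> 1" using assms(1) by simp
    obtain q d h where q: "degree q < k" and h: "set_integrable lebesgue I_ref h"
      and ae: "AE x in lebesgue. x \<in> I_ref \<longrightarrow> \<omega> x = frac_expansion \<alpha> m q d h x"
      and U: "U_seminorm k \<alpha> m \<omega> = ?U h d"
      using U_space_expansion[OF assms \<omega>] .
    define u where "u = ?U h d"
    have u: "u \<ge> 0" unfolding u_def by (intro add_nonneg_nonneg set_integral_abs_nonneg sum_nonneg) auto
    let ?W = "frac_expansion \<alpha> m q d h" and ?w = "frac_density \<alpha> m q d h"
    let ?\<Pi> = "leg_proj ?W p"
    note Ww = set_integrable_frac_density[OF h \<alpha> m, of q d] frac_expansion_eq_RL_1[OF h \<alpha> m, of _ q d]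
    have qn: "degree q < n" if "n \<ge> p" for n using q kp that by simp
    have e: "(?W 1 - poly ?\<Pi> 1) - (-1) ^ n * (?W (-1) - poly ?\<Pi> (-1)) = b q d h n" if "n = p \<or> n = Suc p" for n
      unfolding b_def by (rule leg_proj_endpoints[OF Ww that])
    have b1: "\<bar>b q d h p\<bar> \<le> C1 * real p powr (- s3) * u"
      unfolding u_def by (rule C1(2)[OF p1 qn h]) simp
    have b2: "\<bar>b q d h (Suc p)\<bar> \<le> C1 * real p powr (- s3) * u"
    proof -
      have "\<bar>b q d h (Suc p)\<bar> \<le> C1 * real (Suc p) powr (- s3) * u"
        unfolding u_def by (rule C1(2)[OF _ qn h]) auto
      also have "\<dots> \<le> C1 * real p powr (- s3) * u"
        using C1 u p1 s by (intro mult_right_mono mult_left_mono powr_mono2') auto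
      finally show ?thesis .
    qed
    have b3: "\<bar>b q d h p + b q d h (Suc p)\<bar> \<le> C2 * real p powr (- (s1 - 1 / 2)) * u"
      unfolding u_def by (rule C2(2)[OF p1 qn h]) simp
    have half: "real p powr (- r) * real p powr (- 1 / 2) = real p powr (- (r + 1 / 2))" for r
      by (simp flip: powr_add)
    \<comment> \<open>The signs \<open>(-1) ^ n\<close> for \<open>n = p\<close> and
      \<open>n = Suc p\<close> are opposite: adding the identities \<open>e\<close> isolates the
      endpoint 1, subtracting them the endpoint -1.\<close>
    have "2 * (?W 1 - poly ?\<Pi> 1) = b q d h p + b q d h (Suc p)"
      using e[of p] e[of "Suc p"] by simp
    then have "\<bar>?W 1 - poly ?\<Pi> 1\<bar> \<le> C2 * real p powr (- (s1 - 1 / 2)) * u"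
      using b3 by (rule half_abs_le)
    then have "\<bar>?W 1 - poly ?\<Pi> 1\<bar> * real p powr (- 1 / 2) \<le> C2 * real p powr (- (s1 - 1 / 2)) * u * real p powr (- 1 / 2)"
      by (intro mult_right_mono) auto
    also have "\<dots> = C2 * (real p powr (- (s1 - 1 / 2)) * real p powr (- 1 / 2)) * u" by simp
    also have "\<dots> = C2 * real p powr (- s1) * u" unfolding half by simp
    finally have r1: "\<bar>?W 1 - poly ?\<Pi> 1\<bar> * real p powr (- 1 / 2) \<le> C2 * real p powr (- s1) * u" .
    \<comment> \<open>Here the alternating moments do not cancel, so each functional value is
      estimated on its own, at the rate \<open>s3\<close>.\<close>
    have "2 * ((-1) ^ p * (?W (-1) - poly ?\<Pi> (-1))) = b q d h (Suc p) - b q d h p"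
      using e[of p] e[of "Suc p"] by simp
    then have "\<bar>(-1) ^ p * (?W (-1) - poly ?\<Pi> (-1))\<bar> \<le> C1 * real p powr (- s3) * u"
      using b1 b2 by (rule half_abs_diff_le)
    then have "\<bar>?W (-1) - poly ?\<Pi> (-1)\<bar> \<le> C1 * real p powr (- s3) * u"
      by (simp add: abs_mult power_abs)
    then have "\<bar>?W (-1) - poly ?\<Pi> (-1)\<bar> * real p powr (- 1 / 2) \<le> C1 * real p powr (- s3) * u * real p powr (- 1 / 2)"
      by (intro mult_right_mono) auto
    also have "\<dots> = C1 * (real p powr (- s3) * real p powr (- 1 / 2)) * u" by simp
    also have "\<dots> \<le> C1 * real p powr (- s2) * u"
      unfolding half using C1 u p1 s by (intro mult_right_mono mult_left_mono powr_neg_mono) auto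
    finally have r2: "\<bar>?W (-1) - poly ?\<Pi> (-1)\<bar> * real p powr (- 1 / 2) \<le> C1 * real p powr (- s2) * u" .
    have "leg_err ?W p \<le> (C3 * u)\<^sup>2 / (2 * s1) * real p powr (- (2 * s1))"
    proof (rule leg_err_bound[OF W_cont[OF Ww] s(1) p1])
      fix n assume n: "n > p"
      then show "\<bar>leg_coeff ?W n\<bar> \<le> C3 * u * real n powr (- s1)"
        using C3(2)[OF _ qn h, of n d] by (simp add: u_def mult_ac)
    qed auto
    also have "\<dots> = (C3 / sqrt (2 * s1) * real p powr (- s1) * u)\<^sup>2"
    proof -
      have "real p powr (- (2 * s1)) = (real p powr (- s1))\<^sup>2"
        by (simp add: power2_eq_square flip: powr_add)
      then show ?thesis using s by (simp add: power_mult_distrib power_divide)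
    qed
    finally have "sqrt (leg_err ?W p) \<le> \<bar>C3 / sqrt (2 * s1) * real p powr (- s1) * u\<bar>"
      by (metis real_sqrt_abs real_sqrt_le_mono)
    then have E: "sqrt (leg_err ?W p) \<le> C3 / sqrt (2 * s1) * real p powr (- s1) * u"
      using C3 u s by simp
    have mono: "D * real p powr (- r) * u \<le> D * real p powr (- t) * u" if "t \<le> r" "D \<ge> 0" for D r t
      using that u p1 by (intro mult_right_mono mult_left_mono powr_neg_mono) auto
    have R: "x \<le> C * real p powr (- t) * u"
      if "x \<le> A * real p powr (- t) * u" "A \<le> C" for x A t
      by (rule order_trans[OF that(1)]) (use that(2) u in \<open>intro mult_right_mono; simp\<close>)
    have le: "C3 / sqrt (2 * s1) + C2 \<le> C" "C3 / sqrt (2 * s1) + C1 \<le> C" "C1 \<le> C"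
      using C1 C2 C3 s by (auto simp: C_def)
    have "L2_norm I_ref (\<lambda>\<xi>. \<omega> \<xi> - poly (radau_minus p \<omega>) \<xi>) \<le> (C3 / sqrt (2 * s1) + C2) * real p powr (- s1) * u"
      using radau_L2[OF Ww ae, of 1 p] p1 E r1 by (simp add: distrib_right)
    moreover have "L2_norm I_ref (\<lambda>\<xi>. \<omega> \<xi> - poly (radau_plus p \<omega>) \<xi>) \<le> (C3 / sqrt (2 * s1) + C1) * real p powr (- s2) * u"
    proof -
      have "C3 / sqrt (2 * s1) * real p powr (- s1) * u \<le> C3 / sqrt (2 * s1) * real p powr (- s2) * u"
        using C3 s by (intro mono) auto
      then show ?thesis using radau_L2[OF Ww ae, of "-1" p] p1 E r2 by (simp add: distrib_right)
    qed
    moreover have "\<bar>cont_rep I_ref \<omega> 1 - poly (radau_plus p \<omega>) 1\<bar> \<le> C1 * real p powr (- s3) * u"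
      using radau_opposite_endpoint[OF Ww ae, of "-1" p] p1 b1 by (simp add: b_def)
    moreover have "\<bar>cont_rep I_ref \<omega> (-1) - poly (radau_minus p \<omega>) (-1)\<bar> \<le> C1 * real p powr (- s3) * u"
      using radau_opposite_endpoint[OF Ww ae, of 1 p] p1 b1 by (simp add: b_def)
    ultimately show ?thesis unfolding U u_def[symmetric] using R le by blast
  qed
  show ?thesis
    by (intro exI[of _ C] conjI C allI impI ballI main[unfolded s1_def s2_def s3_def, THEN conjunct1]
        main[unfolded s1_def s2_def s3_def, THEN conjunct2, THEN conjunct1]
        main[unfolded s1_def s2_def s3_def, THEN conjunct2, THEN conjunct2, THEN conjunct1]
        main[unfolded s1_def s2_def s3_def, THEN conjunct2, THEN conjunct2, THEN conjunct2]) auto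
qed

end
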